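(* Let $D$ be a compact convex domain in the hyperbolic plane $\mathbb{H}$ whose boundary $\partial D$ is $C^1$, and let $L(\partial D)$ be the hyperbolic length of $\partial D$. Let $f\in C^1(\mathbb{R};\mathbb{R})$. Then $$\int_{\mathcal{G}_{D}}(f\circ\rho_D)\,\mathrm{d}\mu=\int_{\mathcal{G}_{D}}(f'\circ\rho_D)\,\sinh\rho_D\,\cot\alpha_1\cot\alpha_2\,\mathrm{d}\mu+\frac{1}{2}f(0)L(\partial D).$$ In particular, if $f(0)=0$, then one has the hyperbolic version of the Pleijel identity: $$\int_{\mathcal{G}_{D}}(f\circ\rho_D)\,\mathrm{d}\mu=\int_{\mathcal{G}_{D}}(f'\circ\rho_D)\,\sinh\rho_D\,\cot\alpha_1\cot\alpha_2\,\mathrm{d}\mu.$$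
   Context: $\mathbb{H}$ is the hyperbolic plane (curvature $-1$), e.g. the upper half plane with metric $\mathrm{d}s^2=(\mathrm{d}x^2+\mathrm{d}y^2)/y^2$. $\mathcal{G}_{\mathbb{H}}$ is the set of (unoriented, complete) geodesics of $\mathbb{H}$, identified with unordered pairs of distinct points $\{u,v\}$ of $\partial\mathbb{H}=\mathbb{R}\cup\{\infty\}$. $\mu$ is the Liouville measure on $\mathcal{G}_{\mathbb{H}}$, the isometry-invariant measure normalized as $\mathrm{d}\mu=\frac{\mathrm{d}u\,\mathrm{d}v}{|u-v|^2}$; equivalently, on the set of geodesics crossing a given geodesic, $\mathrm{d}\mu=\frac12\sin\alpha\,\mathrm{d}l\,\mathrm{d}\alpha$, where $l$ is the arclength position of the crossing point and $\alpha\in(0,\pi)$ the crossing angle. $\mathcal{G}_D\subset\mathcal{G}_{\mathbb{H}}$ is the set of geodesics intersecting $D$. For $\gamma\in\mathcal{G}_D$, the chord of $\gamma$ is $\gamma\cap D$ and $\rho_D(\gamma)$ is its hyperbolic length. $\alpha_1(\gamma),\alpha_2(\gamma)$ are the two angles between the boundary $\partial D$ and the chord of $\gamma$, at the two endpoints of the chord, lying on the same side of $\gamma$ (the product $\cot\alpha_1\cot\alpha_2$ does not depend on the choice of side).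
   Formalization: The formal theorem also assumes that the boundary of D contains no geodesic segment; otherwise the identity fails, e.g. for f(x)=x the two sides differ by one quarter of the sum of the squared lengths of the boundary segments. *)

theory Defs
  imports "HOL-Analysis.Analysis"
begin

section \<open>The hyperbolic plane and its geodesics\<close>

definition upper_half_plane :: "complex set" where
  "upper_half_plane = {z. 0 < Im z}"

text \<open>Length for the metric \<open>ds\<^sup>2 = (dx\<^sup>2 + dy\<^sup>2) / y\<^sup>2\<close>.\<close>

definition hyp_speed :: "(real \<Rightarrow> complex) \<Rightarrow> real \<Rightarrow> real" where
  "hyp_speed c t = norm (vector_derivative c (at t)) / Im (c t)"

definition hyp_length :: "(real \<Rightarrow> complex) \<Rightarrow> real \<Rightarrow> real \<Rightarrow> real" where
  "hyp_length c a b = integral {a..b} (hyp_speed c)"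

text \<open>Unit speed parametrizations of the geodesic with ideal endpoints \<open>u < v\<close> (run through from
  \<open>u\<close> to \<open>v\<close>) and of the geodesic with ideal endpoints \<open>u\<close> and \<open>\<infinity>\<close>.\<close>

definition semicircle_line :: "real \<Rightarrow> real \<Rightarrow> real \<Rightarrow> complex" where
  "semicircle_line u v t = Complex ((u + v) / 2 + (v - u) / 2 * tanh t) ((v - u) / 2 / cosh t)"

definition vertical_line :: "real \<Rightarrow> real \<Rightarrow> complex" where
  "vertical_line u t = Complex u (exp t)"

definition geodesic_params :: "(real \<Rightarrow> complex) set" where
  "geodesic_params = {semicircle_line u v | u v. u < v} \<union> range vertical_line"

text \<open>Geodesics are unoriented, i.e. point sets. Each of them has exactly one parametrization
  in \<open>geodesic_params\<close>; see \<open>inj_on_geodesic_params\<close> below.\<close>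

definition geodesics :: "complex set set" where
  "geodesics = range ` geodesic_params"

definition param_of :: "complex set \<Rightarrow> real \<Rightarrow> complex" where
  "param_of \<gamma> = inv_into geodesic_params range \<gamma>"

text \<open>The measure \<open>du dv / (u - v)\<^sup>2\<close> on unordered pairs of ideal points. The pairs with \<open>u < v\<close> represent
  each unordered pair of real points once; the geodesics ending at \<open>\<infinity>\<close> form a null set.\<close>

definition liouville :: "complex set measure" where
  "liouville =
     distr (density (restrict_space lborel {(u, v). u < v})
                    (\<lambda>(u, v). ennreal (1 / (v - u)\<^sup>2)))
           (sigma geodesics
              {A. A \<subseteq> geodesics \<and> {(u, v). u < v \<and> range (semicircle_line u v) \<in> A} \<in> sets borel})
           (\<lambda>(u, v). range (semicircle_line u v))"


section \<open>Convex domains and their chords\<close>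

definition hyp_convex :: "complex set \<Rightarrow> bool" where
  "hyp_convex D \<longleftrightarrow>
     (\<forall>g \<in> geodesic_params. \<forall>a b. a \<le> b \<and> g a \<in> D \<and> g b \<in> D \<longrightarrow> g ` {a..b} \<subseteq> D)"

definition compact_convex_domain :: "complex set \<Rightarrow> bool" where
  "compact_convex_domain D \<longleftrightarrow>
     D \<subseteq> upper_half_plane \<and> compact D \<and> interior D \<noteq> {} \<and> hyp_convex D"

definition contains_geodesic_segment :: "complex set \<Rightarrow> bool" where
  "contains_geodesic_segment S \<longleftrightarrow> (\<exists>g \<in> geodesic_params. \<exists>a b. a < b \<and> g ` {a..b} \<subseteq> S)"

text \<open>Regular \<open>C\<^sup>1\<close> parametrization of the boundary as a simple closed curve, 1-periodic on the line so
  that it is \<open>C\<^sup>1\<close> at the base point as well.\<close>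

definition C1_boundary_param :: "complex set \<Rightarrow> (real \<Rightarrow> complex) \<Rightarrow> bool" where
  "C1_boundary_param D c \<longleftrightarrow>
     c C1_differentiable_on UNIV \<and>
     (\<forall>t. vector_derivative c (at t) \<noteq> 0) \<and>
     (\<forall>s t. c s = c t \<longleftrightarrow> s - t \<in> \<int>) \<and>
     range c = frontier D"

definition geodesics_meeting :: "complex set \<Rightarrow> complex set set" where
  "geodesics_meeting D = {\<gamma> \<in> geodesics. \<gamma> \<inter> D \<noteq> {}}"

text \<open>For compact convex \<open>D\<close> the chord \<open>\<gamma> \<inter> D\<close> is the image of the interval from \<open>chord_start D \<gamma>\<close>
  to \<open>chord_end D \<gamma>\<close> under the parametrization of \<open>\<gamma>\<close>.\<close>

definition chord_start :: "complex set \<Rightarrow> complex set \<Rightarrow> real" where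
  "chord_start D \<gamma> = Inf {t. param_of \<gamma> t \<in> \<gamma> \<inter> D}"

definition chord_end :: "complex set \<Rightarrow> complex set \<Rightarrow> real" where
  "chord_end D \<gamma> = Sup {t. param_of \<gamma> t \<in> \<gamma> \<inter> D}"

definition chord_length :: "complex set \<Rightarrow> complex set \<Rightarrow> real" where
  "chord_length D \<gamma> = hyp_length (param_of \<gamma>) (chord_start D \<gamma>) (chord_end D \<gamma>)"

text \<open>The metric is conformal to the Euclidean one, so hyperbolic angles between tangent vectors at a
  common point are Euclidean angles.\<close>

definition vector_angle :: "complex \<Rightarrow> complex \<Rightarrow> real" where
  "vector_angle v w = arccos (v \<bullet> w / (norm v * norm w))"

text \<open>For a point \<open>g t\<close> on the closed curve \<open>c\<close>: the tangent vector of \<open>c\<close> there, with the sign for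
  which it points to the left of \<open>g\<close>. If \<open>c\<close> and \<open>g\<close> are tangent there is no left one and the sign is
  irrelevant: the geodesics tangent to the boundary form a null set.\<close>

definition left_tangent :: "(real \<Rightarrow> complex) \<Rightarrow> (real \<Rightarrow> complex) \<Rightarrow> real \<Rightarrow> complex" where
  "left_tangent c g t =
     (let w = vector_derivative c (at (inv_into {0..<1} c (g t)))
      in if 0 < Im (w * cnj (vector_derivative g (at t))) then w else - w)"

text \<open>The angles on the left of \<open>param_of \<gamma>\<close> between the boundary and the chord, the chord being
  directed from the endpoint in question into \<open>D\<close>.\<close>

definition chord_angle_start :: "complex set \<Rightarrow> (real \<Rightarrow> complex) \<Rightarrow> complex set \<Rightarrow> real" where
  "chord_angle_start D c \<gamma> =
     vector_angle (left_tangent c (param_of \<gamma>) (chord_start D \<gamma>))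
                  (vector_derivative (param_of \<gamma>) (at (chord_start D \<gamma>)))"

definition chord_angle_end :: "complex set \<Rightarrow> (real \<Rightarrow> complex) \<Rightarrow> complex set \<Rightarrow> real" where
  "chord_angle_end D c \<gamma> =
     vector_angle (left_tangent c (param_of \<gamma>) (chord_end D \<gamma>))
                  (- vector_derivative (param_of \<gamma>) (at (chord_end D \<gamma>)))"


section \<open>The geodesics and their measure are as intended\<close>

lemma range_vertical_line: "range (vertical_line u) = {z. Re z = u \<and> 0 < Im z}"
proof -
  have "z \<in> range (vertical_line u)" if "Re z = u" "0 < Im z" for z
    using that by (intro range_eqI[of _ _ "ln (Im z)"]) (simp add: vertical_line_def complex_eq_iff)
  then show ?thesis
    by (auto simp: vertical_line_def)
qed

lemma range_semicircle_line:
  assumes "u < v"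
  shows "range (semicircle_line u v) =
    {z. 0 < Im z \<and> dist z (of_real ((u + v) / 2)) = (v - u) / 2}"
proof (intro set_eqI iffI)
  fix z assume "z \<in> range (semicircle_line u v)"
  then obtain t where z: "z = semicircle_line u v t" by auto
  define r where "r = (v - u) / 2"
  have r: "r > 0" using assms by (simp add: r_def)
  have "(r * tanh t)\<^sup>2 + (r / cosh t)\<^sup>2 = r\<^sup>2 * ((sinh t)\<^sup>2 + 1) / (cosh t)\<^sup>2"
    by (simp add: tanh_def power_mult_distrib power_divide field_simps)
  also have "\<dots> = r\<^sup>2"
    using cosh_real_pos[of t] by (simp add: cosh_square_eq[symmetric])
  finally have "sqrt ((r * tanh t)\<^sup>2 + (r / cosh t)\<^sup>2) = r"
    using r by simp
  then show "z \<in> {z. 0 < Im z \<and> dist z (of_real ((u + v) / 2)) = (v - u) / 2}"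
    using r by (simp add: z semicircle_line_def dist_norm cmod_def r_def cosh_real_pos)
next
  fix z assume "z \<in> {z. 0 < Im z \<and> dist z (of_real ((u + v) / 2)) = (v - u) / 2}"
  then have pos: "0 < Im z" and d: "dist z (of_real ((u + v) / 2)) = (v - u) / 2" by auto
  define r where "r = (v - u) / 2"
  define x where "x = Re z - (u + v) / 2"
  define s where "s = x / Im z"
  define t where "t = arsinh s"
  have r: "r > 0" using assms by (simp add: r_def)
  have "sqrt (x\<^sup>2 + (Im z)\<^sup>2) = r"
    using d by (simp add: dist_norm cmod_def r_def x_def)
  then have sq: "x\<^sup>2 + (Im z)\<^sup>2 = r\<^sup>2"
    by (metis real_sqrt_pow2 add_nonneg_nonneg zero_le_power2)
  have sh: "sinh t = s" by (simp add: t_def)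
  have "(cosh t)\<^sup>2 = (r / Im z)\<^sup>2"
    using sq pos by (simp add: cosh_square_eq sh s_def power_divide field_simps)
  then have ch: "cosh t = r / Im z"
    using r pos by (simp add: power2_eq_iff_nonneg)
  have "z = semicircle_line u v t"
    using r pos unfolding semicircle_line_def r_def[symmetric] tanh_def sh ch s_def
    by (simp add: complex_eq_iff x_def)
  then show "z \<in> range (semicircle_line u v)" by blast
qed

lemma has_vector_derivative_vertical_line:
  "(vertical_line u has_vector_derivative Complex 0 (exp t)) (at t)"
  unfolding vertical_line_def has_vector_derivative_complex_iff
  by (auto intro!: derivative_eq_intros)

lemma has_vector_derivative_semicircle_line:
  "(semicircle_line u v has_vector_derivative
     Complex ((v - u) / 2 / (cosh t)\<^sup>2) (- ((v - u) / 2 * sinh t / (cosh t)\<^sup>2))) (at t)"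
proof -
  have "1 - (tanh t)\<^sup>2 = 1 / (cosh t)\<^sup>2"
    using cosh_real_pos[of t] cosh_square_eq[of t] sum_power2_gt_zero_iff[of "sinh t" 1]
    by (simp add: tanh_def power_divide divide_simps)
  then show ?thesis
    unfolding semicircle_line_def has_vector_derivative_complex_iff
    using cosh_real_pos[of t]
    by (auto intro!: derivative_eq_intros simp: power2_eq_square)
      (simp add: divide_simps)
qed

lemma hyp_speed_geodesic:
  assumes "g \<in> geodesic_params"
  shows "hyp_speed g t = 1"
proof -
  consider (s) u v where "u < v" "g = semicircle_line u v" | (v) u where "g = vertical_line u"
    using assms by (auto simp: geodesic_params_def)
  then show ?thesis
  proof cases
    case s
    define r where "r = (v - u) / 2"
    have r: "r > 0" and C: "cosh t > 0" using s by (simp_all add: r_def)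
    have "(r / (cosh t)\<^sup>2)\<^sup>2 + (r * sinh t / (cosh t)\<^sup>2)\<^sup>2
        = r\<^sup>2 * ((sinh t)\<^sup>2 + 1) / ((cosh t)\<^sup>2)\<^sup>2"
      using C by (simp add: power_mult_distrib power_divide field_simps)
    also have "\<dots> = (r / cosh t)\<^sup>2"
      unfolding cosh_square_eq[symmetric] using C by (simp add: power_divide power2_eq_square)
    finally have "norm (vector_derivative g (at t)) = r / cosh t"
      using r C
      by (simp add: s vector_derivative_at[OF has_vector_derivative_semicircle_line]
          cmod_def flip: r_def)
    then show ?thesis
      using r C by (simp add: hyp_speed_def s semicircle_line_def flip: r_def)
  next
    case v
    then show ?thesis
      by (simp add: hyp_speed_def v vector_derivative_at[OF has_vector_derivative_vertical_line]
          cmod_def vertical_line_def)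
  qed
qed

lemma semicircle_line_ideal_endpoints:
  "(semicircle_line u v \<longlongrightarrow> of_real u) at_bot" "(semicircle_line u v \<longlongrightarrow> of_real v) at_top"
proof -
  have top: "filterlim (cosh :: real \<Rightarrow> real) at_infinity at_top"
    by (rule filterlim_at_top_imp_at_infinity[OF cosh_real_at_top])
  have bot: "filterlim (cosh :: real \<Rightarrow> real) at_infinity at_bot"
    by (rule filterlim_at_top_imp_at_infinity[OF cosh_real_at_bot])
  have "(semicircle_line u v \<longlongrightarrow> Complex ((u + v) / 2 + (v - u) / 2 * (- 1)) 0) at_bot"
    unfolding semicircle_line_def
    by (intro tendsto_Complex tendsto_add tendsto_mult tendsto_const tanh_real_at_bot
        tendsto_divide_0[OF tendsto_const bot])
  also have "Complex ((u + v) / 2 + (v - u) / 2 * (- 1)) 0 = of_real u"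
    by (simp add: complex_eq_iff field_simps)
  finally show "(semicircle_line u v \<longlongrightarrow> of_real u) at_bot" .
  have "(semicircle_line u v \<longlongrightarrow> Complex ((u + v) / 2 + (v - u) / 2 * 1) 0) at_top"
    unfolding semicircle_line_def
    by (intro tendsto_Complex tendsto_add tendsto_mult tendsto_const tanh_real_at_top
        tendsto_divide_0[OF tendsto_const top])
  also have "Complex ((u + v) / 2 + (v - u) / 2 * 1) 0 = of_real v"
    by (simp add: complex_eq_iff field_simps)
  finally show "(semicircle_line u v \<longlongrightarrow> of_real v) at_top" .
qed

lemma range_semicircle_line_inj:
  assumes "u < v" "u' < v'" "range (semicircle_line u v) = range (semicircle_line u' v')"
  shows "u = u' \<and> v = v'"
proof -
  let ?x = "(u + v) / 2" and ?r = "(v - u) / 2" and ?x' = "(u' + v') / 2" and ?r' = "(v' - u') / 2"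
  have mem: "Complex x r \<in> range (semicircle_line a b) \<longleftrightarrow>
      0 < r \<and> (x - (a + b) / 2)\<^sup>2 + r\<^sup>2 = ((b - a) / 2)\<^sup>2" if "a < b" for a b x r
  proof -
    have "sqrt ((x - (a + b) / 2)\<^sup>2 + r\<^sup>2) = (b - a) / 2 \<longleftrightarrow>
        (x - (a + b) / 2)\<^sup>2 + r\<^sup>2 = ((b - a) / 2)\<^sup>2"
      using that real_sqrt_unique[of "(b - a) / 2"] by (auto dest: sym)
    then show ?thesis
      unfolding range_semicircle_line[OF that] by (simp add: dist_norm cmod_def)
  qed
  have "Complex ?x ?r \<in> range (semicircle_line u v)" "Complex ?x' ?r' \<in> range (semicircle_line u' v')"
    unfolding mem[OF assms(1)] mem[OF assms(2)] using assms(1,2) by simp_all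
  then have "Complex ?x ?r \<in> range (semicircle_line u' v')" "Complex ?x' ?r' \<in> range (semicircle_line u v)"
    unfolding assms(3) by simp_all
  then have 1: "(?x - ?x')\<^sup>2 + ?r\<^sup>2 = ?r'\<^sup>2" and 2: "(?x' - ?x)\<^sup>2 + ?r'\<^sup>2 = ?r\<^sup>2"
    unfolding mem[OF assms(1)] mem[OF assms(2)] by simp_all
  have "(?x' - ?x)\<^sup>2 = (?x - ?x')\<^sup>2" by (simp add: power2_commute)
  with 1 2 have "(?x - ?x')\<^sup>2 = 0" "?r\<^sup>2 = ?r'\<^sup>2" by linarith+
  then have "?x = ?x'" "?r = ?r'"
    using assms(1,2) by (simp_all add: power2_eq_iff_nonneg)
  then show ?thesis by (simp add: field_simps)
qed

lemma inj_on_geodesic_params: "inj_on range geodesic_params"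
proof (rule inj_onI)
  fix g h assume g: "g \<in> geodesic_params" and h: "h \<in> geodesic_params" and eq: "range g = range h"
  have neq: "range (semicircle_line u v) \<noteq> range (vertical_line w)" if "u < v" for u v w
  proof
    assume *: "range (semicircle_line u v) = range (vertical_line w)"
    have "vertical_line w (ln (v - u)) \<in> range (semicircle_line u v)"
      unfolding * by blast
    then have "dist (Complex w (v - u)) (of_real ((u + v) / 2)) = (v - u) / 2"
      using that unfolding range_semicircle_line[OF that] by (simp add: vertical_line_def)
    moreover have "\<bar>v - u\<bar> \<le> dist (Complex w (v - u)) (of_real ((u + v) / 2))"
      using abs_Im_le_cmod[of "Complex w (v - u) - of_real ((u + v) / 2)"] by (simp add: dist_norm)
    ultimately show False using that by simp
  qed
  have vert: "w = w'" if "range (vertical_line w) = range (vertical_line w')" for w w'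
  proof -
    have "Complex w 1 \<in> range (vertical_line w)"
      unfolding range_vertical_line by simp
    then have "Complex w 1 \<in> range (vertical_line w')"
      unfolding that .
    then show ?thesis
      unfolding range_vertical_line by simp
  qed
  show "g = h"
    using g h eq neq vert range_semicircle_line_inj
    unfolding geodesic_params_def by (auto, metis+)
qed

lemma param_of:
  assumes "\<gamma> \<in> geodesics"
  shows "param_of \<gamma> \<in> geodesic_params" "range (param_of \<gamma>) = \<gamma>"
  using assms unfolding geodesics_def param_of_def
  by (rule inv_into_into, rule f_inv_into_f)

lemma param_of_range: "g \<in> geodesic_params \<Longrightarrow> param_of (range g) = g"
  unfolding param_of_def by (rule inv_into_f_f[OF inj_on_geodesic_params])

lemma sets_lower_triangle: "{(u, v). u < v} \<in> sets (borel :: (real \<times> real) measure)"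
proof -
  have "open {p :: real \<times> real. fst p < snd p}"
    by (intro open_Collect_less continuous_intros)
  then show ?thesis
    by (simp add: case_prod_beta')
qed

lemma sets_liouville:
  "sets liouville =
     {A. A \<subseteq> geodesics \<and> {(u, v). u < v \<and> range (semicircle_line u v) \<in> A} \<in> sets borel}"
    (is "_ = ?S")
proof -
  note lt = sets_lower_triangle
  have "sigma_algebra geodesics ?S"
    unfolding sigma_algebra_iff2
  proof (intro conjI ballI allI impI)
    show "{} \<in> ?S" by simp
  next
    fix A assume A: "A \<in> ?S"
    have "{(u, v). u < v \<and> range (semicircle_line u v) \<in> geodesics - A}
        = {(u, v). u < v} - {(u, v). u < v \<and> range (semicircle_line u v) \<in> A}"
      by (auto simp: geodesics_def geodesic_params_def)
    then show "geodesics - A \<in> ?S" using A lt by auto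
  next
    fix A :: "nat \<Rightarrow> complex set set" assume A: "range A \<subseteq> ?S"
    have "{(u, v). u < v \<and> range (semicircle_line u v) \<in> \<Union> (range A)}
        = (\<Union>i. {(u, v). u < v \<and> range (semicircle_line u v) \<in> A i})"
      by auto
    moreover have "{(u, v). u < v \<and> range (semicircle_line u v) \<in> A i} \<in> sets borel" for i
      using A by auto
    ultimately show "\<Union> (range A) \<in> ?S" using A by auto
  qed auto
  then have "sigma_sets geodesics ?S = ?S"
    by (rule sigma_algebra.sigma_sets_eq)
  moreover have "sets liouville = sigma_sets geodesics ?S"
    unfolding liouville_def by (simp add: sets_measure_of_conv) (auto intro!: sets_measure_of)
  ultimately show ?thesis by simp
qed

lemma space_liouville: "space liouville = geodesics"
  unfolding liouville_def by (simp add: space_measure_of_conv)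

lemma emeasure_liouville:
  assumes "A \<in> sets liouville"
  shows "emeasure liouville A =
    (\<integral>\<^sup>+ (u, v). ennreal (1 / (v - u)\<^sup>2) * indicator {(u, v). u < v \<and> range (semicircle_line u v) \<in> A} (u, v)
       \<partial>lborel)"
proof -
  let ?T = "{(u, v). u < v} :: (real \<times> real) set" and ?g = "\<lambda>(u, v). range (semicircle_line u v)"
  let ?d = "\<lambda>(u, v). ennreal (1 / (v - u :: real)\<^sup>2)"
  let ?R = "restrict_space lborel ?T" and ?B = "{(u, v). u < v \<and> range (semicircle_line u v) \<in> A}"
  have T: "?T \<in> sets lborel"
    using sets_lower_triangle by simp
  have d: "?d \<in> borel_measurable lborel"
    unfolding measurable_lborel2 borel_prod[symmetric] by measurable
  have dR: "?d \<in> borel_measurable ?R"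
    by (rule measurable_restrict_space1[OF d])
  have B: "?B \<in> sets lborel"
    using assms unfolding sets_liouville by simp
  have pre: "?g -` A' \<inter> ?T = {(u, v). u < v \<and> range (semicircle_line u v) \<in> A'}" for A'
    by auto
  have g: "?g \<in> measurable (density ?R ?d)
      (sigma geodesics {A. A \<subseteq> geodesics \<and> {(u, v). u < v \<and> range (semicircle_line u v) \<in> A} \<in> sets borel})"
  proof (rule measurable_measure_of)
    show "?g \<in> space (density ?R ?d) \<rightarrow> geodesics"
      by (auto simp: space_restrict_space geodesics_def geodesic_params_def)
    fix A' assume "A' \<in> {A. A \<subseteq> geodesics \<and> {(u, v). u < v \<and> range (semicircle_line u v) \<in> A} \<in> sets borel}"
    then show "?g -` A' \<inter> space (density ?R ?d) \<in> sets (density ?R ?d)"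
      using T by (simp add: space_restrict_space pre sets_restrict_space_iff) auto
  qed auto
  have A: "A \<in> sets (sigma geodesics {A. A \<subseteq> geodesics \<and> {(u, v). u < v \<and> range (semicircle_line u v) \<in> A} \<in> sets borel})"
    using assms unfolding liouville_def by simp
  have BR: "?B \<in> sets ?R"
    using B T by (auto simp: sets_restrict_space_iff)
  have "emeasure liouville A = emeasure (density ?R ?d) ?B"
    unfolding liouville_def emeasure_distr[OF g A] by (simp add: space_restrict_space pre)
  also have "\<dots> = (\<integral>\<^sup>+ p. ?d p * indicator ?B p \<partial>?R)"
    by (rule emeasure_density[OF dR BR])
  also have "\<dots> = (\<integral>\<^sup>+ p. ?d p * indicator ?B p * indicator ?T p \<partial>lborel)"
    using T by (intro nn_integral_restrict_space) simp
  also have "\<dots> = (\<integral>\<^sup>+ p. ?d p * indicator ?B p \<partial>lborel)"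
    by (intro nn_integral_cong) (auto split: split_indicator)
  finally show ?thesis
    by (simp add: case_prod_beta')
qed

end

theory Submission
  imports Defs
begin

text \<open>Almost every geodesic meeting \<open>D\<close> is the line through \<open>c s\<close> and \<open>c t\<close> for exactly one pair of parameters with
  \<open>Re (c s) < Re (c t)\<close>. Let \<open>\<rho>(s, t)\<close> be the hyperbolic distance of \<open>c s\<close> and \<open>c t\<close>. In these
  coordinates the Liouville measure is \<open>\<partial>\<^sub>s\<partial>\<^sub>t\<rho> / 2 ds dt\<close>, the mixed derivative being positive by convexity, and
  \<open>sinh \<rho> cot \<alpha>\<^sub>1 cot \<alpha>\<^sub>2 \<partial>\<^sub>s\<partial>\<^sub>t\<rho> = - \<partial>\<^sub>s\<rho> \<partial>\<^sub>t\<rho>\<close>. Hence the difference of the two integrals is the integral of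
  \<open>\<partial>\<^sub>t (f(\<rho>) \<partial>\<^sub>s\<rho>) / 2\<close> over these pairs, that is, by symmetry in \<open>s\<close> and \<open>t\<close>, a quarter of the integral of
  \<open>\<partial>\<^sub>t (f(\<rho>) \<partial>\<^sub>s\<rho>)\<close> over the square of all pairs. For fixed \<open>s\<close> the fundamental theorem of calculus in \<open>t\<close> only
  leaves the jump of \<open>f(\<rho>) \<partial>\<^sub>s\<rho>\<close> at \<open>t = s\<close>, from \<open>f(0)\<close> to \<open>- f(0)\<close> times the speed of \<open>c\<close> at \<open>s\<close>.\<close>

section \<open>Change of variables in the plane\<close>

text \<open>The relation between angles and derivatives is the first variation formula: in absolute
  value the s-derivative of the distance is the hyperbolic speed times cos \<alpha>1, and the mixed
  derivative is the product of both speeds times sin \<alpha>1 sin \<alpha>2 / sinh \<rho>. The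
  curve crosses a chord towards opposite sides at its two ends, which gives the positive mixed
  derivative and the minus sign. A C1 boundary suffices because each of the two derivatives moves
  only one endpoint. The obstacle is the diagonal: the mixed derivative need not be bounded near it,
  so its integrability is not clear in advance. It follows from the row computation itself, applied
  to the constant function 1: each row integrates a nonnegative function to twice the speed, and
  Tonelli applies. The term with the first derivatives is bounded. Positivity of the mixed
  derivative means that boundary tangents are supporting geodesics; the Klein model turns this into
  Euclidean convexity. Tangent and vertical geodesics belong to no pair. They are null, but the
  integrands must still be measurable on them.\<close>

definition prod_of_vec :: "real^2 \<Rightarrow> real \<times> real" where
  "prod_of_vec x = (x $ 1, x $ 2)"

text \<open>The multidimensional change-of-variables theorem is about \<open>real^2\<close>, the
  Liouville density about pairs. This map and its inverse carry statements from one to the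
  other.\<close>

definition vec_of_prod :: "real \<times> real \<Rightarrow> real^2" where
  "vec_of_prod p = vector [fst p, snd p]"

lemma prod_of_vec_of_prod [simp]: "prod_of_vec (vec_of_prod p) = p"
  by (simp add: prod_of_vec_def vec_of_prod_def)

lemma vec_of_prod_of_vec [simp]: "vec_of_prod (prod_of_vec x) = x"
  by (simp add: prod_of_vec_def vec_of_prod_def vec_eq_iff forall_2)

lemma bounded_linear_prod_of_vec: "bounded_linear prod_of_vec"
  unfolding prod_of_vec_def by (intro bounded_linear_Pair bounded_linear_vec_nth)

lemma bounded_linear_vec_of_prod: "bounded_linear vec_of_prod"
  by (intro linear_conv_bounded_linear[THEN iffD1] linearI)
    (auto simp: vec_of_prod_def vec_eq_iff forall_2)

lemma measurable_vec_of_prod [measurable]: "vec_of_prod \<in> borel_measurable borel"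
  by (intro borel_measurable_continuous_onI linear_continuous_on bounded_linear_vec_of_prod)

lemma measurable_prod_of_vec [measurable]: "prod_of_vec \<in> borel_measurable borel"
  by (intro borel_measurable_continuous_onI linear_continuous_on bounded_linear_prod_of_vec)

text \<open>Lebesgue measure is characterised by its values on boxes, and boxes correspond to boxes
  with the same sides.\<close>

lemma distr_vec_of_prod: "distr lborel borel vec_of_prod = (lborel :: (real^2) measure)"
proof (rule lborel_eqI[symmetric])
  fix l u :: "real^2"
  assume le: "\<And>b. b \<in> Basis \<Longrightarrow> l \<bullet> b \<le> u \<bullet> b"
  have le': "l $ i \<le> u $ i" for i
    using le[of "axis i 1"] by (simp add: inner_axis axis_in_Basis_iff)
  have B: "(Basis :: (real^2) set) = {axis 1 1, axis 2 1}"
    by (auto simp: Basis_vec_def) (metis exhaust_2)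
  have ne: "axis 1 1 \<noteq> (axis 2 1 :: real^2)" by (simp add: axis_eq_axis)
  have pre: "vec_of_prod -` box l u = box (prod_of_vec l) (prod_of_vec u)"
  proof (intro set_eqI)
    fix p :: "real \<times> real"
    show "p \<in> vec_of_prod -` box l u \<longleftrightarrow> p \<in> box (prod_of_vec l) (prod_of_vec u)"
      by (cases p)
        (simp add: mem_box_cart forall_2 vec_of_prod_def prod_of_vec_def box_prod mem_box Basis_prod_def)
  qed
  have "emeasure (distr lborel borel vec_of_prod) (box l u) = emeasure lborel (box (prod_of_vec l) (prod_of_vec u))"
    by (subst emeasure_distr) (auto simp: pre)
  also have "\<dots> = ennreal ((u $ 1 - l $ 1) * (u $ 2 - l $ 2))"
    using le' by (simp add: emeasure_lborel_box_eq Basis_prod_def prod_of_vec_def image_Un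
        prod.union_disjoint)
  also have "(u $ 1 - l $ 1) * (u $ 2 - l $ 2) = (\<Prod>b\<in>Basis. (u - l) \<bullet> b)"
    unfolding B using ne by (simp add: inner_axis)
  finally show "emeasure (distr lborel borel vec_of_prod) (box l u) = (\<Prod>b\<in>Basis. (u - l) \<bullet> b)" .
qed simp

text \<open>Integrals over \<open>lebesgue\<close>, the completion of \<open>lborel\<close>, agree
  with those over \<open>lborel\<close> for Borel integrands; hence the measurability
  assumption.\<close>

lemma
  fixes h :: "real^2 \<Rightarrow> real"
  assumes "(\<lambda>p. h (vec_of_prod p)) \<in> borel_measurable borel"
  shows integrable_lebesgue_vec2_iff: "integrable lebesgue h \<longleftrightarrow> integrable lborel (\<lambda>p. h (vec_of_prod p))"
    and integral_lebesgue_vec2: "integral\<^sup>L lebesgue h = integral\<^sup>L lborel (\<lambda>p. h (vec_of_prod p))"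
proof -
  have "(\<lambda>x. h (vec_of_prod (prod_of_vec x))) \<in> borel_measurable borel"
    by (rule measurable_compose[OF measurable_prod_of_vec assms])
  then have h: "h \<in> borel_measurable borel" by simp
  have "integrable lebesgue h \<longleftrightarrow> integrable (distr lborel borel vec_of_prod) h"
    by (subst distr_vec_of_prod) (simp add: integrable_completion h)
  also have "\<dots> \<longleftrightarrow> integrable lborel (\<lambda>p. h (vec_of_prod p))"
    using h by (intro integrable_distr_eq) auto
  finally show "integrable lebesgue h \<longleftrightarrow> integrable lborel (\<lambda>p. h (vec_of_prod p))" .
  have "integral\<^sup>L lebesgue h = integral\<^sup>L (distr lborel borel vec_of_prod) h"
    by (subst distr_vec_of_prod) (simp add: integral_completion h)
  also have "\<dots> = integral\<^sup>L lborel (\<lambda>p. h (vec_of_prod p))"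
    using h by (intro integral_distr) auto
  finally show "integral\<^sup>L lebesgue h = integral\<^sup>L lborel (\<lambda>p. h (vec_of_prod p))" .
qed

lemma vec1_scaleR: "r *\<^sub>R (vec x :: real^1) = vec (r * x)"
  by (simp add: vec_eq_iff)

text \<open>The change-of-variables theorem takes integrands with values in \<open>real^'n\<close>,
  so a real integrand is read as a vector with one component.\<close>

lemma vec1_absolutely_integrable_on_iff:
  fixes h :: "real^2 \<Rightarrow> real"
  shows "(\<lambda>x. vec (h x) :: real^1) absolutely_integrable_on A
    \<longleftrightarrow> integrable lebesgue (\<lambda>x. indicator A x * h x)"
proof
  assume "(\<lambda>x. vec (h x) :: real^1) absolutely_integrable_on A"
  then have "integrable lebesgue (\<lambda>x. (indicator A x *\<^sub>R (vec (h x) :: real^1)) $ 1)"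
    unfolding set_integrable_def by (rule integrable_bounded_linear[OF bounded_linear_vec_nth])
  then show "integrable lebesgue (\<lambda>x. indicator A x * h x)" by simp
next
  have bl: "bounded_linear (vec :: real \<Rightarrow> real^1)"
    by (intro linear_conv_bounded_linear[THEN iffD1] linear_vec)
  assume "integrable lebesgue (\<lambda>x. indicator A x * h x)"
  then have "integrable lebesgue (\<lambda>x. vec (indicator A x * h x) :: real^1)"
    by (rule integrable_bounded_linear[OF bl])
  then show "(\<lambda>x. vec (h x) :: real^1) absolutely_integrable_on A"
    unfolding set_integrable_def by (simp only: vec1_scaleR)
qed

lemma vec1_integral_eq:
  fixes h :: "real^2 \<Rightarrow> real"
  assumes "integrable lebesgue (\<lambda>x. indicator A x * h x)"
  shows "integral A (\<lambda>x. vec (h x) :: real^1) = vec (integral\<^sup>L lebesgue (\<lambda>x. indicator A x * h x))"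
proof -
  have bl: "bounded_linear (vec :: real \<Rightarrow> real^1)"
    by (intro linear_conv_bounded_linear[THEN iffD1] linear_vec)
  have "(\<lambda>x. vec (h x) :: real^1) absolutely_integrable_on A"
    using assms by (simp add: vec1_absolutely_integrable_on_iff)
  then have "integral A (\<lambda>x. vec (h x) :: real^1) = (LINT x:A|lebesgue. vec (h x))"
    by (rule set_lebesgue_integral_eq_integral(2)[symmetric])
  also have "\<dots> = integral\<^sup>L lebesgue (\<lambda>x. vec (indicator A x * h x))"
    unfolding set_lebesgue_integral_def by (simp only: vec1_scaleR)
  also have "\<dots> = vec (integral\<^sup>L lebesgue (\<lambda>x. indicator A x * h x))"
    by (rule integral_bounded_linear[OF bl assms])
  finally show ?thesis .
qed

text \<open>The derivative is given by its four matrix entries, which makes the determinant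
  explicit. The two Borel conditions allow the passage from \<open>lebesgue\<close> to
  \<open>lborel\<close> on the domain and on the image.\<close>

lemma
  fixes g :: "real \<times> real \<Rightarrow> real \<times> real" and F :: "real \<times> real \<Rightarrow> real"
  assumes S: "S \<in> sets borel"
    and der: "\<And>p. p \<in> S \<Longrightarrow>
      (g has_derivative (\<lambda>(h, k). (a p * h + b p * k, c p * h + d p * k))) (at p within S)"
    and inj: "inj_on g S"
    and m1: "(\<lambda>p. indicator S p * (\<bar>a p * d p - b p * c p\<bar> * F (g p))) \<in> borel_measurable borel"
    and m2: "(\<lambda>q. indicator (g ` S) q * F q) \<in> borel_measurable borel"
  shows integrable_change_of_variables_prod:
      "integrable lborel (\<lambda>q. indicator (g ` S) q * F q) \<longleftrightarrow>
       integrable lborel (\<lambda>p. indicator S p * (\<bar>a p * d p - b p * c p\<bar> * F (g p)))" (is ?A)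
    and integral_change_of_variables_prod:
      "integral\<^sup>L lborel (\<lambda>q. indicator (g ` S) q * F q) =
       integral\<^sup>L lborel (\<lambda>p. indicator S p * (\<bar>a p * d p - b p * c p\<bar> * F (g p)))" (is ?B)
proof -
  define S' where "S' = vec_of_prod ` S"
  define G where "G = vec_of_prod \<circ> g \<circ> prod_of_vec"
  define G' where "G' = (\<lambda>x. let p = prod_of_vec x in
    vec_of_prod \<circ> (\<lambda>(h, k). (a p * h + b p * k, c p * h + d p * k)) \<circ> prod_of_vec)"
  have S'_vim: "S' = prod_of_vec -` S"
    unfolding S'_def by (auto simp: image_iff) (metis vec_of_prod_of_vec)
  have S'b: "S' \<in> sets borel"
    unfolding S'_vim using measurable_sets[OF measurable_prod_of_vec S] by simp
  then have S'l: "S' \<in> sets lebesgue" by auto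
  have GS: "G ` S' = vec_of_prod ` g ` S"
    unfolding G_def S'_def by (auto simp: image_image)
  have mem_iff: "vec_of_prod p \<in> vec_of_prod ` A \<longleftrightarrow> p \<in> A" for p A
    by (metis imageE image_eqI prod_of_vec_of_prod)
  have der': "(G has_derivative G' x) (at x within S')" if "x \<in> S'" for x
  proof -
    have p: "prod_of_vec x \<in> S" using that by (simp add: S'_vim)
    have im: "prod_of_vec ` S' = S" by (auto simp: S'_def image_image)
    have 1: "(prod_of_vec has_derivative prod_of_vec) (at x within S')"
      by (rule bounded_linear_imp_has_derivative[OF bounded_linear_prod_of_vec])
    have 2: "(g has_derivative (\<lambda>(h, k). (a (prod_of_vec x) * h + b (prod_of_vec x) * k,
        c (prod_of_vec x) * h + d (prod_of_vec x) * k))) (at (prod_of_vec x) within prod_of_vec ` S')"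
      unfolding im by (rule der[OF p])
    have 3: "(vec_of_prod has_derivative vec_of_prod) (at (g (prod_of_vec x)))"
      by (rule bounded_linear_imp_has_derivative[OF bounded_linear_vec_of_prod])
    show ?thesis
      unfolding G_def G'_def Let_def
      using diff_chain_within[OF diff_chain_within[OF 1 2] has_derivative_at_withinI[OF 3[folded o_apply[of g]]]]
      by (simp add: comp_assoc o_def)
  qed
  have inj': "inj_on G S'"
    unfolding G_def S'_def using inj
    by (auto simp: inj_on_def) (metis prod_of_vec_of_prod)
  have det: "det (matrix (G' (vec_of_prod p))) = a p * d p - b p * c p" for p
    by (simp add: det_2 matrix_def G'_def axis_def) (simp add: vec_of_prod_def prod_of_vec_def)
  let ?f = "\<lambda>x. F (prod_of_vec x)"
  let ?J = "\<lambda>x. \<bar>det (matrix (G' x))\<bar> * ?f (G x)"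
  have comp1: "(\<lambda>p. indicator S' (vec_of_prod p) * ?J (vec_of_prod p))
      = (\<lambda>p. indicator S p * (\<bar>a p * d p - b p * c p\<bar> * F (g p)))"
    by (auto simp: fun_eq_iff indicator_def S'_vim det G_def)
  have comp2: "(\<lambda>q. indicator (G ` S') (vec_of_prod q) * ?f (vec_of_prod q)) = (\<lambda>q. indicator (g ` S) q * F q)"
    by (auto simp: fun_eq_iff indicator_def GS mem_iff)
  have m1': "(\<lambda>p. indicator S' (vec_of_prod p) * ?J (vec_of_prod p)) \<in> borel_measurable borel"
    unfolding comp1 by (rule m1)
  have m2': "(\<lambda>p. indicator (G ` S') (vec_of_prod p) * ?f (vec_of_prod p)) \<in> borel_measurable borel"
    unfolding comp2 by (rule m2)
  have vJ: "\<bar>det (matrix (G' x))\<bar> *\<^sub>R (vec (?f (G x)) :: real^1) = vec (?J x)" for x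
    by (simp only: vec1_scaleR)
  \<comment> \<open>The theorem equates, for every b, being integrable with integral b on both
    sides. Letting b vary separates this into an equivalence of integrability and an equality of
    integrals.\<close>
  have iff_and_eq: "P = Q \<and> (P \<longrightarrow> x = y)" if "\<And>b. (P \<and> x = b) = (Q \<and> y = b)" for P Q and x y :: "real^1"
    using that by metis
  note cv = iff_and_eq[OF has_absolute_integral_change_of_variables[OF S'l der' inj',
      of "\<lambda>x. vec (?f x) :: real^1", unfolded vJ vec1_absolutely_integrable_on_iff]]
  have i1: "integrable lebesgue (\<lambda>x. indicator S' x * ?J x) \<longleftrightarrow>
      integrable lborel (\<lambda>p. indicator S p * (\<bar>a p * d p - b p * c p\<bar> * F (g p)))"
    using integrable_lebesgue_vec2_iff[OF m1'] unfolding comp1 .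
  have i2: "integrable lebesgue (\<lambda>x. indicator (G ` S') x * ?f x) \<longleftrightarrow>
      integrable lborel (\<lambda>q. indicator (g ` S) q * F q)"
    using integrable_lebesgue_vec2_iff[OF m2'] unfolding comp2 .
  show A: ?A
    using cv i1 i2 by simp
  show ?B
  proof (cases "integrable lborel (\<lambda>q. indicator (g ` S) q * F q)")
    case True
    then have l1: "integrable lebesgue (\<lambda>x. indicator S' x * ?J x)"
      and l2: "integrable lebesgue (\<lambda>x. indicator (G ` S') x * ?f x)"
      using A i1 i2 by auto
    have "vec (integral\<^sup>L lebesgue (\<lambda>x. indicator S' x * ?J x))
        = (vec (integral\<^sup>L lebesgue (\<lambda>x. indicator (G ` S') x * ?f x)) :: real^1)"
      unfolding vec1_integral_eq[OF l1, symmetric] vec1_integral_eq[OF l2, symmetric]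
      using cv l1 by blast
    then have "integral\<^sup>L lebesgue (\<lambda>x. indicator S' x * ?J x)
        = integral\<^sup>L lebesgue (\<lambda>x. indicator (G ` S') x * ?f x)"
      by (simp add: vec_eq_iff)
    then show ?thesis
      using integral_lebesgue_vec2[OF m1'] integral_lebesgue_vec2[OF m2'] unfolding comp1 comp2 by simp
  next
    \<comment> \<open>Neither side is integrable, and both integrals take the default value
      0.\<close>
    case False
    then show ?thesis using A by (simp add: not_integrable_integral_eq)
  qed
qed

section \<open>Integration against the Liouville measure\<close>

text \<open>\<open>liouville\<close> is an image measure of a density on a restricted measure, and
  these three layers are removed in turn. Measurability is demanded in the coordinates (u, v)
  because the sigma-algebra is defined through them.\<close>

lemma
  fixes h :: "complex set \<Rightarrow> real"
  assumes G: "G \<subseteq> geodesics"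
    and meas: "(\<lambda>(u, v). if u < v \<and> range (semicircle_line u v) \<in> G
        then h (range (semicircle_line u v)) else 0) \<in> borel_measurable (borel :: (real \<times> real) measure)"
  shows set_integrable_liouville_iff: "set_integrable liouville G h \<longleftrightarrow>
      integrable lborel (\<lambda>(u, v). if u < v \<and> range (semicircle_line u v) \<in> G
        then h (range (semicircle_line u v)) / (v - u)\<^sup>2 else 0)" (is ?A)
    and set_lebesgue_integral_liouville: "(LINT \<gamma>:G|liouville. h \<gamma>) =
      integral\<^sup>L lborel (\<lambda>(u, v). if u < v \<and> range (semicircle_line u v) \<in> G
        then h (range (semicircle_line u v)) / (v - u)\<^sup>2 else 0)" (is ?B)
proof -
  let ?T = "{(u, v). u < v} :: (real \<times> real) set" and ?g = "\<lambda>(u, v). range (semicircle_line u v)"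
  let ?d = "\<lambda>(u, v). ennreal (1 / (v - u :: real)\<^sup>2)"
  let ?dr = "\<lambda>(u, v). 1 / (v - u :: real)\<^sup>2"
  let ?R = "restrict_space lborel ?T"
  let ?\<Sigma> = "{A. A \<subseteq> geodesics \<and> {(u, v). u < v \<and> range (semicircle_line u v) \<in> A} \<in> sets borel}"
  let ?N = "sigma geodesics ?\<Sigma>"
  let ?H = "\<lambda>\<gamma>. indicator G \<gamma> * h \<gamma>"
  have T: "?T \<in> sets lborel"
    using sets_lower_triangle by simp
  have dr: "?dr \<in> borel_measurable lborel"
    unfolding measurable_lborel2 borel_prod[symmetric] by measurable
  have d: "?d = (\<lambda>p. ennreal (?dr p))" by auto
  have drR: "?dr \<in> borel_measurable ?R"
    by (rule measurable_restrict_space1[OF dr])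
  have setsN: "sets ?N = ?\<Sigma>"
    using sets_liouville unfolding liouville_def by simp
  have g: "?g \<in> measurable (density ?R ?d) ?N"
  proof (rule measurable_measure_of)
    show "?g \<in> space (density ?R ?d) \<rightarrow> geodesics"
      by (auto simp: space_restrict_space geodesics_def geodesic_params_def)
    fix A' assume A': "A' \<in> ?\<Sigma>"
    have "?g -` A' \<inter> ?T = {(u, v). u < v \<and> range (semicircle_line u v) \<in> A'}" by auto
    then show "?g -` A' \<inter> space (density ?R ?d) \<in> sets (density ?R ?d)"
      using T A' by (simp add: space_restrict_space sets_restrict_space_iff) auto
  qed auto
  \<comment> \<open>Vertical lines are not in the image of the endpoint map, so the values of
    \<open>h\<close> on them do not affect measurability.\<close>
  have HN: "?H \<in> borel_measurable ?N"
  proof (rule measurableI)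
    fix B :: "real set" assume B: "B \<in> sets borel"
    have sp: "space ?N = geodesics" by (simp add: space_measure_of_conv)
    let ?K = "\<lambda>(u, v). if u < v \<and> range (semicircle_line u v) \<in> G
        then h (range (semicircle_line u v)) else 0"
    have "{(u, v). u < v \<and> range (semicircle_line u v) \<in> ?H -` B \<inter> geodesics} = (?K -` B) \<inter> ?T"
      by (auto simp: indicator_def geodesics_def geodesic_params_def split: if_splits)
    moreover have "?K -` B \<in> sets borel"
      using measurable_sets[OF meas B] by simp
    ultimately show "?H -` B \<inter> space ?N \<in> sets ?N"
      unfolding setsN sp using sets_lower_triangle by auto
  qed auto
  have hg: "(\<lambda>p. ?H (?g p)) \<in> borel_measurable ?R"
    using measurable_compose[OF g HN] by simp
  have eq: "(\<lambda>p. indicator ?T p *\<^sub>R (?dr p *\<^sub>R ?H (?g p)))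
     = (\<lambda>(u, v). if u < v \<and> range (semicircle_line u v) \<in> G
        then h (range (semicircle_line u v)) / (v - u)\<^sup>2 else 0)"
    by (auto simp: fun_eq_iff indicator_def)
  have L: "liouville = distr (density ?R ?d) ?N ?g" by (simp add: liouville_def)
  have "set_integrable liouville G h \<longleftrightarrow> integrable (density ?R ?d) (\<lambda>p. ?H (?g p))"
    unfolding set_integrable_def L real_scaleR_def by (rule integrable_distr_eq[OF g HN])
  also have "\<dots> \<longleftrightarrow> integrable ?R (\<lambda>p. ?dr p *\<^sub>R ?H (?g p))"
    unfolding d by (rule integrable_density[OF hg drR]) auto
  also have "\<dots> \<longleftrightarrow> integrable lborel (\<lambda>p. indicator ?T p *\<^sub>R (?dr p *\<^sub>R ?H (?g p)))"
    using T by (subst integrable_restrict_space) (auto simp: set_integrable_def)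
  finally show ?A unfolding eq .
  have "(LINT \<gamma>:G|liouville. h \<gamma>) = integral\<^sup>L (density ?R ?d) (\<lambda>p. ?H (?g p))"
    unfolding set_lebesgue_integral_def L real_scaleR_def by (rule integral_distr[OF g HN])
  also have "\<dots> = integral\<^sup>L ?R (\<lambda>p. ?dr p *\<^sub>R ?H (?g p))"
    unfolding d by (rule integral_density[OF hg drR]) auto
  also have "\<dots> = integral\<^sup>L lborel (\<lambda>p. indicator ?T p *\<^sub>R (?dr p *\<^sub>R ?H (?g p)))"
    using T by (subst integral_restrict_space) (auto simp: set_lebesgue_integral_def)
  finally show ?B unfolding eq .
qed


section \<open>Derivatives of the hyperbolic distance\<close>

text \<open>The usual 1 + |z - w|^2 / (2 Im z Im w) with its terms collected.\<close>

definition cosh_hdist :: "complex \<Rightarrow> complex \<Rightarrow> real" where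
  "cosh_hdist z w = ((Re z - Re w)\<^sup>2 + (Im z)\<^sup>2 + (Im w)\<^sup>2) / (2 * Im z * Im w)"

definition hdist :: "complex \<Rightarrow> complex \<Rightarrow> real" where
  "hdist z w = arcosh (cosh_hdist z w)"

text \<open>In terms of \<open>z\<close>, \<open>w\<close> and tangent vectors \<open>p\<close> at \<open>z\<close> and \<open>q\<close> at \<open>w\<close>: \<open>hdist_d z p w\<close> is the derivative of
  \<open>hdist z w\<close> in the direction \<open>p\<close>, and \<open>hdist_dd z p w q\<close> the mixed second derivative. The two numbers
  \<open>hdist_rad z p w\<close> and \<open>hdist_tra z p w\<close> are proportional to the components of \<open>p\<close> along and across the
  geodesic from \<open>z\<close> to \<open>w\<close>, with the factor \<open>hdist_root z w = 2 Im z Im w sinh (hdist z w)\<close>.\<close>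

definition hdist_root :: "complex \<Rightarrow> complex \<Rightarrow> real" where
  "hdist_root z w = sqrt (((Re z - Re w)\<^sup>2 + (Im w)\<^sup>2 - (Im z)\<^sup>2)\<^sup>2 + 4 * (Re z - Re w)\<^sup>2 * (Im z)\<^sup>2)"

definition hdist_rad :: "complex \<Rightarrow> complex \<Rightarrow> complex \<Rightarrow> real" where
  "hdist_rad z p w = 2 * (Re z - Re w) * Im z * Re p - ((Re z - Re w)\<^sup>2 + (Im w)\<^sup>2 - (Im z)\<^sup>2) * Im p"

definition hdist_tra :: "complex \<Rightarrow> complex \<Rightarrow> complex \<Rightarrow> real" where
  "hdist_tra z p w = ((Re z - Re w)\<^sup>2 + (Im w)\<^sup>2 - (Im z)\<^sup>2) * Re p + 2 * (Re z - Re w) * Im z * Im p"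

definition hdist_d :: "complex \<Rightarrow> complex \<Rightarrow> complex \<Rightarrow> real" where
  "hdist_d z p w = hdist_rad z p w / (Im z * hdist_root z w)"

definition hdist_dd :: "complex \<Rightarrow> complex \<Rightarrow> complex \<Rightarrow> complex \<Rightarrow> real" where
  "hdist_dd z p w q = 2 * hdist_tra z p w * hdist_tra w q z / hdist_root z w ^ 3"

text \<open>Both sides are ((x - y)^2 + a^2 + b^2)^2 - (2 a b)^2.\<close>

lemma hdist_root_arg_commute:
  fixes x y a b :: real
  shows "((x - y)\<^sup>2 + b\<^sup>2 - a\<^sup>2)\<^sup>2 + 4 * (x - y)\<^sup>2 * a\<^sup>2 = ((y - x)\<^sup>2 + a\<^sup>2 - b\<^sup>2)\<^sup>2 + 4 * (y - x)\<^sup>2 * b\<^sup>2"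
  by algebra

lemma hdist_root_commute: "hdist_root z w = hdist_root w z"
  unfolding hdist_root_def by (subst hdist_root_arg_commute) simp

lemma cosh_hdist_commute: "cosh_hdist z w = cosh_hdist w z"
  unfolding cosh_hdist_def by (simp add: power2_commute[of "Re z"] algebra_simps)

lemma hdist_commute: "hdist z w = hdist w z"
  unfolding hdist_def by (simp add: cosh_hdist_commute)

lemma hdist_dd_commute: "hdist_dd z p w q = hdist_dd w q z p"
  unfolding hdist_dd_def by (simp add: hdist_root_commute[of z])

lemma hdist_root_square:
  "(hdist_root z w)\<^sup>2 = ((Re z - Re w)\<^sup>2 + (Im w)\<^sup>2 - (Im z)\<^sup>2)\<^sup>2 + 4 * (Re z - Re w)\<^sup>2 * (Im z)\<^sup>2"
  unfolding hdist_root_def by (rule real_sqrt_pow2) simp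

lemma hdist_root_nonneg [simp]: "0 \<le> hdist_root z w"
  unfolding hdist_root_def by simp

lemma hdist_root_pos:
  assumes "0 < Im z" "0 < Im w" "z \<noteq> w"
  shows "0 < hdist_root z w"
proof -
  let ?B = "(Re z - Re w)\<^sup>2 + (Im w)\<^sup>2 - (Im z)\<^sup>2"
  have "?B\<^sup>2 + 4 * (Re z - Re w)\<^sup>2 * (Im z)\<^sup>2 > 0"
  proof (cases "Re z = Re w")
    case True
    then have "Im z \<noteq> Im w" using assms(3) by (simp add: complex_eq_iff)
    then have "(Im w)\<^sup>2 \<noteq> (Im z)\<^sup>2" using assms(1,2) by (simp add: power2_eq_iff_nonneg)
    then show ?thesis using True by simp
  next
    case False
    then show ?thesis using assms(1) by (intro add_nonneg_pos mult_pos_pos) auto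
  qed
  then show ?thesis unfolding hdist_root_def by simp
qed

lemma cosh_hdist_square:
  assumes "0 < Im z" "0 < Im w"
  shows "(cosh_hdist z w)\<^sup>2 - 1 = (hdist_root z w / (2 * Im z * Im w))\<^sup>2"
proof -
  have "((Re z - Re w)\<^sup>2 + (Im z)\<^sup>2 + (Im w)\<^sup>2)\<^sup>2 - (2 * Im z * Im w)\<^sup>2 = (hdist_root z w)\<^sup>2"
    unfolding hdist_root_square by algebra
  then have "(hdist_root z w)\<^sup>2 / (2 * Im z * Im w)\<^sup>2
     = ((Re z - Re w)\<^sup>2 + (Im z)\<^sup>2 + (Im w)\<^sup>2)\<^sup>2 / (2 * Im z * Im w)\<^sup>2 - (2 * Im z * Im w)\<^sup>2 / (2 * Im z * Im w)\<^sup>2"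
    by (metis diff_divide_distrib)
  also have "(2 * Im z * Im w)\<^sup>2 / (2 * Im z * Im w)\<^sup>2 = 1"
    using assms by simp
  finally show ?thesis
    by (simp only: power_divide cosh_hdist_def)
qed

lemma cosh_hdist_ge_1:
  assumes "0 < Im z" "0 < Im w"
  shows "1 \<le> cosh_hdist z w"
proof -
  have "0 \<le> (Re z - Re w)\<^sup>2 + (Im z - Im w)\<^sup>2" by simp
  then show ?thesis
    using assms unfolding cosh_hdist_def by (simp add: divide_simps power2_eq_square algebra_simps)
qed

lemma cosh_hdist_gt_1:
  assumes "0 < Im z" "0 < Im w" "z \<noteq> w"
  shows "1 < cosh_hdist z w"
proof -
  have "(cosh_hdist z w)\<^sup>2 - 1 > 0"
    unfolding cosh_hdist_square[OF assms(1,2)] using hdist_root_pos[OF assms] assms by simp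
  then have "cosh_hdist z w \<noteq> 1" by auto
  with cosh_hdist_ge_1[OF assms(1,2)] show ?thesis by simp
qed

lemma cosh_of_hdist:
  assumes "0 < Im z" "0 < Im w"
  shows "cosh (hdist z w) = cosh_hdist z w"
  unfolding hdist_def using cosh_hdist_ge_1[OF assms] by (simp add: cosh_arcosh_real)

lemma hdist_nonneg:
  assumes "0 < Im z" "0 < Im w"
  shows "0 \<le> hdist z w"
  unfolding hdist_def using cosh_hdist_ge_1[OF assms] by (rule arcosh_nonneg_real)

lemma sinh_of_hdist:
  assumes "0 < Im z" "0 < Im w"
  shows "sinh (hdist z w) = hdist_root z w / (2 * Im z * Im w)"
proof -
  have "(sinh (hdist z w))\<^sup>2 = (hdist_root z w / (2 * Im z * Im w))\<^sup>2"
    using cosh_hdist_square[OF assms] cosh_of_hdist[OF assms] by (simp add: sinh_square_eq)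
  then show ?thesis
    using assms hdist_nonneg[OF assms] by (simp add: power2_eq_iff_nonneg)
qed

lemma hdist_same [simp]: "0 < Im z \<Longrightarrow> hdist z z = 0"
  unfolding hdist_def cosh_hdist_def by (simp add: power2_eq_square)

lemma continuous_on_hdist:
  fixes g h :: "'a::topological_space \<Rightarrow> complex"
  assumes "continuous_on S g" "continuous_on S h" "\<And>x. x \<in> S \<Longrightarrow> 0 < Im (g x)" "\<And>x. x \<in> S \<Longrightarrow> 0 < Im (h x)"
  shows "continuous_on S (\<lambda>x. hdist (g x) (h x))"
proof -
  have "continuous_on S (\<lambda>x. cosh_hdist (g x) (h x))"
    unfolding cosh_hdist_def using assms by (intro continuous_intros) force+
  then show ?thesis
    unfolding hdist_def
    by (rule continuous_on_compose2[OF continuous_on_arcosh[OF order.refl]]) (auto intro: cosh_hdist_ge_1 assms)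
qed

text \<open>\<open>hdist_rad\<close> and \<open>hdist_tra\<close> are the real and the imaginary
  part of one product: p times a complex number that depends only on z and w and has modulus
  \<open>hdist_root z w\<close>.\<close>

lemma hdist_rad_tra:
  "(hdist_rad z p w)\<^sup>2 + (hdist_tra z p w)\<^sup>2 = (hdist_root z w)\<^sup>2 * (norm p)\<^sup>2"
  unfolding hdist_root_square hdist_rad_def hdist_tra_def cmod_power2 by algebra

text \<open>Only the component of p along the geodesic changes the distance. The bound keeps
  products of first derivatives bounded up to the diagonal.\<close>

lemma abs_hdist_d_le:
  assumes "0 < Im z" "0 < Im w" "z \<noteq> w"
  shows "\<bar>hdist_d z p w\<bar> \<le> norm p / Im z"
proof -
  have "(hdist_rad z p w)\<^sup>2 \<le> (hdist_root z w * norm p)\<^sup>2"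
    using hdist_rad_tra[of z p w] zero_le_power2[of "hdist_tra z p w"]
    by (simp only: power_mult_distrib)
  then have "\<bar>hdist_rad z p w\<bar> \<le> hdist_root z w * norm p"
    using abs_le_square_iff[of "hdist_rad z p w" "hdist_root z w * norm p"] by (simp add: abs_mult)
  then show ?thesis
    using hdist_root_pos[OF assms] assms(1)
    by (simp add: hdist_d_def abs_mult field_simps)
qed

lemma has_real_derivative_hdist:
  fixes c :: "real \<Rightarrow> complex"
  assumes c: "(c has_vector_derivative q) (at t)" and pos: "0 < Im z" "0 < Im (c t)" and ne: "z \<noteq> c t"
  shows "((\<lambda>t. hdist z (c t)) has_real_derivative hdist_d (c t) q z) (at t)"
proof -
  let ?C = "cosh_hdist z (c t)" and ?R = "hdist_root z (c t)"
  have dRe: "((\<lambda>t. Re (c t)) has_real_derivative Re q) (at t)"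
    and dIm: "((\<lambda>t. Im (c t)) has_real_derivative Im q) (at t)"
    using c by (auto simp: has_vector_derivative_complex_iff)
  have R: "?R > 0" by (rule hdist_root_pos[OF pos ne])
  have 1: "((\<lambda>t. cosh_hdist z (c t)) has_real_derivative
      hdist_rad (c t) q z / (2 * Im z * (Im (c t))\<^sup>2)) (at t)"
  proof -
    let ?n = "2 * (Re z - Re (c t)) * (- Re q) + 2 * Im (c t) * Im q"
    let ?W = "(Re z - Re (c t))\<^sup>2 + (Im z)\<^sup>2 + (Im (c t))\<^sup>2" and ?d = "2 * Im z * Im (c t)"
    have n: "((\<lambda>t. (Re z - Re (c t))\<^sup>2 + (Im z)\<^sup>2 + (Im (c t))\<^sup>2) has_real_derivative ?n) (at t)"
      by (rule dRe dIm derivative_eq_intros refl)+ simp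
    have d: "((\<lambda>t. 2 * Im z * Im (c t)) has_real_derivative 2 * Im z * Im q) (at t)"
      by (rule dRe dIm derivative_eq_intros refl)+ simp
    have "(?n * ?d - ?W * (2 * Im z * Im q)) * (2 * Im z * (Im (c t))\<^sup>2) = hdist_rad (c t) q z * (?d * ?d)"
      unfolding hdist_rad_def by algebra
    then have "(?n * ?d - ?W * (2 * Im z * Im q)) / (?d * ?d) = hdist_rad (c t) q z / (2 * Im z * (Im (c t))\<^sup>2)"
      using pos by (subst frac_eq_eq) auto
    with DERIV_divide[OF n d] pos show ?thesis
      unfolding cosh_hdist_def by simp
  qed
  have 2: "sqrt (?C\<^sup>2 - 1) = ?R / (2 * Im z * Im (c t))"
    unfolding cosh_hdist_square[OF pos] using pos R by simp
  have "((\<lambda>t. arcosh (cosh_hdist z (c t))) has_real_derivative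
      hdist_rad (c t) q z / (2 * Im z * (Im (c t))\<^sup>2) * (1 / sqrt (?C\<^sup>2 - 1))) (at t)"
    using DERIV_chain2[OF arcosh_real_has_field_derivative[OF cosh_hdist_gt_1[OF pos ne]] 1]
    by (simp add: mult.commute)
  moreover have "hdist_rad (c t) q z / (2 * Im z * (Im (c t))\<^sup>2) * (1 / sqrt (?C\<^sup>2 - 1)) = hdist_d (c t) q z"
    unfolding 2 hdist_d_def hdist_root_commute[of z] using pos by (simp add: divide_simps power2_eq_square)
  ultimately show ?thesis unfolding hdist_def by simp
qed

text \<open>The direction p is a fixed vector here, so a single derivative of \<open>c\<close> at t
  is enough for the mixed derivative.\<close>

lemma has_real_derivative_hdist_d:
  fixes c :: "real \<Rightarrow> complex"
  assumes c: "(c has_vector_derivative q) (at t)" and pos: "0 < Im z" "0 < Im (c t)" and ne: "z \<noteq> c t"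
  shows "((\<lambda>t. hdist_d z p (c t)) has_real_derivative hdist_dd z p (c t) q) (at t)"
proof -
  define A where "A = Re z - Re (c t)"
  define y1 where "y1 = Im z"
  define y2 where "y2 = Im (c t)"
  define B where "B = A\<^sup>2 + y2\<^sup>2 - y1\<^sup>2"
  define B' where "B' = - 2 * A * Re q + 2 * y2 * Im q"
  define R where "R = hdist_root z (c t)"
  have dRe: "((\<lambda>t. Re (c t)) has_real_derivative Re q) (at t)"
    and dIm: "((\<lambda>t. Im (c t)) has_real_derivative Im q) (at t)"
    using c by (auto simp: has_vector_derivative_complex_iff)
  have R: "R > 0" unfolding R_def by (rule hdist_root_pos[OF pos ne])
  have R2: "R\<^sup>2 = B\<^sup>2 + 4 * A\<^sup>2 * y1\<^sup>2"
    unfolding R_def hdist_root_square by (simp add: A_def B_def y1_def y2_def)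
  have dA: "((\<lambda>t. Re z - Re (c t)) has_real_derivative - Re q) (at t)"
    by (rule dRe derivative_eq_intros refl)+ simp
  have dB: "((\<lambda>t. (Re z - Re (c t))\<^sup>2 + (Im (c t))\<^sup>2 - (Im z)\<^sup>2) has_real_derivative B') (at t)"
    by (rule dA dIm derivative_eq_intros refl)+ (simp add: B'_def A_def y2_def algebra_simps)
  have R2pos: "B\<^sup>2 + 4 * A\<^sup>2 * y1\<^sup>2 > 0" using R R2 by (metis zero_less_power)
  have dR: "((\<lambda>t. hdist_root z (c t)) has_real_derivative (B * B' - 4 * A * Re q * y1\<^sup>2) / R) (at t)"
  proof -
    have "((\<lambda>t. ((Re z - Re (c t))\<^sup>2 + (Im (c t))\<^sup>2 - (Im z)\<^sup>2)\<^sup>2 + 4 * (Re z - Re (c t))\<^sup>2 * (Im z)\<^sup>2)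
        has_real_derivative 2 * (B * B' - 4 * A * Re q * y1\<^sup>2)) (at t)"
      by (rule derivative_eq_intros dA dB refl)+
        (simp add: A_def B_def y1_def y2_def algebra_simps)
    from DERIV_chain2[OF DERIV_real_sqrt[of "B\<^sup>2 + 4 * A\<^sup>2 * y1\<^sup>2", OF R2pos, unfolded A_def B_def y1_def y2_def] this]
    show ?thesis
      unfolding hdist_root_def[symmetric] R_def[symmetric]
      by (rule DERIV_cong) (use R in \<open>simp add: field_simps\<close>)
  qed
  have dN: "((\<lambda>t. hdist_rad z p (c t)) has_real_derivative (- 2 * Re q * y1 * Re p - B' * Im p)) (at t)"
    unfolding hdist_rad_def
    by (rule derivative_eq_intros dA dB refl)+ (simp add: y1_def)
  let ?N = "hdist_rad z p (c t)"
  have N: "?N = 2 * A * y1 * Re p - B * Im p"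
    unfolding hdist_rad_def by (simp add: A_def B_def y1_def y2_def)
  have E1: "hdist_tra z p (c t) = B * Re p + 2 * A * y1 * Im p"
    unfolding hdist_tra_def by (simp add: A_def B_def y1_def y2_def)
  have E2: "hdist_tra (c t) q z = (A\<^sup>2 + y1\<^sup>2 - y2\<^sup>2) * Re q - 2 * A * y2 * Im q"
    unfolding hdist_tra_def
    by (simp add: A_def y1_def y2_def power2_commute[of "Re (c t)"] algebra_simps)
  have "((\<lambda>t. hdist_d z p (c t)) has_real_derivative
      ((- 2 * Re q * y1 * Re p - B' * Im p) * (y1 * R) - ?N * (y1 * ((B * B' - 4 * A * Re q * y1\<^sup>2) / R)))
       / (y1 * R)\<^sup>2) (at t)"
    unfolding hdist_d_def
    by (rule derivative_eq_intros dN dR refl)+ (use pos R in \<open>auto simp: y1_def R_def power2_eq_square\<close>)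
  moreover have "((- 2 * Re q * y1 * Re p - B' * Im p) * (y1 * R) - ?N * (y1 * ((B * B' - 4 * A * Re q * y1\<^sup>2) / R)))
       / (y1 * R)\<^sup>2 = hdist_dd z p (c t) q"
  proof -
    \<comment> \<open>Why the numerator factors: moving the far point along the geodesic does not
      turn the direction seen from z, and moving z along it does not either. Only the components
      across the geodesic survive.\<close>
    have id: "(- 2 * Re q * y1 * Re p - B' * Im p) * R\<^sup>2 - ?N * (B * B' - 4 * A * Re q * y1\<^sup>2)
       = 2 * y1 * (hdist_tra z p (c t) * hdist_tra (c t) q z)"
      unfolding R2 N E1 E2 B'_def B_def by algebra
    have y: "y1 \<noteq> 0" using pos by (simp add: y1_def)
    have "((- 2 * Re q * y1 * Re p - B' * Im p) * (y1 * R) - ?N * (y1 * ((B * B' - 4 * A * Re q * y1\<^sup>2) / R)))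
       / (y1 * R)\<^sup>2 = ((- 2 * Re q * y1 * Re p - B' * Im p) * R\<^sup>2 - ?N * (B * B' - 4 * A * Re q * y1\<^sup>2)) / (y1 * R ^ 3)"
      using R y by (simp add: divide_simps power2_eq_square power3_eq_cube algebra_simps)
    also have "\<dots> = hdist_dd z p (c t) q"
      unfolding id hdist_dd_def R_def[symmetric] using R y by simp
    finally show ?thesis .
  qed
  ultimately show ?thesis by simp
qed

text \<open>Seen from \<open>c s\<close>, the direction of \<open>c t\<close> tends to that of p for
  t > s and to that of -p for t < s, so the first variation jumps. The factor
  \<open>sgn (t - s)\<close> merges the two one-sided limits into one.\<close>

lemma tendsto_hdist_d_diagonal:
  fixes c :: "real \<Rightarrow> complex"
  assumes c: "(c has_vector_derivative p) (at s)" and pos: "0 < Im (c s)" and p: "p \<noteq> 0"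
  shows "((\<lambda>t. sgn (t - s) * hdist_d (c s) p (c t)) \<longlongrightarrow> - norm p / Im (c s)) (at s)"
proof -
  let ?y = "Im (c s)"
  have dRe: "((\<lambda>t. Re (c t)) has_real_derivative Re p) (at s)"
    and dIm: "((\<lambda>t. Im (c t)) has_real_derivative Im p) (at s)"
    using c by (auto simp: has_vector_derivative_complex_iff)
  define a where "a = (\<lambda>t. (Re (c t) - Re (c s)) / (t - s))"
  define b where "b = (\<lambda>t. (Im (c t) - Im (c s)) / (t - s))"
  have la: "(a \<longlongrightarrow> Re p) (at s)" and lb: "(b \<longlongrightarrow> Im p) (at s)"
    using dRe dIm unfolding has_field_derivative_iff a_def b_def by auto
  have lRe: "((\<lambda>t. Re (c t)) \<longlongrightarrow> Re (c s)) (at s)" and lIm: "((\<lambda>t. Im (c t)) \<longlongrightarrow> Im (c s)) (at s)"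
    using DERIV_isCont[OF dRe] DERIV_isCont[OF dIm] by (auto simp: isCont_def)
  \<comment> \<open>\<open>B\<close> is the difference quotient of (Re z - Re w)^2 + (Im w)^2 - (Im
    z)^2. Numerator and root of \<open>hdist_d\<close> contain the factors t - s and |t - s|; in
    \<open>Q\<close> these are cancelled, at the price of a sign.\<close>
  define B where "B = (\<lambda>t. (Re (c t) - Re (c s)) * a t + (Im (c t) + ?y) * b t)"
  define Q where "Q = (\<lambda>t. (- 2 * a t * ?y * Re p - B t * Im p) / (?y * sqrt ((B t)\<^sup>2 + 4 * (a t)\<^sup>2 * ?y\<^sup>2)))"
  have lB: "(B \<longlongrightarrow> (Re (c s) - Re (c s)) * Re p + (?y + ?y) * Im p) (at s)"
    unfolding B_def by (intro tendsto_intros la lb lRe lIm)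
  have n: "sqrt ((2 * ?y * Im p)\<^sup>2 + 4 * (Re p)\<^sup>2 * ?y\<^sup>2) = 2 * ?y * norm p"
  proof -
    have "(2 * ?y * Im p)\<^sup>2 + 4 * (Re p)\<^sup>2 * ?y\<^sup>2 = (2 * ?y * norm p)\<^sup>2"
      by (simp add: power_mult_distrib cmod_power2 algebra_simps)
    then show ?thesis using pos by simp
  qed
  have lB': "(B \<longlongrightarrow> 2 * ?y * Im p) (at s)" using lB by simp
  have lQ: "(Q \<longlongrightarrow> (- 2 * Re p * ?y * Re p - 2 * ?y * Im p * Im p)
      / (?y * sqrt ((2 * ?y * Im p)\<^sup>2 + 4 * (Re p)\<^sup>2 * ?y\<^sup>2))) (at s)"
    unfolding Q_def using n pos p by (intro tendsto_intros la lB') simp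
  have "(- 2 * Re p * ?y * Re p - 2 * ?y * Im p * Im p) = - 2 * ?y * (norm p)\<^sup>2"
    by (simp only: cmod_power2) (simp add: power2_eq_square algebra_simps)
  then have eq: "(- 2 * Re p * ?y * Re p - 2 * ?y * Im p * Im p)
      / (?y * sqrt ((2 * ?y * Im p)\<^sup>2 + 4 * (Re p)\<^sup>2 * ?y\<^sup>2)) = - norm p / ?y"
    unfolding n using pos p by (simp add: power2_eq_square divide_simps)
  have ev: "Q t = sgn (t - s) * hdist_d (c s) p (c t)" if ts: "t \<noteq> s" for t
  proof -
    define h where "h = t - s"
    have h: "h \<noteq> 0" using ts by (simp add: h_def)
    have A: "Re (c s) - Re (c t) = - a t * h" using ts by (simp add: a_def h_def)
    have Bt: "(Re (c s) - Re (c t))\<^sup>2 + (Im (c t))\<^sup>2 - ?y\<^sup>2 = B t * h"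
    proof -
      have "a t * h = Re (c t) - Re (c s)" "b t * h = Im (c t) - ?y"
        using ts by (simp_all add: a_def b_def h_def)
      then show ?thesis unfolding B_def by algebra
    qed
    have R: "hdist_root (c s) (c t) = \<bar>h\<bar> * sqrt ((B t)\<^sup>2 + 4 * (a t)\<^sup>2 * ?y\<^sup>2)"
    proof -
      have "(B t * h)\<^sup>2 + 4 * (- a t * h)\<^sup>2 * ?y\<^sup>2 = h\<^sup>2 * ((B t)\<^sup>2 + 4 * (a t)\<^sup>2 * ?y\<^sup>2)"
        by (simp add: power_mult_distrib algebra_simps)
      then show ?thesis
        unfolding hdist_root_def Bt unfolding A by (simp add: real_sqrt_mult)
    qed
    have N: "hdist_rad (c s) p (c t) = h * (- 2 * a t * ?y * Re p - B t * Im p)"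
      unfolding hdist_rad_def Bt unfolding A by (simp add: algebra_simps)
    have "sgn h * h = \<bar>h\<bar>" by (simp add: abs_sgn mult.commute)
    then have sg: "sgn h * (h * X / (?y * (\<bar>h\<bar> * Y))) = X / (?y * Y)" for X Y
      using h by (cases "h > 0") (auto simp: sgn_if)
    show ?thesis
      unfolding hdist_d_def N R Q_def h_def[symmetric] sg ..
  qed
  show ?thesis
    using lQ unfolding eq
    by (rule Lim_transform_eventually) (auto simp: eventually_at_filter ev)
qed

section \<open>The geodesic through two points\<close>

text \<open>The point where the Euclidean perpendicular bisector of z and w meets the real
  axis.\<close>

definition geod_centre :: "complex \<Rightarrow> complex \<Rightarrow> real" where
  "geod_centre z w = ((Re w)\<^sup>2 + (Im w)\<^sup>2 - (Re z)\<^sup>2 - (Im z)\<^sup>2) / (2 * (Re w - Re z))"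

definition geod_radius :: "complex \<Rightarrow> complex \<Rightarrow> real" where
  "geod_radius z w = sqrt ((Re z - geod_centre z w)\<^sup>2 + (Im z)\<^sup>2)"

definition ideal_ends :: "complex \<Rightarrow> complex \<Rightarrow> real \<times> real" where
  "ideal_ends z w = (geod_centre z w - geod_radius z w, geod_centre z w + geod_radius z w)"

lemma geod_radius_pos: "0 < Im z \<Longrightarrow> 0 < geod_radius z w"
  unfolding geod_radius_def by (simp add: add_nonneg_pos)

lemma geod_centre_eqs:
  assumes "Re z < Re w"
  shows "Re z - geod_centre z w = ((Re z - Re w)\<^sup>2 + (Im w)\<^sup>2 - (Im z)\<^sup>2) / (2 * (Re z - Re w))"
    and "Re w - geod_centre z w = - ((Re z - Re w)\<^sup>2 + (Im z)\<^sup>2 - (Im w)\<^sup>2) / (2 * (Re z - Re w))"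
  using assms unfolding geod_centre_def by (simp_all add: divide_simps) (simp_all add: algebra_simps power2_eq_square)

lemma geod_radius_eq:
  assumes "Re z < Re w"
  shows "geod_radius z w = hdist_root z w / (2 * (Re w - Re z))"
proof -
  let ?A = "Re z - Re w" and ?B = "(Re z - Re w)\<^sup>2 + (Im w)\<^sup>2 - (Im z)\<^sup>2"
  have "(Re z - geod_centre z w)\<^sup>2 + (Im z)\<^sup>2 = (?B\<^sup>2 + 4 * ?A\<^sup>2 * (Im z)\<^sup>2) / (2 * (Re w - Re z))\<^sup>2"
    unfolding geod_centre_eqs[OF assms] using assms
    by (simp add: divide_simps) (simp add: power2_eq_square algebra_simps)
  then show ?thesis
    unfolding geod_radius_def hdist_root_def using assms by (simp add: real_sqrt_divide)
qed

lemma geod_radius_square: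
  assumes "Re z < Re w"
  shows "(geod_radius z w)\<^sup>2 = (Re z - geod_centre z w)\<^sup>2 + (Im z)\<^sup>2"
    and "(geod_radius z w)\<^sup>2 = (Re w - geod_centre z w)\<^sup>2 + (Im w)\<^sup>2"
proof -
  show 1: "(geod_radius z w)\<^sup>2 = (Re z - geod_centre z w)\<^sup>2 + (Im z)\<^sup>2"
    unfolding geod_radius_def by simp
  show "(geod_radius z w)\<^sup>2 = (Re w - geod_centre z w)\<^sup>2 + (Im w)\<^sup>2"
    unfolding 1 geod_centre_eqs[OF assms] using assms
    by (simp add: divide_simps) (simp add: power2_eq_square algebra_simps)
qed

text \<open>\<open>as\<close> and \<open>at'\<close> are the partial derivatives of the centre.
  While one boundary point moves, the other stays on the circle, and differentiating the circle
  equation of the latter gives \<open>rs * as\<close> and \<open>rt * at'\<close> for the radius.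
  The ideal ends are centre minus and plus radius, so the determinant is 2 as at' (rt - rs). The
  divisor is the (v - u)^2 of the Liouville density.\<close>

lemma
  fixes c :: "real \<Rightarrow> complex"
  assumes s: "(c has_vector_derivative p) (at s)" and t: "(c has_vector_derivative q) (at t)"
    and pos: "0 < Im (c s)" "0 < Im (c t)" and less: "Re (c s) < Re (c t)"
  defines "as \<equiv> hdist_tra (c s) p (c t) / (2 * (Re (c s) - Re (c t))\<^sup>2)"
    and "at' \<equiv> hdist_tra (c t) q (c s) / (2 * (Re (c s) - Re (c t))\<^sup>2)"
    and "rs \<equiv> - (Re (c t) - geod_centre (c s) (c t)) / geod_radius (c s) (c t)"
    and "rt \<equiv> - (Re (c s) - geod_centre (c s) (c t)) / geod_radius (c s) (c t)"
  shows has_derivative_ideal_ends: "((\<lambda>p. ideal_ends (c (fst p)) (c (snd p))) has_derivative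
      (\<lambda>(h, k). ((as - rs * as) * h + (at' - rt * at') * k, (as + rs * as) * h + (at' + rt * at') * k)))
      (at (s, t) within S)" (is ?D)
    and jacobian_ideal_ends: "((as - rs * as) * (at' + rt * at') - (at' - rt * at') * (as + rs * as))
       / (2 * geod_radius (c s) (c t))\<^sup>2 = hdist_dd (c s) p (c t) q / 2" (is ?J)
proof -
  define x1 where "x1 = Re (c s)"
  define y1 where "y1 = Im (c s)"
  define x2 where "x2 = Re (c t)"
  define y2 where "y2 = Im (c t)"
  define a where "a = geod_centre (c s) (c t)"
  define r where "r = geod_radius (c s) (c t)"
  have lt: "x1 < x2" using less by (simp add: x1_def x2_def)
  have r: "r > 0" unfolding r_def by (rule geod_radius_pos[OF pos(1)])
  have a: "a * (2 * (x2 - x1)) = x2\<^sup>2 + y2\<^sup>2 - x1\<^sup>2 - y1\<^sup>2"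
    unfolding a_def geod_centre_def using lt by (simp add: x1_def x2_def y1_def y2_def)
  have r2: "(x1 - a)\<^sup>2 + y1\<^sup>2 = r\<^sup>2"
    using geod_radius_square(1)[OF less] by (simp add: x1_def y1_def a_def r_def)
  have ds: "((\<lambda>t. Re (c t)) has_real_derivative Re p) (at s)" "((\<lambda>t. Im (c t)) has_real_derivative Im p) (at s)"
    using s by (auto simp: has_vector_derivative_complex_iff)
  have dt: "((\<lambda>t. Re (c t)) has_real_derivative Re q) (at t)" "((\<lambda>t. Im (c t)) has_real_derivative Im q) (at t)"
    using t by (auto simp: has_vector_derivative_complex_iff)
  have f: "(fst has_derivative fst) (at (s, t) within S)" "(snd has_derivative snd) (at (s, t) within S)"
    by (auto intro: bounded_linear_imp_has_derivative bounded_linear_fst bounded_linear_snd)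
  have X1: "((\<lambda>p. Re (c (fst p))) has_derivative (\<lambda>h. Re p * fst h)) (at (s, t) within S)"
    and Y1: "((\<lambda>p. Im (c (fst p))) has_derivative (\<lambda>h. Im p * fst h)) (at (s, t) within S)"
    using has_derivative_compose[OF f(1), of _ "(*) _"] ds by (auto simp: has_field_derivative_def)
  have X2: "((\<lambda>p. Re (c (snd p))) has_derivative (\<lambda>h. Re q * snd h)) (at (s, t) within S)"
    and Y2: "((\<lambda>p. Im (c (snd p))) has_derivative (\<lambda>h. Im q * snd h)) (at (s, t) within S)"
    using has_derivative_compose[OF f(2), of _ "(*) _"] dt by (auto simp: has_field_derivative_def)
  have as: "as = - ((x1 - a) * Re p + y1 * Im p) / (x2 - x1)"
    and at': "at' = ((x2 - a) * Re q + y2 * Im q) / (x2 - x1)"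
    unfolding as_def at'_def hdist_tra_def a_def x1_def x2_def geod_centre_eqs[OF less] y1_def y2_def
    using less by (simp_all add: divide_simps) (simp_all add: algebra_simps power2_eq_square)
  have A: "((\<lambda>p. geod_centre (c (fst p)) (c (snd p))) has_derivative (\<lambda>h. as * fst h + at' * snd h))
      (at (s, t) within S)"
  proof -
    have "((\<lambda>p. geod_centre (c (fst p)) (c (snd p))) has_derivative
       (\<lambda>h. ((2 * x2 * (Re q * snd h) + 2 * y2 * (Im q * snd h) - 2 * x1 * (Re p * fst h) - 2 * y1 * (Im p * fst h))
              * (2 * (x2 - x1)) - (x2\<^sup>2 + y2\<^sup>2 - x1\<^sup>2 - y1\<^sup>2) * (2 * (Re q * snd h - Re p * fst h)))
            / ((2 * (x2 - x1)) * (2 * (x2 - x1)))))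
      (at (s, t) within S)"
      unfolding geod_centre_def
      by (rule has_derivative_eq_rhs, (rule X1 Y1 X2 Y2 derivative_intros)+)
        (use lt in \<open>auto simp: x1_def x2_def y1_def y2_def power2_eq_square fun_eq_iff\<close>)
    moreover have "((2 * x2 * (Re q * k) + 2 * y2 * (Im q * k) - 2 * x1 * (Re p * h) - 2 * y1 * (Im p * h))
              * (2 * (x2 - x1)) - (x2\<^sup>2 + y2\<^sup>2 - x1\<^sup>2 - y1\<^sup>2) * (2 * (Re q * k - Re p * h)))
            / ((2 * (x2 - x1)) * (2 * (x2 - x1))) = as * h + at' * k" for h k
      unfolding a[symmetric] as at' using lt
      by (simp add: divide_simps) (simp add: algebra_simps)
    ultimately show ?thesis by simp
  qed
  have R: "((\<lambda>p. geod_radius (c (fst p)) (c (snd p))) has_derivative (\<lambda>h. rs * as * fst h + rt * at' * snd h))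
      (at (s, t) within S)"
  proof -
    have sq: "((\<lambda>p. (Re (c (fst p)) - geod_centre (c (fst p)) (c (snd p)))\<^sup>2 + (Im (c (fst p)))\<^sup>2) has_derivative
       (\<lambda>h. 2 * (x1 - a) * (Re p * fst h - (as * fst h + at' * snd h)) + 2 * y1 * (Im p * fst h)))
      (at (s, t) within S)"
      by (rule has_derivative_eq_rhs[OF has_derivative_add[OF
            has_derivative_power[OF has_derivative_diff[OF X1 A]] has_derivative_power[OF Y1]]])
        (simp add: fun_eq_iff x1_def y1_def a_def algebra_simps)
    have val: "(Re (c (fst (s, t))) - geod_centre (c (fst (s, t))) (c (snd (s, t))))\<^sup>2 + (Im (c (fst (s, t))))\<^sup>2 = r\<^sup>2"
      using r2 by (simp add: x1_def y1_def a_def)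
    have "((\<lambda>p. geod_radius (c (fst p)) (c (snd p))) has_derivative
       (\<lambda>h. (2 * (x1 - a) * (Re p * fst h - (as * fst h + at' * snd h)) + 2 * y1 * (Im p * fst h)) * (inverse r / 2)))
      (at (s, t) within S)"
      using has_derivative_real_sqrt[OF _ sq, unfolded val] r unfolding geod_radius_def by simp
    moreover have "(2 * (x1 - a) * (Re p * h - (as * h + at' * k)) + 2 * y1 * (Im p * h)) * (inverse r / 2)
       = rs * as * h + rt * at' * k" for h k
    proof -
      \<comment> \<open>This exchanges the circle equation at the first point, which defines the
        radius, for the one at the second point, which is at rest while s varies.\<close>
      have "(x1 - a) * (Re p - as) + y1 * Im p = - (x2 - a) * as"
        unfolding as using lt by (simp add: divide_simps) (simp add: algebra_simps)
      then have "(2 * (x1 - a) * (Re p * h - (as * h + at' * k)) + 2 * y1 * (Im p * h))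
         = 2 * (- (x2 - a) * as) * h - 2 * (x1 - a) * at' * k" by algebra
      then show ?thesis
        unfolding rs_def rt_def x1_def[symmetric] x2_def[symmetric] a_def[symmetric] r_def[symmetric]
        using r by (simp only:) (simp add: divide_simps algebra_simps)
    qed
    ultimately show ?thesis by (simp only:)
  qed
  show ?D
    unfolding ideal_ends_def
    by (rule has_derivative_eq_rhs, (rule A R derivative_intros)+) (auto simp: fun_eq_iff algebra_simps)
  have det: "(as - rs * as) * (at' + rt * at') - (at' - rt * at') * (as + rs * as) = 2 * as * at' * (rt - rs)"
    by algebra
  have rr: "rt - rs = (x2 - x1) / r"
    unfolding rs_def rt_def x1_def[symmetric] x2_def[symmetric] a_def[symmetric] r_def[symmetric]
    using r by (simp add: divide_simps)
  have rR: "r = hdist_root (c s) (c t) / (2 * (x2 - x1))"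
    unfolding r_def x1_def x2_def by (rule geod_radius_eq[OF less])
  have H: "hdist_root (c s) (c t) = 2 * r * (x2 - x1)"
    using rR lt by (simp add: field_simps)
  show ?J
    unfolding det rr hdist_dd_def H r_def[symmetric] unfolding as_def at'_def x1_def[symmetric] x2_def[symmetric]
    using r lt by (simp add: divide_simps power2_eq_square power3_eq_cube) (simp add: algebra_simps)
qed


section \<open>Convexity in the projective model\<close>

text \<open>This injection of the half plane into the plane sends geodesics to line segments: it is the
  projective (Klein) model, with the ideal boundary sent to a parabola.\<close>

definition klein :: "complex \<Rightarrow> complex" where
  "klein z = Complex (Re z) ((Re z)\<^sup>2 + (Im z)\<^sup>2)"

lemma inj_on_klein: "inj_on klein upper_half_plane"
  by (auto simp: inj_on_def klein_def upper_half_plane_def complex_eq_iff power2_eq_iff_nonneg)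

lemma continuous_on_klein: "continuous_on S klein"
  unfolding klein_def by (intro continuous_intros continuous_on_Complex)

definition klein_inv :: "complex \<Rightarrow> complex" where
  "klein_inv x = Complex (Re x) (sqrt (Im x - (Re x)\<^sup>2))"

lemma continuous_on_klein_inv: "continuous_on S klein_inv"
  unfolding klein_inv_def by (intro continuous_intros continuous_on_Complex)

lemma klein_inv_klein: "0 < Im z \<Longrightarrow> klein_inv (klein z) = z"
  by (simp add: klein_def klein_inv_def complex_eq_iff)

lemma klein_klein_inv: "(Re x)\<^sup>2 < Im x \<Longrightarrow> klein (klein_inv x) = x"
  by (simp add: klein_def klein_inv_def complex_eq_iff)

lemma geodesic_pos:
  assumes "g \<in> geodesic_params"
  shows "0 < Im (g t)"
proof -
  consider (s) u v where "u < v" "g = semicircle_line u v" | (v) u where "g = vertical_line u"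
    using assms by (auto simp: geodesic_params_def)
  then show ?thesis
  proof cases
    case s
    then show ?thesis using cosh_real_pos[of t] by (simp add: semicircle_line_def)
  next
    case v
    then show ?thesis by (simp add: vertical_line_def)
  qed
qed

lemma continuous_on_geodesic:
  assumes "g \<in> geodesic_params"
  shows "continuous_on S g"
proof -
  consider (s) u v where "u < v" "g = semicircle_line u v" | (v) u where "g = vertical_line u"
    using assms by (auto simp: geodesic_params_def)
  then have "isCont g t" for t
    by cases (metis has_vector_derivative_continuous has_vector_derivative_semicircle_line,
      metis has_vector_derivative_continuous has_vector_derivative_vertical_line)
  then show ?thesis by (simp add: continuous_at_imp_continuous_on)
qed

lemma semicircle_circle_eq:
  "(Re (semicircle_line u v t) - (u + v) / 2)\<^sup>2 + (Im (semicircle_line u v t))\<^sup>2 = ((v - u) / 2)\<^sup>2"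
proof -
  define r where "r = (v - u) / 2"
  have "(r * tanh t)\<^sup>2 + (r / cosh t)\<^sup>2 = r\<^sup>2 * ((sinh t)\<^sup>2 + 1) / (cosh t)\<^sup>2"
    by (simp add: tanh_def power_mult_distrib power_divide field_simps)
  also have "\<dots> = r\<^sup>2"
    using cosh_real_pos[of t] by (simp add: cosh_square_eq[symmetric])
  finally show ?thesis
    unfolding semicircle_line_def r_def[symmetric] by simp
qed

text \<open>On a circle centred on the real axis the circle equation makes |z|^2 an affine function
  of Re z; on a vertical line Re z is constant. The parameter \<open>\<kappa>\<close> is tanh or the
  square of exp.\<close>

lemma klein_geodesic:
  assumes "g \<in> geodesic_params"
  obtains P V \<kappa> where "V \<noteq> 0" "strict_mono \<kappa>" "continuous_on UNIV \<kappa>"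
    "\<And>t. klein (g t) = P + \<kappa> t *\<^sub>R V"
proof -
  consider (s) u v where "u < v" "g = semicircle_line u v" | (v) u where "g = vertical_line u"
    using assms by (auto simp: geodesic_params_def)
  then show thesis
  proof cases
    case s
    define a where "a = (u + v) / 2"
    define r where "r = (v - u) / 2"
    have r: "r > 0" using s by (simp add: r_def)
    have eq: "klein (g t) = Complex a (2 * a * a - a\<^sup>2 + r\<^sup>2) + tanh t *\<^sub>R Complex r (2 * a * r)" for t
    proof -
      have 1: "(Re (g t) - a)\<^sup>2 + (Im (g t))\<^sup>2 = r\<^sup>2"
        using semicircle_circle_eq[of u v t] unfolding s(2) a_def r_def .
      have 2: "Re (g t) = a + r * tanh t"
        unfolding s(2) semicircle_line_def a_def r_def by simp
      have "(Re (g t))\<^sup>2 + (Im (g t))\<^sup>2 = 2 * a * Re (g t) - a\<^sup>2 + r\<^sup>2"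
        using 1 by (simp add: power2_eq_square algebra_simps)
      then show ?thesis unfolding klein_def by (simp add: 2 complex_eq_iff algebra_simps)
    qed
    show thesis
    proof (rule that[OF _ _ _ eq])
      show "Complex r (2 * a * r) \<noteq> 0" using r by (simp add: complex_eq_iff)
      show "strict_mono (tanh :: real \<Rightarrow> real)" by (simp add: strict_mono_def)
      show "continuous_on UNIV (tanh :: real \<Rightarrow> real)"
        by (intro continuous_intros) (simp add: less_imp_neq[symmetric])
    qed
  next
    case v
    have eq: "klein (g t) = Complex u (u\<^sup>2) + (exp t)\<^sup>2 *\<^sub>R Complex 0 1" for t
      unfolding v klein_def vertical_line_def by (simp add: complex_eq_iff)
    show thesis
    proof (rule that[OF _ _ _ eq])
      show "Complex 0 1 \<noteq> 0" by (simp add: complex_eq_iff)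
      show "strict_mono (\<lambda>t :: real. (exp t)\<^sup>2)"
        by (simp add: strict_mono_def power_strict_mono)
      show "continuous_on UNIV (\<lambda>t :: real. (exp t)\<^sup>2)"
        by (intro continuous_intros)
    qed
  qed
qed

lemma inj_geodesic:
  assumes "g \<in> geodesic_params"
  shows "inj g"
proof -
  obtain P V \<kappa> where "V \<noteq> 0" "strict_mono \<kappa>" "\<And>t. klein (g t) = P + \<kappa> t *\<^sub>R V"
    using klein_geodesic[OF assms] by metis
  then show ?thesis
    by (metis (no_types, lifting) add_left_cancel injI scaleR_cancel_right strict_mono_eq)
qed

lemma klein_image_geodesic:
  assumes g: "g \<in> geodesic_params" and ab: "a \<le> b"
  shows "klein ` g ` {a..b} = closed_segment (klein (g a)) (klein (g b))"
proof -
  obtain P V \<kappa> where V: "V \<noteq> 0" and mono: "strict_mono \<kappa>" and cont: "continuous_on UNIV \<kappa>"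
    and k: "\<And>t. klein (g t) = P + \<kappa> t *\<^sub>R V"
    using klein_geodesic[OF g] by metis
  have le: "\<kappa> a \<le> \<kappa> b" using mono ab by (simp add: strict_mono_less_eq)
  have img: "\<kappa> ` {a..b} = {\<kappa> a..\<kappa> b}"
  proof
    show "\<kappa> ` {a..b} \<subseteq> {\<kappa> a..\<kappa> b}"
      using mono by (auto simp: strict_mono_less_eq)
    show "{\<kappa> a..\<kappa> b} \<subseteq> \<kappa> ` {a..b}"
    proof
      fix y assume "y \<in> {\<kappa> a..\<kappa> b}"
      then show "y \<in> \<kappa> ` {a..b}"
        using IVT'[of \<kappa> a y b] ab continuous_on_subset[OF cont, of "{a..b}"] by auto
    qed
  qed
  have "klein ` g ` {a..b} = (\<lambda>x. P + x *\<^sub>R V) ` \<kappa> ` {a..b}"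
    by (simp add: image_image k)
  also have "\<dots> = (\<lambda>x. P + x *\<^sub>R V) ` closed_segment (\<kappa> a) (\<kappa> b)"
    unfolding img using le by (simp add: closed_segment_eq_real_ivl)
  also have "\<dots> = (+) P ` (\<lambda>x. x *\<^sub>R V) ` closed_segment (\<kappa> a) (\<kappa> b)"
    by (simp add: image_image)
  also have "\<dots> = closed_segment (P + \<kappa> a *\<^sub>R V) (P + \<kappa> b *\<^sub>R V)"
    by (simp add: closed_segment_linear_image[symmetric] closed_segment_translation linear_iff scaleR_add_left)
  finally show ?thesis by (simp add: k)
qed

lemma klein_open_segment:
  assumes g: "g \<in> geodesic_params" and "a < m" "m < b"
  shows "klein (g m) \<in> open_segment (klein (g a)) (klein (g b))"
    and "klein (g m) \<in> open_segment (klein (g b)) (klein (g a))"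
proof -
  have "klein (g m) \<in> klein ` g ` {a..b}" using assms by auto
  moreover have "klein (g m) \<noteq> klein (g x)" if "x \<noteq> m" for x
    using that inj_onD[OF inj_on_klein, of "g m" "g x"] geodesic_pos[OF g] injD[OF inj_geodesic[OF g], of m x]
    by (auto simp: upper_half_plane_def)
  ultimately show "klein (g m) \<in> open_segment (klein (g a)) (klein (g b))"
    using assms klein_image_geodesic[OF g, of a b] by (auto simp: open_segment_def)
  then show "klein (g m) \<in> open_segment (klein (g b)) (klein (g a))"
    by (simp add: open_segment_commute)
qed

lemma semicircle_line_in_params: "u < v \<Longrightarrow> semicircle_line u v \<in> geodesic_params"
  by (auto simp: geodesic_params_def)

lemma vertical_line_in_params: "vertical_line u \<in> geodesic_params"
  by (auto simp: geodesic_params_def)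

text \<open>The parameter at which \<open>semicircle_line u v\<close> passes through \<open>z\<close>.\<close>

definition semicircle_time :: "real \<Rightarrow> real \<Rightarrow> complex \<Rightarrow> real" where
  "semicircle_time u v z = arsinh ((Re z - (u + v) / 2) / Im z)"

lemma semicircle_line_time:
  assumes "u < v" "0 < Im z" "(Re z - (u + v) / 2)\<^sup>2 + (Im z)\<^sup>2 = ((v - u) / 2)\<^sup>2"
  shows "semicircle_line u v (semicircle_time u v z) = z"
    and "sinh (semicircle_time u v z) = (Re z - (u + v) / 2) / Im z"
    and "cosh (semicircle_time u v z) = (v - u) / 2 / Im z"
proof -
  let ?t = "semicircle_time u v z"
  show sh: "sinh ?t = (Re z - (u + v) / 2) / Im z"
    by (simp add: semicircle_time_def)
  have X: "(X / Im z)\<^sup>2 + 1 = (X\<^sup>2 + (Im z)\<^sup>2) / (Im z)\<^sup>2" for X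
    using assms(2) by (simp add: power_divide add_divide_distrib)
  have "(cosh ?t)\<^sup>2 = ((v - u) / 2 / Im z)\<^sup>2"
    unfolding cosh_square_eq sh X assms(3) by (simp only: power_divide)
  moreover have "0 \<le> (v - u) / 2 / Im z" "0 \<le> cosh ?t" using assms by simp_all
  ultimately show ch: "cosh ?t = (v - u) / 2 / Im z"
    using power2_eq_iff_nonneg by blast
  show "semicircle_line u v ?t = z"
  proof -
    have e: "r * (X / Im z / (r / Im z)) = X" "r / (r / Im z) = Im z" if "r > 0" for r X
      using that assms(2) by simp_all
    have "(v - u) / 2 > 0" using assms(1) by simp
    note e = e[OF this]
    show ?thesis
      unfolding semicircle_line_def tanh_def sh ch e by (simp add: complex_eq_iff)
  qed
qed

lemma semicircle_time_line:
  assumes "u < v"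
  shows "semicircle_time u v (semicircle_line u v t) = t"
proof -
  have "semicircle_line u v (semicircle_time u v (semicircle_line u v t)) = semicircle_line u v t"
    by (rule semicircle_line_time(1)[OF assms geodesic_pos[OF semicircle_line_in_params[OF assms]]
          semicircle_circle_eq])
  then show ?thesis
    using inj_geodesic[OF semicircle_line_in_params[OF assms]] by (auto dest: injD)
qed

lemma strict_mono_Re_semicircle_line:
  assumes "u < v"
  shows "Re (semicircle_line u v s) < Re (semicircle_line u v t) \<longleftrightarrow> s < t"
  using assms by (simp add: semicircle_line_def)

lemma ideal_ends_less: "0 < Im z \<Longrightarrow> fst (ideal_ends z w) < snd (ideal_ends z w)"
  using geod_radius_pos[of z w] by (simp add: ideal_ends_def)

lemma ideal_ends_circle:
  assumes "Re z < Re w" "ideal_ends z w = (u, v)"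
  shows "(Re z - (u + v) / 2)\<^sup>2 + (Im z)\<^sup>2 = ((v - u) / 2)\<^sup>2"
    and "(Re w - (u + v) / 2)\<^sup>2 + (Im w)\<^sup>2 = ((v - u) / 2)\<^sup>2"
proof -
  have "(u + v) / 2 = geod_centre z w" "(v - u) / 2 = geod_radius z w"
    using assms(2) by (auto simp: ideal_ends_def)
  then show "(Re z - (u + v) / 2)\<^sup>2 + (Im z)\<^sup>2 = ((v - u) / 2)\<^sup>2"
    and "(Re w - (u + v) / 2)\<^sup>2 + (Im w)\<^sup>2 = ((v - u) / 2)\<^sup>2"
    using geod_radius_square[OF assms(1)] by simp_all
qed

lemma ideal_ends_unique:
  assumes "Re z < Re w" "u < v"
    and "(Re z - (u + v) / 2)\<^sup>2 + (Im z)\<^sup>2 = ((v - u) / 2)\<^sup>2"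
    and "(Re w - (u + v) / 2)\<^sup>2 + (Im w)\<^sup>2 = ((v - u) / 2)\<^sup>2"
  shows "ideal_ends z w = (u, v)"
proof -
  \<comment> \<open>Subtracting the two circle equations leaves a linear equation for the
    centre.\<close>
  have "b * (2 * (Re w - Re z)) = (Re w)\<^sup>2 + (Im w)\<^sup>2 - (Re z)\<^sup>2 - (Im z)\<^sup>2"
    if "(Re z - b)\<^sup>2 + (Im z)\<^sup>2 = r" "(Re w - b)\<^sup>2 + (Im w)\<^sup>2 = r" for b r :: real
    using that by (simp add: power2_eq_square algebra_simps)
  from this[OF assms(3,4)]
  have "(u + v) / 2 * (2 * (Re w - Re z)) = (Re w)\<^sup>2 + (Im w)\<^sup>2 - (Re z)\<^sup>2 - (Im z)\<^sup>2" .
  then have a: "geod_centre z w = (u + v) / 2"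
    unfolding geod_centre_def using assms(1) by (simp add: divide_simps)
  have "geod_radius z w = (v - u) / 2"
    unfolding geod_radius_def a assms(3) using assms(2) by simp
  then show ?thesis unfolding ideal_ends_def a by (simp add: field_simps)
qed

lemma geodesic_through:
  assumes "0 < Im z" "0 < Im w" "z \<noteq> w"
  obtains g a b where "g \<in> geodesic_params" "a < b" "{g a, g b} = {z, w}"
proof -
  have semi: "\<exists>g a b. g \<in> geodesic_params \<and> a < b \<and> g a = z \<and> g b = w"
    if "0 < Im z" "0 < Im w" "Re z < Re w" for z w
  proof -
    obtain u v where uv: "ideal_ends z w = (u, v)" by fastforce
    have lt: "u < v" using ideal_ends_less[OF that(1), of w] uv by simp
    note c = ideal_ends_circle[OF that(3) uv]
    have "semicircle_line u v (semicircle_time u v z) = z" "semicircle_line u v (semicircle_time u v w) = w"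
      using semicircle_line_time(1)[OF lt that(1) c(1)] semicircle_line_time(1)[OF lt that(2) c(2)] by auto
    then show ?thesis
      using strict_mono_Re_semicircle_line[OF lt] that(3) semicircle_line_in_params[OF lt] by metis
  qed
  have vert: "\<exists>g a b. g \<in> geodesic_params \<and> a < b \<and> g a = z \<and> g b = w"
    if "0 < Im z" "Re z = Re w" "Im z < Im w" for z w
    using that by (intro exI[of _ "vertical_line (Re z)"] exI[of _ "ln (Im z)"] exI[of _ "ln (Im w)"])
      (simp add: vertical_line_in_params vertical_line_def complex_eq_iff)
  consider "Re z < Re w" | "Re w < Re z" | "Re z = Re w" "Im z < Im w" | "Re w = Re z" "Im w < Im z"
    using assms(3) by (metis complex_eq_iff linorder_neqE)
  then have "(\<exists>g a b. g \<in> geodesic_params \<and> a < b \<and> g a = z \<and> g b = w) \<or>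
      (\<exists>g a b. g \<in> geodesic_params \<and> a < b \<and> g a = w \<and> g b = z)"
    using semi[of z w] semi[of w z] vert[of z w] vert[of w z] assms(1,2) by cases simp_all
  then show thesis
    using that by (auto simp: insert_commute)
qed

text \<open>The segment between two points of the image is the image of a geodesic segment. This
  makes supporting lines and the interior of Euclidean convex sets available for D.\<close>

lemma convex_klein_image:
  assumes "D \<subseteq> upper_half_plane" "hyp_convex D"
  shows "convex (klein ` D)"
  unfolding convex_contains_segment
proof (intro ballI)
  fix x y assume "x \<in> klein ` D" "y \<in> klein ` D"
  then obtain z w where z: "z \<in> D" "x = klein z" and w: "w \<in> D" "y = klein w" by auto
  show "closed_segment x y \<subseteq> klein ` D"
  proof (cases "z = w")
    case False
    have pos: "0 < Im z" "0 < Im w" using z w assms(1) by (auto simp: upper_half_plane_def)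
    obtain g a b where g: "g \<in> geodesic_params" "a < b" "{g a, g b} = {z, w}"
      using geodesic_through[OF pos False] by blast
    have "g a \<in> D" "g b \<in> D" using g(3) z w by (auto simp: doubleton_eq_iff)
    then have "g ` {a..b} \<subseteq> D" using assms(2) g unfolding hyp_convex_def by auto
    moreover have "closed_segment x y = closed_segment (klein (g a)) (klein (g b))"
      using g(3) z w by (auto simp: doubleton_eq_iff closed_segment_commute)
    ultimately have "closed_segment x y = klein ` g ` {a..b}"
      using klein_image_geodesic[OF g(1), of a b] g(2) by simp
    then show ?thesis using \<open>g ` {a..b} \<subseteq> D\<close> by (simp add: image_mono)
  qed (use z w in auto)
qed

text \<open>\<open>klein\<close> is a homeomorphism of the half plane onto the open region above the
  parabola, with inverse \<open>klein_inv\<close>; each direction pulls an open set back along a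
  continuous map.\<close>

lemma klein_mem_interior_iff:
  assumes D: "D \<subseteq> upper_half_plane" and z: "0 < Im z"
  shows "klein z \<in> interior (klein ` D) \<longleftrightarrow> z \<in> interior D"
proof
  assume *: "klein z \<in> interior (klein ` D)"
  let ?U = "klein -` interior (klein ` D) \<inter> {w. 0 < Im w}"
  have "open {w. 0 < Im w}" by (rule open_halfspace_Im_gt)
  then have "open ?U"
    by (intro open_Int open_vimage continuous_on_klein) auto
  moreover have "?U \<subseteq> D"
  proof
    fix w assume w: "w \<in> ?U"
    then obtain w' where w': "w' \<in> D" "klein w = klein w'"
      using interior_subset[of "klein ` D"] by auto
    then have "w = w'" using inj_on_klein w D by (auto simp: inj_on_def upper_half_plane_def)
    then show "w \<in> D" using w' by simp
  qed
  moreover have "z \<in> ?U" using * z by simp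
  ultimately show "z \<in> interior D" by (meson interiorI)
next
  assume *: "z \<in> interior D"
  let ?U = "klein_inv -` interior D \<inter> {x. (Re x)\<^sup>2 < Im x}"
  have "open {x. (Re x)\<^sup>2 < Im x}"
    by (intro open_Collect_less continuous_intros)
  then have "open ?U"
    by (intro open_Int open_vimage continuous_on_klein_inv) auto
  moreover have "?U \<subseteq> klein ` D"
    using interior_subset[of D] klein_klein_inv by (auto simp: image_iff) (metis subsetD)
  moreover have "klein z \<in> ?U"
    using * z klein_inv_klein by (simp add: klein_def[of z]) (simp add: klein_def)
  ultimately show "klein z \<in> interior (klein ` D)" by (meson interiorI)
qed

section \<open>Strictly convex domains\<close>

lemma infinite_obtain_three:
  fixes L :: "real set"
  assumes "infinite L"
  obtains a m b where "a \<in> L" "m \<in> L" "b \<in> L" "a < m" "m < b"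
proof -
  obtain x where x: "x \<in> L" using assms infinite_imp_nonempty by blast
  obtain y where y: "y \<in> L - {x}" using assms infinite_imp_nonempty[of "L - {x}"] by auto
  obtain z where z: "z \<in> L - {x, y}" using assms infinite_imp_nonempty[of "L - {x, y}"] by auto
  have "x < y \<and> y < z \<or> x < z \<and> z < y \<or> y < x \<and> x < z \<or> y < z \<and> z < x \<or> z < x \<and> x < y \<or> z < y \<and> y < x"
    using y z by force
  then show thesis using that x y z by blast
qed

text \<open>\<open>no_segment\<close> enters through \<open>strictly_convex\<close>: a geodesic then
  cannot carry three boundary points. The nonvanishing of \<open>hdist_tra\<close> and the
  description of chords by their endpoints rest on this.\<close>

locale smooth_domain =
  fixes D :: "complex set" and c :: "real \<Rightarrow> complex"
  assumes domain: "compact_convex_domain D"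
    and param: "C1_boundary_param D c"
    and no_segment: "\<not> contains_geodesic_segment (frontier D)"
begin

lemma D_sub: "D \<subseteq> upper_half_plane" and compact_D: "compact D" and hyp_convex_D: "hyp_convex D"
  and interior_D: "interior D \<noteq> {}"
  using domain by (auto simp: compact_convex_domain_def)

lemma D_pos: "z \<in> D \<Longrightarrow> 0 < Im z"
  using D_sub by (auto simp: upper_half_plane_def)

lemma closed_D: "closed D"
  by (rule compact_imp_closed[OF compact_D])

lemma frontier_D: "frontier D = D - interior D"
  using closed_D by (simp add: frontier_def closure_closed)

lemma geodesic_segment_in_D:
  assumes "g \<in> geodesic_params" "g a \<in> D" "g b \<in> D" "a \<le> t" "t \<le> b"
  shows "g t \<in> D"
proof -
  have "g ` {a..b} \<subseteq> D"
    using hyp_convex_D assms unfolding hyp_convex_def by auto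
  then show ?thesis using assms by auto
qed

abbreviation "K \<equiv> klein ` D"

lemma convex_K: "convex K"
  by (rule convex_klein_image[OF D_sub hyp_convex_D])

lemma interior_K_iff: "0 < Im z \<Longrightarrow> klein z \<in> interior K \<longleftrightarrow> z \<in> interior D"
  by (rule klein_mem_interior_iff[OF D_sub])

text \<open>If \<open>g m\<close> is not interior then no point of the open segment is: \<open>g m\<close> would lie between that
  point and \<open>g a\<close> or \<open>g b\<close>. So the boundary contains a segment.\<close>

lemma strictly_convex:
  assumes g: "g \<in> geodesic_params" and ab: "a < m" "m < b" and D: "g a \<in> D" "g b \<in> D"
  shows "g m \<in> interior D"
proof (rule ccontr)
  assume m: "g m \<notin> interior D"
  have "g n \<notin> interior D" if n: "a < n" "n < b" for n
  proof
    assume "g n \<in> interior D"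
    then have nK: "klein (g n) \<in> interior K"
      using interior_K_iff geodesic_pos[OF g] by simp
    have "klein (g m) \<in> interior K"
    proof -
      have cl: "klein (g a) \<in> closure K" "klein (g b) \<in> closure K"
        using D closure_subset[of K] by auto
      consider "m = n" | "a < m" "m < n" | "n < m" "m < b" using ab by linarith
      then show ?thesis
        using nK in_interior_closure_convex_segment[OF convex_K nK cl(1)]
          in_interior_closure_convex_segment[OF convex_K nK cl(2)]
          klein_open_segment[OF g, of a m n] klein_open_segment[OF g, of n m b]
        by cases auto
    qed
    then show False using m interior_K_iff geodesic_pos[OF g] by simp
  qed
  \<comment> \<open>The middle third of the parameter interval is nondegenerate and avoids the
    endpoints, for which nothing has been shown.\<close>
  then have "g ` {(2 * a + b) / 3..(a + 2 * b) / 3} \<subseteq> frontier D"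
    unfolding frontier_D using geodesic_segment_in_D[OF g D] ab by (auto simp: field_simps)
  then have "contains_geodesic_segment (frontier D)"
    unfolding contains_geodesic_segment_def using g ab
    by (intro bexI[OF _ g] exI[of _ "(2 * a + b) / 3"] exI[of _ "(a + 2 * b) / 3"]) auto
  then show False using no_segment by simp
qed

subsection \<open>The boundary curve\<close>

definition c' :: "real \<Rightarrow> complex" where
  "c' t = vector_derivative c (at t)"

lemma c_deriv: "(c has_vector_derivative c' t) (at t)"
  using param unfolding C1_boundary_param_def C1_differentiable_on_eq c'_def
  by (simp add: vector_derivative_works)

lemma continuous_c': "continuous_on S c'"
  using param unfolding C1_boundary_param_def C1_differentiable_on_eq c'_def[abs_def]
  by (auto intro: continuous_on_subset)

lemma continuous_c: "continuous_on S c"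
  using c_deriv by (auto intro!: continuous_at_imp_continuous_on has_vector_derivative_continuous)

lemma c'_nonzero: "c' t \<noteq> 0"
  using param by (simp add: C1_boundary_param_def c'_def)

lemma c_eq_iff: "c s = c t \<longleftrightarrow> s - t \<in> \<int>"
  using param by (simp add: C1_boundary_param_def)

lemma range_c: "range c = frontier D"
  using param by (simp add: C1_boundary_param_def)

lemma c_frontier: "c t \<in> frontier D"
  using range_c by auto

lemma c_in_D: "c t \<in> D"
  using c_frontier[of t] frontier_D by auto

lemma c_not_interior: "c t \<notin> interior D"
  using c_frontier[of t] frontier_D by auto

lemma c_pos: "0 < Im (c t)"
  by (rule D_pos[OF c_in_D])

lemma c_eq_iff_unit: "s \<in> {0..<1} \<Longrightarrow> t \<in> {0..<1} \<Longrightarrow> c s = c t \<longleftrightarrow> s = t"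
  unfolding c_eq_iff using Ints_nonzero_abs_less1[of "s - t"] by auto

lemma frontier_obtain:
  assumes "z \<in> frontier D"
  obtains t where "t \<in> {0..<1}" "c t = z"
proof -
  obtain t where t: "c t = z" using assms range_c by (metis rangeE)
  have "c (frac t) = z" using t c_eq_iff[of "frac t" t] by (simp add: frac_def)
  moreover have "frac t \<in> {0..<1}" by (simp add: frac_lt_1)
  ultimately show thesis using that by blast
qed

text \<open>\<open>klein\<close> maps the tangent vector p to (Re p, 2 Re z Re p + 2 Im z Im p), and
  the left factor is this vector turned by a right angle. So the sign of
  \<open>hdist_tra z p w\<close> tells on which side of the geodesic tangent to p the point w
  lies.\<close>

lemma hdist_tra_eq:
  "hdist_tra z p w = (Re p * \<i> - (2 * Re z * Re p + 2 * Im z * Im p)) \<bullet> (klein w - klein z)"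
  by (simp add: hdist_tra_def klein_def inner_complex_def power2_eq_square algebra_simps)

text \<open>A supporting functional of \<open>K\<close> at \<open>klein (c s)\<close> is minimal there along the boundary curve, hence
  normal to its tangent vector; so it is \<open>hdist_tra (c s) (c' s)\<close> up to a factor.\<close>

lemma tangent_supports:
  obtains k :: real where "k \<noteq> 0" "\<And>z. z \<in> D \<Longrightarrow> z \<noteq> c s \<Longrightarrow> 0 < k * hdist_tra (c s) (c' s) z"
proof -
  define gs where "gs = klein (c s)"
  define T where "T = Complex (Re (c' s)) (2 * Re (c s) * Re (c' s) + 2 * Im (c s) * Im (c' s))"
  have int: "interior K \<noteq> {}"
    using interior_D interior_K_iff interior_subset[of D] D_pos by blast
  have "gs \<notin> interior K"
    unfolding gs_def using interior_K_iff[OF c_pos] c_not_interior by simp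
  then have "gs \<notin> rel_interior K"
    using rel_interior_nonempty_interior[OF int] by simp
  moreover have "gs \<in> K"
    unfolding gs_def using c_in_D by blast
  ultimately obtain a where a: "a \<noteq> 0" "\<And>y. y \<in> K \<Longrightarrow> a \<bullet> gs \<le> a \<bullet> y"
    using supporting_hyperplane_rel_boundary[OF convex_K] by blast
  have "((\<lambda>t. klein (c t)) has_vector_derivative T) (at s)"
  proof -
    have dRe: "((\<lambda>t. Re (c t)) has_real_derivative Re (c' s)) (at s)"
      and dIm: "((\<lambda>t. Im (c t)) has_real_derivative Im (c' s)) (at s)"
      using c_deriv[of s] by (auto simp: has_vector_derivative_complex_iff)
    then show ?thesis
      unfolding klein_def T_def has_vector_derivative_complex_iff complex.sel
      by (intro conjI dRe) ((rule dRe dIm derivative_eq_intros refl)+, simp)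
  qed
  then have "((\<lambda>t. a \<bullet> klein (c t)) has_vector_derivative a \<bullet> T) (at s)"
    by (rule bounded_linear.has_vector_derivative[OF bounded_linear_inner_right])
  then have "((\<lambda>t. a \<bullet> klein (c t)) has_real_derivative a \<bullet> T) (at s)"
    by (simp add: has_real_derivative_iff_has_vector_derivative)
  then have aT: "a \<bullet> T = 0"
    using a(2) c_in_D by (intro DERIV_local_min[of _ _ s 1]) (auto simp: gs_def)
  have T0: "T \<noteq> 0"
    using c'_nonzero[of s] c_pos[of s] by (auto simp: T_def complex_eq_iff)
  define J where "J = Complex (- Im T) (Re T)"
  define k where "k = a \<bullet> J / (norm T)\<^sup>2"
  have aJ: "a = k *\<^sub>R J"
  proof -
    have "Re a * Re T + Im a * Im T = 0" using aT by (simp add: inner_complex_def)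
    then have "Re a * (norm T)\<^sup>2 = - Im T * (Im a * Re T - Re a * Im T)"
      "Im a * (norm T)\<^sup>2 = Re T * (Im a * Re T - Re a * Im T)"
      unfolding cmod_power2 by algebra+
    moreover define m where "m = Im a * Re T - Re a * Im T"
    moreover have k: "k = m / (norm T)\<^sup>2"
      by (simp add: k_def m_def J_def inner_complex_def)
    ultimately have "Re a * (norm T)\<^sup>2 = - Im T * m" "Im a * (norm T)\<^sup>2 = Re T * m" by simp_all
    then show ?thesis
      using T0 unfolding k by (simp add: J_def complex_eq_iff field_simps)
  qed
  have tra: "k * hdist_tra (c s) (c' s) z = a \<bullet> (klein z - gs)" for z
    unfolding hdist_tra_eq aJ gs_def by (simp add: J_def T_def inner_complex_def algebra_simps)
  show thesis
  proof (rule that)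
    show "k \<noteq> 0" using a(1) aJ by auto
    fix z assume z: "z \<in> D" "z \<noteq> c s"
    \<comment> \<open>Otherwise the supporting line contains both points and hence an inner point of
      the geodesic segment between them. By strict convexity that point is interior to
      \<open>K\<close>, so the functional drops below its minimum a little further in direction
      -a.\<close>
    have "a \<bullet> (klein z - gs) \<noteq> 0"
    proof
      assume 0: "a \<bullet> (klein z - gs) = 0"
      obtain g p q where g: "g \<in> geodesic_params" "p < q" "{g p, g q} = {z, c s}"
        using geodesic_through[OF D_pos[OF z(1)] c_pos z(2)] by blast
      have pq: "g p \<in> D" "g q \<in> D" using g(3) z c_in_D by (auto simp: doubleton_eq_iff)
      let ?m = "klein (g ((p + q) / 2))"
      have "g ((p + q) / 2) \<in> interior D"
        by (rule strictly_convex[OF g(1) _ _ pq]) (use g(2) in auto)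
      then have m: "?m \<in> interior K"
        using interior_K_iff geodesic_pos[OF g(1)] by simp
      have "?m \<in> closed_segment (klein (g p)) (klein (g q))"
        using klein_open_segment(1)[OF g(1), of p "(p + q) / 2" q] g(2) by (auto simp: open_segment_def)
      moreover have "closed_segment (klein (g p)) (klein (g q)) = closed_segment gs (klein z)"
        using g(3) by (auto simp: doubleton_eq_iff closed_segment_commute gs_def)
      ultimately obtain l where l: "?m = (1 - l) *\<^sub>R gs + l *\<^sub>R klein z"
        by (auto simp: in_segment)
      have "?m - gs = l *\<^sub>R (klein z - gs)"
        unfolding l by (simp add: algebra_simps)
      then have am: "a \<bullet> ?m = a \<bullet> gs"
        using 0 by (metis inner_diff_right inner_scaleR_right mult_zero_right right_minus_eq)
      obtain e where e: "e > 0" "cball ?m e \<subseteq> K"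
        using m unfolding mem_interior_cball by blast
      have "?m - (e / norm a) *\<^sub>R a \<in> cball ?m e"
        using e a(1) by (simp add: dist_norm)
      then have "a \<bullet> gs \<le> a \<bullet> (?m - (e / norm a) *\<^sub>R a)" using e a(2) by blast
      then have "(e / norm a) * (a \<bullet> a) \<le> 0" by (simp add: inner_diff_right am)
      moreover have "(e / norm a) * (a \<bullet> a) > 0" using e a(1) by simp
      ultimately show False by simp
    qed
    moreover have "0 \<le> a \<bullet> (klein z - gs)" using a(2)[of "klein z"] z by (simp add: inner_diff_right)
    ultimately show "0 < k * hdist_tra (c s) (c' s) z" unfolding tra by simp
  qed
qed

lemma hdist_tra_nonzero: "s - t \<notin> \<int> \<Longrightarrow> hdist_tra (c s) (c' s) (c t) \<noteq> 0"
proof -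
  assume st: "s - t \<notin> \<int>"
  obtain k where "\<And>z. z \<in> D \<Longrightarrow> z \<noteq> c s \<Longrightarrow> 0 < k * hdist_tra (c s) (c' s) z"
    using tangent_supports[of s] by metis
  moreover have "c t \<noteq> c s" using st c_eq_iff[of s t] by auto
  ultimately show ?thesis using c_in_D by force
qed

text \<open>The sign of the factor in \<open>tangent_supports\<close> could depend on s. But the
  pairs with s < t < s + 1 form a convex, hence connected set on which the continuous
  \<open>hdist_tra\<close> has no zero. The common sign is the orientation of
  \<open>c\<close>.\<close>

lemma hdist_tra_sign:
  obtains \<epsilon> :: real where "\<And>s t. s - t \<notin> \<int> \<Longrightarrow> 0 < \<epsilon> * hdist_tra (c s) (c' s) (c t)"
proof -
  let ?T = "{x :: real \<times> real. fst x < snd x \<and> snd x < fst x + 1}"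
  let ?E = "\<lambda>x. hdist_tra (c (fst x)) (c' (fst x)) (c (snd x))"
  have "?T = {x. fst x - snd x < 0} \<inter> {x. snd x - fst x < 1}" by auto
  moreover have "convex {x :: real \<times> real. fst x - snd x < 0}"
    using convex_halfspace_lt[of "(1, -1) :: real \<times> real" 0] by (simp add: inner_prod_def)
  moreover have "convex {x :: real \<times> real. snd x - fst x < 1}"
    using convex_halfspace_lt[of "(-1, 1) :: real \<times> real" 1] by (simp add: inner_prod_def)
  ultimately have conv: "convex ?T" by (simp add: convex_Int)
  have cont: "continuous_on ?T ?E"
    unfolding hdist_tra_def
    by (intro continuous_intros continuous_on_compose2[OF continuous_c[of UNIV]]
        continuous_on_compose2[OF continuous_c'[of UNIV]]) auto
  have conn: "connected (?E ` ?T)"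
    by (rule connected_continuous_image[OF cont convex_connected[OF conv]])
  have notint: "s - t \<notin> \<int>" if "s < t" "t < s + 1" for s t :: real
    using that Ints_nonzero_abs_less1[of "s - t"] by auto
  have 0: "0 \<notin> ?E ` ?T"
  proof
    assume "0 \<in> ?E ` ?T"
    then obtain x where "fst x < snd x" "snd x < fst x + 1" "?E x = 0" by auto
    then show False using hdist_tra_nonzero[of "fst x" "snd x"] notint by auto
  qed
  have sgn: "(\<forall>x\<in>?T. ?E x > 0) \<or> (\<forall>x\<in>?T. ?E x < 0)"
  proof (rule ccontr)
    assume "\<not> ?thesis"
    then obtain x y where "x \<in> ?T" "y \<in> ?T" "?E x \<le> 0" "?E y \<ge> 0" by (meson not_le)
    then have "0 \<in> ?E ` ?T" using connectedD_interval[OF conn, of "?E x" "?E y" 0] by blast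
    then show False using 0 by simp
  qed
  then obtain \<epsilon> :: real where e: "\<And>x. x \<in> ?T \<Longrightarrow> 0 < \<epsilon> * ?E x"
  proof
    assume "\<forall>x\<in>?T. ?E x > 0" then show thesis using that[of 1] by simp
  next
    assume "\<forall>x\<in>?T. ?E x < 0" then show thesis using that[of "-1"] by simp
  qed
  show thesis
  proof (rule that)
    fix s t :: real assume st: "s - t \<notin> \<int>"
    \<comment> \<open>The representative of t modulo 1 that lies between s and s + 1. Only the point
      \<open>c t\<close> and not the tangent there enters, so periodicity of \<open>c\<close> is
      enough.\<close>
    define t' where "t' = s + frac (t - s)"
    have "t - s \<notin> \<int>" using st by (metis Ints_minus minus_diff_eq)
    then have "0 < frac (t - s)" "frac (t - s) < 1"
      by (simp_all add: frac_gt_0_iff frac_lt_1)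
    then have "0 < \<epsilon> * ?E (s, t')" by (intro e) (auto simp: t'_def)
    moreover have "c t' = c t" unfolding c_eq_iff by (simp add: t'_def frac_def)
    ultimately show "0 < \<epsilon> * hdist_tra (c s) (c' s) (c t)" by simp
  qed
qed

text \<open>Both across components carry the sign given by the orientation of \<open>c\<close>, and
  it cancels in their product.\<close>

lemma hdist_dd_pos:
  assumes "s - t \<notin> \<int>"
  shows "0 < hdist_dd (c s) (c' s) (c t) (c' t)"
proof -
  obtain e where e: "\<And>s t. s - t \<notin> \<int> \<Longrightarrow> 0 < e * hdist_tra (c s) (c' s) (c t)"
    using hdist_tra_sign by blast
  have ts: "t - s \<notin> \<int>" using assms by (metis Ints_minus minus_diff_eq)
  have "0 < (e * hdist_tra (c s) (c' s) (c t)) * (e * hdist_tra (c t) (c' t) (c s))"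
    using e[OF assms] e[OF ts] by simp
  also have "\<dots> = e\<^sup>2 * (hdist_tra (c s) (c' s) (c t) * hdist_tra (c t) (c' t) (c s))"
    by (simp add: power2_eq_square)
  finally have "0 < hdist_tra (c s) (c' s) (c t) * hdist_tra (c t) (c' t) (c s)"
    by (simp add: zero_less_mult_iff)
  moreover have "0 < hdist_root (c s) (c t)"
    using assms c_eq_iff c_pos by (intro hdist_root_pos) auto
  ultimately show ?thesis unfolding hdist_dd_def by (simp add: mult.assoc)
qed

lemma no_three_collinear:
  assumes g: "g \<in> geodesic_params" and "a < m" "m < b" "g a \<in> D" "g b \<in> D"
  shows "g m \<noteq> c t"
  using strictly_convex[OF assms] c_not_interior[of t] by auto

text \<open>Three such points would lie on one geodesic. This will show that the pairs with equal
  real parts, to which no semicircle belongs, form a null set.\<close>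

lemma finite_vertical_pairs: "finite {t \<in> {0..<1}. Re (c t) = x}" (is "finite ?A")
proof (rule ccontr)
  assume inf: "infinite ?A"
  let ?g = "vertical_line x"
  let ?l = "\<lambda>t. ln (Im (c t))"
  have gl: "?g (?l t) = c t" if "t \<in> ?A" for t
    using that c_pos[of t] by (simp add: vertical_line_def complex_eq_iff)
  have "inj_on ?l ?A"
  proof (rule inj_onI)
    fix s t assume s: "s \<in> ?A" and t: "t \<in> ?A" and eq: "?l s = ?l t"
    have "c s = ?g (?l s)" by (rule gl[OF s, symmetric])
    also have "\<dots> = ?g (?l t)" by (simp only: eq)
    also have "\<dots> = c t" by (rule gl[OF t])
    finally have "c s = c t" .
    then show "s = t" using c_eq_iff_unit s t by simp
  qed
  then have "infinite (?l ` ?A)" using inf finite_imageD by blast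
  then obtain a m b where "a \<in> ?l ` ?A" "m \<in> ?l ` ?A" "b \<in> ?l ` ?A" and lt: "a < m" "m < b"
    by (rule infinite_obtain_three)
  moreover have "\<exists>t. ?g y = c t" if "y \<in> ?l ` ?A" for y
    using that gl by auto
  ultimately obtain r s t where "?g a = c r" "?g m = c s" "?g b = c t" by meson
  then show False
    using no_three_collinear[OF vertical_line_in_params lt, of x s] c_in_D by simp
qed

end


section \<open>Chords\<close>

lemma inner_sq_add_cross_sq: "(w \<bullet> h)\<^sup>2 + (Im (w * cnj h))\<^sup>2 = (norm w * norm h)\<^sup>2"
  unfolding power_mult_distrib cmod_power2 by (simp add: inner_complex_def) algebra

text \<open>\<open>arccos\<close> takes values with nonnegative sine, hence the absolute value of
  the cross product.\<close>

lemma cot_vector_angle: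
  assumes "Im (w * cnj h) \<noteq> 0"
  shows "cot (vector_angle w h) = (w \<bullet> h) / \<bar>Im (w * cnj h)\<bar>"
proof -
  define n where "n = norm w * norm h"
  define x where "x = w \<bullet> h / n"
  define y where "y = \<bar>Im (w * cnj h)\<bar> / n"
  have "w \<noteq> 0" "h \<noteq> 0" using assms by auto
  then have n: "n > 0" by (simp add: n_def)
  have "(w \<bullet> h)\<^sup>2 / n\<^sup>2 + (Im (w * cnj h))\<^sup>2 / n\<^sup>2 = 1"
    using inner_sq_add_cross_sq[of w h] n by (simp add: n_def[symmetric] add_divide_distrib[symmetric])
  then have xy: "x\<^sup>2 + y\<^sup>2 = 1" by (simp add: x_def y_def power_divide)
  then have "x\<^sup>2 \<le> 1" using zero_le_power2[of y] by linarith
  then have x1: "- 1 \<le> x" "x \<le> 1" by (simp_all add: abs_square_le_1 abs_le_iff)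
  have y0: "y \<ge> 0" using n by (simp add: y_def)
  have "sin (arccos x) = sqrt (1 - x\<^sup>2)" using x1 by (rule sin_arccos)
  also have "1 - x\<^sup>2 = y\<^sup>2" using xy by simp
  finally have "sin (arccos x) = y" using y0 by simp
  then have "cot (arccos x) = x / y" using x1 by (simp add: cot_def)
  then show ?thesis
    unfolding vector_angle_def n_def[symmetric] using n by (simp add: x_def y_def)
qed

lemma cross_semicircle_line_deriv:
  assumes "u < v" and z: "semicircle_line u v t = z"
  defines "h \<equiv> vector_derivative (semicircle_line u v) (at t)" and "a \<equiv> (u + v) / 2"
  shows "w \<bullet> h = Im z / ((v - u) / 2) * (Re w * Im z - Im w * (Re z - a))"
    and "Im (w * cnj h) = Im z / ((v - u) / 2) * (Im w * Im z + Re w * (Re z - a))"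
proof -
  define r where "r = (v - u) / 2"
  have r: "r > 0" using assms by (simp add: r_def)
  have y: "Im z = r / cosh t" "Re z - a = r * tanh t"
    unfolding z[symmetric] semicircle_line_def r_def a_def by simp_all
  have C: "cosh t > 0" by (rule cosh_real_pos)
  \<comment> \<open>The radius z - a, turned clockwise by a right angle and scaled to hyperbolic
    length 1.\<close>
  have h: "h = Complex (Im z / r * Im z) (- (Im z / r * (Re z - a)))"
    unfolding h_def vector_derivative_at[OF has_vector_derivative_semicircle_line] y r_def[symmetric]
    using r C by (simp add: tanh_def power2_eq_square)
  show "w \<bullet> h = Im z / ((v - u) / 2) * (Re w * Im z - Im w * (Re z - a))"
    "Im (w * cnj h) = Im z / ((v - u) / 2) * (Im w * Im z + Re w * (Re z - a))"
    unfolding h r_def[symmetric] by (simp_all add: inner_complex_def algebra_simps add_divide_distrib diff_divide_distrib)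
qed

section \<open>Chords in terms of pairs of boundary parameters\<close>

context smooth_domain
begin

text \<open>The half-open intervals give every boundary point exactly one parameter. The order of
  the real parts is the direction of \<open>semicircle_line\<close>, so the first entry belongs to
  the start of the chord.\<close>

definition chord_pairs :: "(real \<times> real) set" where
  "chord_pairs = {p \<in> {0..<1} \<times> {0..<1}. Re (c (fst p)) < Re (c (snd p))}"

definition ends :: "real \<times> real \<Rightarrow> real \<times> real" where
  "ends p = ideal_ends (c (fst p)) (c (snd p))"

text \<open>The line has unit speed, so the length is the difference of the times at which it passes
  the two points; the addition formula for cosh turns this into the distance formula.\<close>

lemma chord:
  assumes p: "(s, t) \<in> chord_pairs" and uv: "ends (s, t) = (u, v)"
  defines "g \<equiv> semicircle_line u v"
  defines "a \<equiv> semicircle_time u v (c s)" and "b \<equiv> semicircle_time u v (c t)"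
  shows "u < v" "g a = c s" "g b = c t" "a < b" "{x. g x \<in> D} = {a..b}" "b - a = hdist (c s) (c t)"
proof -
  have less: "Re (c s) < Re (c t)" using p by (simp add: chord_pairs_def)
  have uv': "ideal_ends (c s) (c t) = (u, v)" using uv by (simp add: ends_def)
  show lt: "u < v" using ideal_ends_less[OF c_pos, of s "c t"] uv' by simp
  note circ = ideal_ends_circle[OF less uv']
  note ls = semicircle_line_time[OF lt c_pos circ(1)] and lt' = semicircle_line_time[OF lt c_pos circ(2)]
  show ga: "g a = c s" and gb: "g b = c t"
    unfolding g_def a_def b_def by (rule ls(1), rule lt'(1))
  show ab: "a < b"
    using strict_mono_Re_semicircle_line[OF lt, of a b] less ga gb by (simp add: g_def)
  have g: "g \<in> geodesic_params" unfolding g_def by (rule semicircle_line_in_params[OF lt])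
  have gab: "g a \<in> D" "g b \<in> D" using ga gb c_in_D by auto
  show "{x. g x \<in> D} = {a..b}"
  proof (intro set_eqI iffI)
    fix x assume "x \<in> {a..b}"
    then show "x \<in> {x. g x \<in> D}" using geodesic_segment_in_D[OF g gab] by auto
  next
    fix x assume "x \<in> {x. g x \<in> D}"
    then have x: "g x \<in> D" by simp
    \<comment> \<open>A point of D at a time before \<open>a\<close> would put \<open>c s\<close>
      strictly between two points of D, hence into the interior.\<close>
    have "\<not> x < a" using no_three_collinear[OF g _ ab x gab(2), of s] ga by auto
    moreover have "\<not> b < x" using no_three_collinear[OF g ab _ gab(1) x, of t] gb by auto
    ultimately show "x \<in> {a..b}" by simp
  qed
  have "cosh (b - a) = cosh_hdist (c s) (c t)"
  proof -
    define m where "m = (u + v) / 2"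
    define r where "r = (v - u) / 2"
    define x1 where "x1 = Re (c s)"
    define y1 where "y1 = Im (c s)"
    define x2 where "x2 = Re (c t)"
    define y2 where "y2 = Im (c t)"
    have pos: "y1 > 0" "y2 > 0" using c_pos by (simp_all add: y1_def y2_def)
    have c1: "(x1 - m)\<^sup>2 + y1\<^sup>2 = r\<^sup>2" and c2: "(x2 - m)\<^sup>2 + y2\<^sup>2 = r\<^sup>2"
      using circ by (simp_all add: m_def r_def x1_def x2_def y1_def y2_def)
    have "cosh (b - a) = (r / y2) * (r / y1) - ((x2 - m) / y2) * ((x1 - m) / y1)"
      unfolding cosh_diff a_def b_def ls lt' m_def r_def x1_def x2_def y1_def y2_def ..
    also have "\<dots> = (2 * r\<^sup>2 - 2 * (x2 - m) * (x1 - m)) / (2 * y1 * y2)"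
      using pos by (simp add: divide_simps power2_eq_square)
    also have "2 * r\<^sup>2 - 2 * (x2 - m) * (x1 - m) = (x1 - x2)\<^sup>2 + y1\<^sup>2 + y2\<^sup>2"
      using c1 c2 by algebra
    finally show ?thesis
      unfolding cosh_hdist_def x1_def x2_def y1_def y2_def .
  qed
  then have "cosh (b - a) = cosh (hdist (c s) (c t))"
    by (simp add: cosh_of_hdist c_pos)
  then show "b - a = hdist (c s) (c t)"
    using ab hdist_nonneg[OF c_pos c_pos, of s t] by (metis arcosh_cosh_real diff_ge_0_iff_ge less_imp_le)
qed

text \<open>The case a = b is included for geodesics that touch D in a single point.\<close>

lemma chord_parameters:
  assumes g: "g \<in> geodesic_params" and I: "{x. g x \<in> D} = {a..b}" and ab: "a \<le> b"
  shows "chord_start D (range g) = a" "chord_end D (range g) = b" "chord_length D (range g) = b - a"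
    "range g \<in> geodesics_meeting D"
proof -
  have "{x. param_of (range g) x \<in> range g \<inter> D} = {a..b}"
    unfolding param_of_range[OF g] I[symmetric] by auto
  then show s: "chord_start D (range g) = a" and e: "chord_end D (range g) = b"
    using ab by (simp_all add: chord_start_def chord_end_def)
  have "hyp_length g a b = integral {a..b} (\<lambda>x. 1)"
    unfolding hyp_length_def by (rule integral_cong) (simp add: hyp_speed_geodesic[OF g])
  then show "chord_length D (range g) = b - a"
    unfolding chord_length_def s e param_of_range[OF g] using ab by simp
  have "g a \<in> D" using I ab by auto
  then show "range g \<in> geodesics_meeting D"
    using g by (auto simp: geodesics_meeting_def geodesics_def)
qed

lemma chord_length_ends:
  assumes p: "(s, t) \<in> chord_pairs" and uv: "ends (s, t) = (u, v)"
  shows "chord_length D (range (semicircle_line u v)) = hdist (c s) (c t)"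
    and "range (semicircle_line u v) \<in> geodesics_meeting D"
  using chord_parameters[OF semicircle_line_in_params[OF chord(1)[OF p uv]] chord(5)[OF p uv]]
    chord(4)[OF p uv] chord(6)[OF p uv] by simp_all

section \<open>Angles between chord and boundary\<close>

lemma inv_into_c: "s \<in> {0..<1} \<Longrightarrow> inv_into {0..<1} c (c s) = s"
  by (rule inv_into_f_f) (auto simp: inj_on_def c_eq_iff_unit)

text \<open>For the left-pointing tangent the cross product is positive, so the absolute value in
  \<open>cot_vector_angle\<close> disappears and the quotient does not depend on the orientation of
  \<open>c\<close>. Reversing the chord but keeping the side only changes the sign of the inner
  product.\<close>

lemma cot_left_tangent:
  assumes s: "s \<in> {0..<1}" and g: "g x = c s"
    and ne: "Im (c' s * cnj (vector_derivative g (at x))) \<noteq> 0"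
  defines "q \<equiv> (c' s \<bullet> vector_derivative g (at x)) / Im (c' s * cnj (vector_derivative g (at x)))"
  shows "cot (vector_angle (left_tangent c g x) (vector_derivative g (at x))) = q"
    and "cot (vector_angle (left_tangent c g x) (- vector_derivative g (at x))) = - q"
proof -
  let ?h = "vector_derivative g (at x)"
  define X where "X = c' s \<bullet> ?h"
  define Y where "Y = Im (c' s * cnj ?h)"
  have l: "left_tangent c g x = (if 0 < Y then c' s else - c' s)"
    unfolding left_tangent_def g inv_into_c[OF s] Let_def c'_def Y_def ..
  have Y: "Y \<noteq> 0" using ne by (simp only: Y_def not_False_eq_True)
  have im: "Im (- c' s * cnj ?h) = - Y" "Im (c' s * cnj (- ?h)) = - Y" "Im (- c' s * cnj (- ?h)) = Y"
    unfolding Y_def by simp_all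
  have "X / \<bar>Y\<bar> = X / Y" if "0 < Y" using that by simp
  moreover have "- X / \<bar>- Y\<bar> = X / Y" if "\<not> 0 < Y" using that Y by simp
  ultimately have "cot (vector_angle (left_tangent c g x) ?h) = X / Y"
    "cot (vector_angle (left_tangent c g x) (- ?h)) = - (X / Y)"
    unfolding l using Y cot_vector_angle[of "c' s" ?h] cot_vector_angle[of "- c' s" ?h]
      cot_vector_angle[of "c' s" "- ?h"] cot_vector_angle[of "- c' s" "- ?h"]
    unfolding im inner_minus_left inner_minus_right Y_def[symmetric] X_def[symmetric] by auto
  then show "cot (vector_angle (left_tangent c g x) ?h) = q"
    and "cot (vector_angle (left_tangent c g x) (- ?h)) = - q"
    unfolding q_def X_def Y_def by simp_all
qed

lemma chord_pairs_not_int: "(s, t) \<in> chord_pairs \<Longrightarrow> s - t \<notin> \<int>"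
  using c_eq_iff[of s t] by (auto simp: chord_pairs_def)

lemma cot_chord_angles:
  assumes p: "(s, t) \<in> chord_pairs" and uv: "ends (s, t) = (u, v)"
  shows "cot (chord_angle_start D c (range (semicircle_line u v)))
      = hdist_rad (c s) (c' s) (c t) / hdist_tra (c s) (c' s) (c t)"
    and "cot (chord_angle_end D c (range (semicircle_line u v)))
      = - (hdist_rad (c t) (c' t) (c s) / hdist_tra (c t) (c' t) (c s))"
proof -
  let ?g = "semicircle_line u v" and ?a = "semicircle_time u v (c s)" and ?b = "semicircle_time u v (c t)"
  note ch = chord[OF p uv]
  note params = chord_parameters[OF semicircle_line_in_params[OF ch(1)] ch(5) less_imp_le[OF ch(4)]]
  have less: "Re (c s) < Re (c t)" and st: "s \<in> {0..<1}" "t \<in> {0..<1}" using p by (auto simp: chord_pairs_def)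
  define A where "A = Re (c s) - Re (c t)"
  have A: "A < 0" using less by (simp add: A_def)
  define m where "m = (u + v) / 2"
  have m: "m = geod_centre (c s) (c t)" using uv by (auto simp: ends_def ideal_ends_def m_def)
  \<comment> \<open>Inner and cross products are \<open>hdist_rad\<close> and
    \<open>hdist_tra\<close> times the common factors \<open>k1\<close> and \<open>k2\<close>. These
    cancel in the cotangents, so only their nonvanishing matters.\<close>
  define k1 where "k1 = Im (c s) / ((v - u) / 2) / (2 * A)"
  define k2 where "k2 = - (Im (c t) / ((v - u) / 2) / (2 * A))"
  have k: "k1 \<noteq> 0" "k2 \<noteq> 0" using c_pos[of s] c_pos[of t] A ch(1) by (simp_all add: k1_def k2_def)
  have int: "s - t \<notin> \<int>" "t - s \<notin> \<int>"
    using chord_pairs_not_int[OF p] by (auto dest: Ints_minus)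
  note E1 = hdist_tra_nonzero[OF int(1)] and E2 = hdist_tra_nonzero[OF int(2)]
  have e1: "Re (c s) - m = ((Re (c s) - Re (c t))\<^sup>2 + (Im (c t))\<^sup>2 - (Im (c s))\<^sup>2) / (2 * A)"
    and e2: "Re (c t) - m = - ((Re (c s) - Re (c t))\<^sup>2 + (Im (c s))\<^sup>2 - (Im (c t))\<^sup>2) / (2 * A)"
    unfolding m A_def using geod_centre_eqs[OF less] by simp_all
  have s1: "c' s \<bullet> vector_derivative ?g (at ?a) = k1 * hdist_rad (c s) (c' s) (c t)"
    and s2: "Im (c' s * cnj (vector_derivative ?g (at ?a))) = k1 * hdist_tra (c s) (c' s) (c t)"
    unfolding cross_semicircle_line_deriv[OF ch(1,2)] m_def[symmetric] e1 k1_def hdist_rad_def hdist_tra_def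
      A_def[symmetric]
    using A by (simp_all add: divide_simps)
  have t1: "c' t \<bullet> vector_derivative ?g (at ?b) = k2 * hdist_rad (c t) (c' t) (c s)"
    and t2: "Im (c' t * cnj (vector_derivative ?g (at ?b))) = k2 * hdist_tra (c t) (c' t) (c s)"
    unfolding cross_semicircle_line_deriv[OF ch(1,3)] m_def[symmetric] e2 k2_def hdist_rad_def hdist_tra_def
      minus_diff_eq[of "Re (c s)", symmetric] A_def[symmetric]
    using A by (simp_all add: divide_simps) (simp_all add: algebra_simps)
  have ns: "Im (c' s * cnj (vector_derivative ?g (at ?a))) \<noteq> 0"
    and nt: "Im (c' t * cnj (vector_derivative ?g (at ?b))) \<noteq> 0"
    unfolding s2 t2 using k E1 E2 by simp_all
  show "cot (chord_angle_start D c (range ?g)) = hdist_rad (c s) (c' s) (c t) / hdist_tra (c s) (c' s) (c t)"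
    unfolding chord_angle_start_def params param_of_range[OF semicircle_line_in_params[OF ch(1)]]
      cot_left_tangent(1)[where g = ?g, OF st(1) ch(2) ns] s1 s2 using k by simp
  show "cot (chord_angle_end D c (range ?g)) = - (hdist_rad (c t) (c' t) (c s) / hdist_tra (c t) (c' t) (c s))"
    unfolding chord_angle_end_def params param_of_range[OF semicircle_line_in_params[OF ch(1)]]
      cot_left_tangent(2)[where g = ?g, OF st(2) ch(3) nt] t1 t2 using k by simp
qed

text \<open>The across components in the denominators of the cotangents are the factors of
  \<open>hdist_dd\<close>. What remains after cancelling are the along components, that is, the
  first derivatives. The minus sign comes from the end of the chord, where the inward direction is
  opposite to that of the line.\<close>

lemma pleijel_integrand_ends:
  assumes p: "(s, t) \<in> chord_pairs" and uv: "ends (s, t) = (u, v)"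
  defines "\<gamma> \<equiv> range (semicircle_line u v)"
  shows "sinh (chord_length D \<gamma>) * cot (chord_angle_start D c \<gamma>) * cot (chord_angle_end D c \<gamma>)
      * hdist_dd (c s) (c' s) (c t) (c' t) = - hdist_d (c s) (c' s) (c t) * hdist_d (c t) (c' t) (c s)"
proof -
  have int: "s - t \<notin> \<int>" "t - s \<notin> \<int>"
    using chord_pairs_not_int[OF p] by (auto dest: Ints_minus)
  define E1 where "E1 = hdist_tra (c s) (c' s) (c t)"
  define E2 where "E2 = hdist_tra (c t) (c' t) (c s)"
  define R where "R = hdist_root (c s) (c t)"
  have ne: "E1 \<noteq> 0" "E2 \<noteq> 0"
    unfolding E1_def E2_def using hdist_tra_nonzero int by auto
  have R: "R > 0" unfolding R_def using int c_eq_iff c_pos by (intro hdist_root_pos) auto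
  have R': "hdist_root (c t) (c s) = R" unfolding R_def by (rule hdist_root_commute)
  have pos: "Im (c s) \<noteq> 0" "Im (c t) \<noteq> 0" using c_pos[of s] c_pos[of t] by auto
  show ?thesis
    unfolding \<gamma>_def chord_length_ends(1)[OF p uv] cot_chord_angles[OF p uv] sinh_of_hdist[OF c_pos c_pos]
      hdist_dd_def hdist_d_def R' R_def[symmetric] E1_def[symmetric] E2_def[symmetric]
    using ne R pos by (simp add: divide_simps power3_eq_cube)
qed

section \<open>Correspondence between geodesics and pairs\<close>

lemma inj_on_ends: "inj_on ends chord_pairs"
proof (rule inj_onI)
  fix p p' assume p: "p \<in> chord_pairs" and p': "p' \<in> chord_pairs" and eq: "ends p = ends p'"
  obtain s t where st: "p = (s, t)" by fastforce
  obtain s' t' where st': "p' = (s', t')" by fastforce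
  obtain u v where uv: "ends p = (u, v)" by fastforce
  note ch = chord[OF p[unfolded st] uv[unfolded st]]
  note ch' = chord[OF p'[unfolded st'] uv[unfolded eq st']]
  have "{semicircle_time u v (c s)..semicircle_time u v (c t)} = {semicircle_time u v (c s')..semicircle_time u v (c t')}"
    using ch(5)[symmetric] ch'(5) by (rule trans)
  then have "semicircle_time u v (c s) = semicircle_time u v (c s')" "semicircle_time u v (c t) = semicircle_time u v (c t')"
    using ch(4) ch'(4) by (auto simp: Icc_eq_Icc)
  then have "c s = c s'" "c t = c t'" using ch(2,3) ch'(2,3) by metis+
  then show "p = p'"
    using p p' c_eq_iff_unit unfolding st st' chord_pairs_def by auto
qed

lemma geodesic_interior:
  assumes g: "g \<in> geodesic_params" and x: "g x \<in> interior D"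
  obtains e where "e > 0" "g (x - e) \<in> D" "g (x + e) \<in> D"
proof -
  have "open (g -` interior D)"
    by (intro open_vimage continuous_on_geodesic[OF g]) auto
  with x obtain e where e: "e > 0" "ball x e \<subseteq> g -` interior D"
    unfolding open_contains_ball by (meson vimageI2)
  then have "g (x - e / 2) \<in> D" "g (x + e / 2) \<in> D"
    using interior_subset[of D] by (auto simp: dist_real_def subset_iff)
  then show thesis using that[of "e / 2"] e(1) by simp
qed

text \<open>The times spent in D form a compact nonempty set. If its minimum and maximum differ,
  they belong to boundary points, since from an interior point the line could be continued inside D
  in both directions.\<close>

lemma geodesic_meeting_cases:
  assumes uv: "u < v" and meets: "range (semicircle_line u v) \<in> geodesics_meeting D"
  obtains (chord) s t where "(s, t) \<in> chord_pairs" "ends (s, t) = (u, v)"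
  | (tangent) z where "{x. semicircle_line u v x \<in> D} = {z}"
proof -
  let ?g = "semicircle_line u v"
  define I where "I = {x. ?g x \<in> D}"
  have g: "?g \<in> geodesic_params" by (rule semicircle_line_in_params[OF uv])
  have "I = semicircle_time u v ` (D \<inter> range ?g)"
  proof (intro set_eqI iffI)
    fix x assume "x \<in> I"
    then show "x \<in> semicircle_time u v ` (D \<inter> range ?g)"
      by (intro image_eqI[of _ _ "?g x"]) (auto simp: I_def semicircle_time_line[OF uv])
  qed (auto simp: I_def semicircle_time_line[OF uv])
  moreover have "compact (D \<inter> range ?g)"
  proof -
    \<comment> \<open>The semicircle is not closed, but D lies in the open half plane, so the full
      circle can take its place.\<close>
    have "D \<inter> range ?g = D \<inter> {z. dist z (of_real ((u + v) / 2)) = (v - u) / 2}"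
      unfolding range_semicircle_line[OF uv] using D_pos by auto
    moreover have "closed {z :: complex. dist z (of_real ((u + v) / 2)) = (v - u) / 2}"
      by (intro closed_Collect_eq continuous_intros)
    ultimately show ?thesis using compact_D by (simp add: compact_Int_closed)
  qed
  moreover have "continuous_on (D \<inter> range ?g) (semicircle_time u v)"
    unfolding semicircle_time_def by (intro continuous_on_compose2[OF continuous_on_arsinh[of UNIV]] continuous_intros)
      (use D_pos in force)+
  ultimately have I: "compact I" by (metis compact_continuous_image)
  have ne: "I \<noteq> {}" using meets by (auto simp: I_def geodesics_meeting_def)
  obtain a where a: "a \<in> I" "\<And>x. x \<in> I \<Longrightarrow> a \<le> x" using compact_attains_inf[OF I ne] by blast
  obtain b where b: "b \<in> I" "\<And>x. x \<in> I \<Longrightarrow> x \<le> b" using compact_attains_sup[OF I ne] by blast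
  show thesis
  proof (cases "a = b")
    case True
    then have "I = {a}" using a b by force
    then show thesis using tangent[of a] by (simp add: I_def)
  next
    case False
    then have ab: "a < b" using a b by force
    have fr: "?g x \<in> frontier D" if x: "x \<in> I" "x = a \<or> x = b" for x
    proof -
      have "?g x \<notin> interior D"
      proof
        assume "?g x \<in> interior D"
        then obtain e where e: "e > 0" "?g (x - e) \<in> D" "?g (x + e) \<in> D"
          by (rule geodesic_interior[OF g])
        then show False using a(2)[of "x - e"] b(2)[of "x + e"] x(2) by (auto simp: I_def)
      qed
      then show ?thesis using x(1) by (simp add: frontier_D I_def)
    qed
    obtain s where s: "s \<in> {0..<1}" "c s = ?g a" using frontier_obtain[OF fr[of a]] a by blast
    obtain t where t: "t \<in> {0..<1}" "c t = ?g b" using frontier_obtain[OF fr[of b]] b by blast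
    have less: "Re (c s) < Re (c t)"
      unfolding s(2) t(2) strict_mono_Re_semicircle_line[OF uv] by (rule ab)
    have "ideal_ends (c s) (c t) = (u, v)"
      by (rule ideal_ends_unique[OF less uv]) (simp_all only: s(2) t(2) semicircle_circle_eq)
    then show thesis
      using chord[of s t] less s(1) t(1) by (simp add: chord_pairs_def ends_def)
  qed
qed

end


section \<open>Integrals over geodesics as integrals over pairs of boundary points\<close>

text \<open>A set of geodesics is measurable only if the set of their endpoints is Borel, so that Lebesgue
  measurability of the inverse of \<open>e\<close> would not suffice.\<close>

lemma
  fixes e :: "'a::t2_space \<Rightarrow> 'b::t2_space" and \<phi> :: "'a \<Rightarrow> real"
  assumes S: "S = (\<Union>n::nat. C n)" and C: "\<And>n. compact (C n)" and e: "continuous_on S e"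
    and inj: "inj_on e S" and \<phi>: "continuous_on S \<phi>"
  shows sets_borel_image_sigma_compact: "e ` S \<in> sets borel"
    and borel_measurable_inverse_sigma_compact:
      "(\<lambda>q. if q \<in> e ` S then \<phi> (the_inv_into S e q) else 0) \<in> borel_measurable borel"
proof -
  have img: "e ` {x \<in> S. \<phi> x \<le> a} \<in> sets borel" for a
  proof -
    have "e ` {x \<in> S. \<phi> x \<le> a} = (\<Union>n. e ` (C n \<inter> {x \<in> C n. \<phi> x \<le> a}))"
      unfolding S by auto
    moreover have "compact (e ` (C n \<inter> {x \<in> C n. \<phi> x \<le> a}))" for n
    proof (rule compact_continuous_image)
      have "continuous_on (C n) \<phi>" by (rule continuous_on_subset[OF \<phi>]) (use S in auto)
      then have "closed (C n \<inter> \<phi> -` {..a})"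
        by (rule continuous_closed_preimage[OF _ compact_imp_closed[OF C] closed_atMost])
      also have "C n \<inter> \<phi> -` {..a} = {x \<in> C n. \<phi> x \<le> a}" by auto
      finally show "compact (C n \<inter> {x \<in> C n. \<phi> x \<le> a})" by (rule compact_Int_closed[OF C])
      show "continuous_on (C n \<inter> {x \<in> C n. \<phi> x \<le> a}) e"
        by (rule continuous_on_subset[OF e]) (use S in auto)
    qed
    then have "e ` (C n \<inter> {x \<in> C n. \<phi> x \<le> a}) \<in> sets borel" for n
      by (intro borel_closed compact_imp_closed)
    ultimately show ?thesis by (simp add: sets.countable_UN)
  qed
  have "e ` S = (\<Union>n. e ` C n)" unfolding S by auto
  moreover have "compact (e ` C n)" for n
    by (rule compact_continuous_image[OF continuous_on_subset[OF e] C]) (use S in auto)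
  then have "e ` C n \<in> sets borel" for n
    by (intro borel_closed compact_imp_closed)
  ultimately show eS: "e ` S \<in> sets borel" by (simp add: sets.countable_UN)
  show "(\<lambda>q. if q \<in> e ` S then \<phi> (the_inv_into S e q) else 0) \<in> borel_measurable borel"
  proof (rule borel_measurableI_le)
    fix a :: real
    have val: "(if e x \<in> e ` S then \<phi> (the_inv_into S e (e x)) else 0) = \<phi> x" if "x \<in> S" for x
      using that by (simp add: the_inv_into_f_f[OF inj])
    \<comment> \<open>Outside the image the function has the value 0, so for 0 <= a the whole
      complement joins the sublevel set.\<close>
    have "{q \<in> space borel. (if q \<in> e ` S then \<phi> (the_inv_into S e q) else 0) \<le> a}
        = e ` {x \<in> S. \<phi> x \<le> a} \<union> (if 0 \<le> a then - e ` S else {})"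
    proof (intro set_eqI)
      fix q
      show "q \<in> {q \<in> space borel. (if q \<in> e ` S then \<phi> (the_inv_into S e q) else 0) \<le> a} \<longleftrightarrow>
          q \<in> e ` {x \<in> S. \<phi> x \<le> a} \<union> (if 0 \<le> a then - e ` S else {})"
      proof (cases "q \<in> e ` S")
        case True
        then obtain x where x: "x \<in> S" "q = e x" by auto
        have "e x \<in> e ` {x \<in> S. \<phi> x \<le> a} \<longleftrightarrow> \<phi> x \<le> a"
          using inj_onD[OF inj] x(1) by blast
        then show ?thesis unfolding x(2) using val[OF x(1)] x(1) by auto
      qed auto
    qed
    then show "{q \<in> space borel. (if q \<in> e ` S then \<phi> (the_inv_into S e q) else 0) \<le> a} \<in> sets borel"
      using img[of a] eS by auto
  qed
qed

section \<open>Continuity and measurability in boundary coordinates\<close>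

context smooth_domain
begin

lemma continuous_on_c_fst: "continuous_on S (\<lambda>p. c (fst p))"
  and continuous_on_c_snd: "continuous_on S (\<lambda>p. c (snd p))"
  and continuous_on_c'_fst: "continuous_on S (\<lambda>p. c' (fst p))"
  and continuous_on_c'_snd: "continuous_on S (\<lambda>p. c' (snd p))"
  by (auto intro!: continuous_on_compose2[OF continuous_c[of UNIV]]
      continuous_on_compose2[OF continuous_c'[of UNIV]] continuous_intros)

lemmas continuous_on_boundary = continuous_on_c_fst continuous_on_c_snd continuous_on_c'_fst continuous_on_c'_snd

lemma continuous_on_hdist_c: "continuous_on S (\<lambda>p. hdist (c (fst p)) (c (snd p)))"
  by (intro continuous_on_hdist continuous_on_boundary c_pos)

lemma continuous_on_hdist_root: "continuous_on S (\<lambda>p. hdist_root (c (fst p)) (c (snd p)))"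
  unfolding hdist_root_def by (intro continuous_intros continuous_on_boundary)

lemma continuous_on_hdist_root': "continuous_on S (\<lambda>p. hdist_root (c (snd p)) (c (fst p)))"
  unfolding hdist_root_def by (intro continuous_intros continuous_on_boundary)

lemma hdist_root_c_pos: "c s \<noteq> c t \<Longrightarrow> 0 < hdist_root (c s) (c t)"
  by (rule hdist_root_pos[OF c_pos c_pos])

lemma continuous_on_hdist_dd:
  assumes "\<And>p. p \<in> S \<Longrightarrow> c (fst p) \<noteq> c (snd p)"
  shows "continuous_on S (\<lambda>p. hdist_dd (c (fst p)) (c' (fst p)) (c (snd p)) (c' (snd p)))"
  unfolding hdist_dd_def hdist_tra_def
  by (intro continuous_intros continuous_on_boundary continuous_on_hdist_root)
    (use assms hdist_root_c_pos in force)

lemma continuous_on_hdist_d: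
  assumes "\<And>p. p \<in> S \<Longrightarrow> c (fst p) \<noteq> c (snd p)"
  shows "continuous_on S (\<lambda>p. hdist_d (c (fst p)) (c' (fst p)) (c (snd p)))"
    and "continuous_on S (\<lambda>p. hdist_d (c (snd p)) (c' (snd p)) (c (fst p)))"
proof -
  have 1: "Im (c (fst p)) * hdist_root (c (fst p)) (c (snd p)) \<noteq> 0"
    and 2: "Im (c (snd p)) * hdist_root (c (snd p)) (c (fst p)) \<noteq> 0" if "p \<in> S" for p
    using assms[OF that] hdist_root_c_pos[of "fst p" "snd p"] hdist_root_c_pos[of "snd p" "fst p"]
      c_pos[of "fst p"] c_pos[of "snd p"] by auto
  show "continuous_on S (\<lambda>p. hdist_d (c (fst p)) (c' (fst p)) (c (snd p)))"
    unfolding hdist_d_def hdist_rad_def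
    by (intro continuous_intros continuous_on_boundary continuous_on_hdist_root) (use 1 in blast)
  show "continuous_on S (\<lambda>p. hdist_d (c (snd p)) (c' (snd p)) (c (fst p)))"
    unfolding hdist_d_def hdist_rad_def
    by (intro continuous_intros continuous_on_boundary continuous_on_hdist_root') (use 2 in blast)
qed

lemma continuous_on_ends: "continuous_on chord_pairs ends"
  unfolding ends_def[abs_def] ideal_ends_def geod_radius_def geod_centre_def
  by (intro continuous_intros continuous_on_boundary) (auto simp: chord_pairs_def)

text \<open>The strict conditions s < 1, t < 1 and Re (c s) < Re (c t) are exhausted by closed ones
  with margin 1 / (n + 1).\<close>

lemma chord_pairs_sigma_compact:
  obtains C :: "nat \<Rightarrow> (real \<times> real) set" where "chord_pairs = (\<Union>n. C n)" "\<And>n. compact (C n)"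
proof -
  define C where "C = (\<lambda>n::nat. ({0..1 - inverse (real (Suc n))} \<times> {0..1 - inverse (real (Suc n))})
      \<inter> {p. inverse (real (Suc n)) \<le> Re (c (snd p)) - Re (c (fst p))})"
  have "compact (C n)" for n
    unfolding C_def
    by (intro compact_Int_closed compact_Times compact_Icc closed_Collect_le continuous_intros continuous_on_boundary)
  moreover have "chord_pairs = (\<Union>n. C n)"
  proof (intro set_eqI iffI)
    fix p assume p: "p \<in> chord_pairs"
    obtain s t where st: "p = (s, t)" by fastforce
    define m where "m = min (1 - s) (min (1 - t) (Re (c t) - Re (c s)))"
    have "m > 0" using p by (auto simp: st chord_pairs_def m_def)
    then obtain n where "inverse (real (Suc n)) < m" using reals_Archimedean by blast
    then have "p \<in> C n" using p by (auto simp: C_def st chord_pairs_def m_def)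
    then show "p \<in> (\<Union>n. C n)" by blast
  next
    fix p assume "p \<in> (\<Union>n. C n)"
    then obtain n where p: "p \<in> C n" by blast
    have "inverse (1 + real n) > 0" by simp
    then show "p \<in> chord_pairs" using p unfolding C_def chord_pairs_def
      by (auto simp: mem_Times_iff simp del: inverse_positive_iff_positive)
  qed
  ultimately show thesis using that by blast
qed

lemma sets_chord_pairs: "chord_pairs \<in> sets borel"
proof -
  obtain C where C: "chord_pairs = (\<Union>n::nat. C n)" "\<And>n. compact (C n)"
    using chord_pairs_sigma_compact by blast
  have "C n \<in> sets borel" for n by (intro borel_closed compact_imp_closed C(2))
  then show ?thesis unfolding C(1) by (intro sets.countable_UN) auto
qed

definition meeting_ends :: "(real \<times> real) set" where
  "meeting_ends = {(u, v). u < v \<and> range (semicircle_line u v) \<in> geodesics_meeting D}"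

text \<open>Zero exactly on the geodesic with ideal endpoints \<open>u\<close> and \<open>v\<close>; the sign tells its two sides apart.\<close>

definition circle_fun :: "real \<Rightarrow> real \<Rightarrow> complex \<Rightarrow> real" where
  "circle_fun u v z = (Re z)\<^sup>2 + (Im z)\<^sup>2 - (u + v) * Re z + u * v"

lemma mem_semicircle_iff:
  assumes "u < v" "0 < Im z"
  shows "z \<in> range (semicircle_line u v) \<longleftrightarrow> circle_fun u v z = 0"
proof -
  have eq: "(Re z - (u + v) / 2)\<^sup>2 + (Im z)\<^sup>2 = ((v - u) / 2)\<^sup>2 \<longleftrightarrow> circle_fun u v z = 0"
    by (simp add: circle_fun_def power2_eq_square field_simps) (auto simp: algebra_simps)
  show ?thesis
  proof
    assume "z \<in> range (semicircle_line u v)"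
    then show "circle_fun u v z = 0" using semicircle_circle_eq[of u v] eq by auto
  next
    assume "circle_fun u v z = 0"
    then have "semicircle_line u v (semicircle_time u v z) = z"
      using semicircle_line_time(1)[OF assms] eq by simp
    then show "z \<in> range (semicircle_line u v)" by (metis rangeI)
  qed
qed

lemma meeting_iff:
  assumes "u < v"
  shows "range (semicircle_line u v) \<in> geodesics_meeting D \<longleftrightarrow> (\<exists>z\<in>D. circle_fun u v z = 0)"
proof -
  have "range (semicircle_line u v) \<in> geodesics"
    using semicircle_line_in_params[OF assms] by (auto simp: geodesics_def)
  then show ?thesis
    unfolding geodesics_meeting_def using mem_semicircle_iff[OF assms] D_pos by blast
qed

text \<open>Meeting D is a closed condition on the endpoints, apart from u < v: a closed set
  projected along the compact D stays closed.\<close>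

lemma sets_meeting_ends: "meeting_ends \<in> sets borel"
proof -
  let ?T = "{x :: complex \<times> (real \<times> real). circle_fun (fst (snd x)) (snd (snd x)) (fst x) = 0}"
  have "closed ?T"
    unfolding circle_fun_def by (intro closed_Collect_eq continuous_intros)
  then have "closed {q. \<exists>z. z \<in> D \<and> (z, q) \<in> ?T}"
    by (rule closed_compact_projection[OF compact_D])
  moreover have "meeting_ends = {(u, v). u < v} \<inter> {q. \<exists>z. z \<in> D \<and> (z, q) \<in> ?T}"
    unfolding meeting_ends_def using meeting_iff by auto
  ultimately show ?thesis using sets_lower_triangle by (simp add: sets.Int)
qed

lemma ends_chord_pairs_subset: "ends ` chord_pairs \<subseteq> meeting_ends"
proof
  fix q assume "q \<in> ends ` chord_pairs"
  then obtain s t where st: "(s, t) \<in> chord_pairs" "q = ends (s, t)" by auto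
  obtain u v where uv: "ends (s, t) = (u, v)" by fastforce
  show "q \<in> meeting_ends"
    unfolding meeting_ends_def st(2) uv
    using chord(1)[OF st(1) uv] chord_length_ends(2)[OF st(1) uv] by simp
qed

lemma tangent_ends:
  assumes "(u, v) \<in> meeting_ends - ends ` chord_pairs"
  obtains z where "u < v" "{x. semicircle_line u v x \<in> D} = {z}"
proof -
  have uv: "u < v" and m: "range (semicircle_line u v) \<in> geodesics_meeting D"
    using assms by (auto simp: meeting_ends_def)
  from uv m show thesis
  proof (cases rule: geodesic_meeting_cases)
    case (chord s t)
    then have "(u, v) \<in> ends ` chord_pairs" by (metis imageI)
    then show thesis using assms by simp
  next
    case (tangent z)
    then show thesis using that uv by blast
  qed
qed

text \<open>Of three geodesics with common endpoint \<open>v\<close> that meet \<open>D\<close>, the middle one separates the points where the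
  outer two meet \<open>D\<close>. So it meets the interior and is no tangent.\<close>

lemma tangent_finite: "finite {u. (u, v) \<in> meeting_ends - ends ` chord_pairs}"
proof (rule ccontr)
  assume "infinite {u. (u, v) \<in> meeting_ends - ends ` chord_pairs}"
  then obtain u0 u1 u2 where u: "(u0, v) \<in> meeting_ends - ends ` chord_pairs"
    "(u1, v) \<in> meeting_ends - ends ` chord_pairs" "(u2, v) \<in> meeting_ends - ends ` chord_pairs"
    and lt: "u0 < u1" "u1 < u2"
    by (rule infinite_obtain_three) auto
  obtain x1 where u1v: "u1 < v" and x1: "{x. semicircle_line u1 v x \<in> D} = {x1}"
    by (rule tangent_ends[OF u(2)])
  have pt: "\<exists>z\<in>D. circle_fun u v z = 0 \<and> Re z < v" if q: "(u, v) \<in> meeting_ends - ends ` chord_pairs" for u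
  proof -
    obtain x where uv: "u < v" and x: "{x. semicircle_line u v x \<in> D} = {x}"
      by (rule tangent_ends[OF q])
    have zD: "semicircle_line u v x \<in> D" using x by blast
    have "(v - u) * tanh x < (v - u) * 1"
      using uv tanh_real_lt_1[of x] by (intro mult_strict_left_mono) auto
    then have "Re (semicircle_line u v x) < v"
      by (simp add: semicircle_line_def field_simps)
    then show ?thesis
      using zD mem_semicircle_iff[OF uv D_pos[OF zD]] by auto
  qed
  obtain z0 where z0: "z0 \<in> D" "circle_fun u0 v z0 = 0" "Re z0 < v" using pt[OF u(1)] by blast
  obtain z2 where z2: "z2 \<in> D" "circle_fun u2 v z2 = 0" "Re z2 < v" using pt[OF u(3)] by blast
  \<comment> \<open>\<open>circle_fun u v z\<close> is affine in u with slope v - Re z, which is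
    positive at both points.\<close>
  have "circle_fun u1 v z0 = (u1 - u0) * (v - Re z0)" "circle_fun u1 v z2 = - ((u2 - u1) * (v - Re z2))"
    using z0(2) z2(2) by (simp_all add: circle_fun_def algebra_simps)
  then have sg: "circle_fun u1 v z0 > 0" "circle_fun u1 v z2 < 0"
    using lt z0(3) z2(3) by simp_all
  then have "z0 \<noteq> z2" by auto
  then obtain g a b where g: "g \<in> geodesic_params" "a < b" "{g a, g b} = {z0, z2}"
    using geodesic_through[OF D_pos[OF z0(1)] D_pos[OF z2(1)]] by metis
  have gab: "g a \<in> D" "g b \<in> D" using g(3) z0 z2 by (auto simp: doubleton_eq_iff)
  have cont: "continuous_on {a..b} (\<lambda>x. circle_fun u1 v (g x))"
    unfolding circle_fun_def by (intro continuous_intros continuous_on_geodesic[OF g(1)])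
  have "\<exists>m. a \<le> m \<and> m \<le> b \<and> circle_fun u1 v (g m) = 0"
  proof (cases "g a = z0")
    case True
    then have "g b = z2" using g(3) by (auto simp: doubleton_eq_iff)
    then show ?thesis
      using IVT2'[of "\<lambda>x. circle_fun u1 v (g x)" b 0 a] True sg g(2) cont by auto
  next
    case False
    then have "g a = z2" "g b = z0" using g(3) by (auto simp: doubleton_eq_iff)
    then show ?thesis
      using IVT'[of "\<lambda>x. circle_fun u1 v (g x)" a 0 b] sg g(2) cont by auto
  qed
  then obtain m where m: "a \<le> m" "m \<le> b" "circle_fun u1 v (g m) = 0" by blast
  have "m \<noteq> a" "m \<noteq> b" using m(3) sg g(3) by (auto simp: doubleton_eq_iff)
  then have int: "g m \<in> interior D"
    using strictly_convex[OF g(1) _ _ gab, of m] m by simp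
  have "g m \<in> range (semicircle_line u1 v)"
    using mem_semicircle_iff[OF u1v geodesic_pos[OF g(1)]] m(3) by simp
  then obtain y where y: "g m = semicircle_line u1 v y" by auto
  \<comment> \<open>Around an interior point the middle geodesic stays in D for a whole interval of
    times, whereas a tangent meets D at one time only.\<close>
  obtain e where "e > 0" "semicircle_line u1 v (y - e) \<in> D" "semicircle_line u1 v (y + e) \<in> D"
    using geodesic_interior[OF semicircle_line_in_params[OF u1v], of y] int y by auto
  then have "y - e = x1" "y + e = x1" using x1 by blast+
  then show False using \<open>e > 0\<close> by simp
qed

lemma sets_ends_chord_pairs: "ends ` chord_pairs \<in> sets borel"
proof -
  obtain C where C: "chord_pairs = (\<Union>n::nat. C n)" "\<And>n. compact (C n)"
    using chord_pairs_sigma_compact by blast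
  show ?thesis
    by (rule sets_borel_image_sigma_compact[OF C continuous_on_ends inj_on_ends, of "\<lambda>_. 0"]) simp
qed

text \<open>For each fixed v only finitely many u occur, so every section has measure 0 and Fubini
  applies.\<close>

lemma tangent_null: "AE q in lborel. q \<in> meeting_ends \<longrightarrow> q \<in> ends ` chord_pairs"
proof -
  let ?N = "meeting_ends - ends ` chord_pairs"
  have N: "?N \<in> sets borel" using sets_meeting_ends sets_ends_chord_pairs by (rule sets.Diff)
  have "emeasure (lborel :: (real \<times> real) measure) ?N = emeasure (lborel \<Otimes>\<^sub>M lborel) ?N"
    by (simp add: lborel_prod)
  also have "\<dots> = (\<integral>\<^sup>+ v. emeasure lborel ((\<lambda>u. (u, v)) -` ?N) \<partial>lborel)"
    using N by (intro lborel_pair.emeasure_pair_measure_alt2) (simp only: lborel_prod sets_lborel)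
  also have "\<dots> = (\<integral>\<^sup>+ (v::real). 0 \<partial>lborel)"
  proof (rule nn_integral_cong)
    fix v :: real
    have "(\<lambda>u. (u, v)) -` ?N = {u. (u, v) \<in> ?N}" by auto
    then show "emeasure lborel ((\<lambda>u. (u, v)) -` ?N) = 0"
      using tangent_finite[of v] emeasure_lborel_countable countable_finite by metis
  qed
  finally have "?N \<in> null_sets lborel" using N by (auto simp: null_sets_def)
  from AE_not_in[OF this] show ?thesis by (rule AE_mp) simp
qed

abbreviation dd :: "real \<times> real \<Rightarrow> real" where
  "dd p \<equiv> hdist_dd (c (fst p)) (c' (fst p)) (c (snd p)) (c' (snd p))"

text \<open>The coordinate change is \<open>ends\<close>. On tangents, which form a null set,
  \<open>h\<close> is required to be constant: an arbitrary \<open>h\<close> there could fail to be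
  measurable for the sigma-algebra of \<open>liouville\<close>.\<close>

lemma
  fixes h :: "complex set \<Rightarrow> real" and \<phi> :: "real \<times> real \<Rightarrow> real" and \<kappa> :: real
  assumes chords: "\<And>s t u v. (s, t) \<in> chord_pairs \<Longrightarrow> ends (s, t) = (u, v) \<Longrightarrow>
      h (range (semicircle_line u v)) = \<phi> (s, t)"
    and cont: "continuous_on chord_pairs \<phi>"
    and tangents: "\<And>u v x. u < v \<Longrightarrow> {y. semicircle_line u v y \<in> D} = {x} \<Longrightarrow>
      h (range (semicircle_line u v)) = \<kappa>"
  shows set_integrable_geodesics_iff: "set_integrable liouville (geodesics_meeting D) h \<longleftrightarrow>
      integrable lborel (\<lambda>p. indicator chord_pairs p * (dd p / 2 * \<phi> p))"
    and set_lebesgue_integral_geodesics: "(LINT \<gamma>:geodesics_meeting D|liouville. h \<gamma>) =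
      integral\<^sup>L lborel (\<lambda>p. indicator chord_pairs p * (dd p / 2 * \<phi> p))"
proof -
  define H where "H = (\<lambda>(u, v). if u < v \<and> range (semicircle_line u v) \<in> geodesics_meeting D
      then h (range (semicircle_line u v)) else 0)"
  define E where "E = ends ` chord_pairs"
  define \<psi> where "\<psi> = (\<lambda>q. if q \<in> E then \<phi> (the_inv_into chord_pairs ends q) else 0)"
  obtain C where C: "chord_pairs = (\<Union>n::nat. C n)" "\<And>n. compact (C n)"
    using chord_pairs_sigma_compact by blast
  have E: "E \<in> sets borel" unfolding E_def by (rule sets_ends_chord_pairs)
  have \<psi>: "\<psi> \<in> borel_measurable borel"
    unfolding \<psi>_def E_def
    by (rule borel_measurable_inverse_sigma_compact[OF C continuous_on_ends inj_on_ends cont])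
  have HE: "H (ends p) = \<phi> p" if p: "p \<in> chord_pairs" for p
  proof -
    obtain s t where st: "p = (s, t)" by fastforce
    obtain u v where uv: "ends (s, t) = (u, v)" by fastforce
    show ?thesis
      unfolding st uv using chord(1)[OF p[unfolded st] uv] chord_length_ends(2)[OF p[unfolded st] uv]
        chords[OF p[unfolded st] uv] by (simp add: H_def)
  qed
  have H_eq: "H q = (if q \<in> E then \<psi> q else if q \<in> meeting_ends then \<kappa> else 0)" for q
  proof -
    obtain u v where uv: "q = (u, v)" by fastforce
    consider "q \<in> E" | "q \<in> meeting_ends - E" | "q \<notin> E" "q \<notin> meeting_ends" by blast
    then show ?thesis
    proof cases
      case 1
      then obtain p where p: "p \<in> chord_pairs" "q = ends p" by (auto simp: E_def)
      then show ?thesis using 1 HE[OF p(1)] by (simp add: \<psi>_def the_inv_into_f_f[OF inj_on_ends p(1)])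
    next
      case 2
      then obtain z where "u < v" "{x. semicircle_line u v x \<in> D} = {z}"
        using tangent_ends[of u v] unfolding uv E_def by blast
      then have "h (range (semicircle_line u v)) = \<kappa>" by (rule tangents)
      then show ?thesis using 2 by (auto simp: H_def uv meeting_ends_def)
    next
      case 3
      then show ?thesis by (auto simp: H_def uv meeting_ends_def)
    qed
  qed
  have H: "H \<in> borel_measurable borel"
    unfolding H_eq[abs_def] using E sets_meeting_ends \<psi> by (intro measurable_If_set) auto
  have sub: "geodesics_meeting D \<subseteq> geodesics" by (auto simp: geodesics_meeting_def)
  define F where "F = (\<lambda>q. H q / (snd q - fst q)\<^sup>2)"
  have F: "F \<in> borel_measurable borel"
    unfolding F_def
    by (intro borel_measurable_divide H borel_measurable_continuous_onI continuous_intros)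
  have Feq: "(\<lambda>(u, v). if u < v \<and> range (semicircle_line u v) \<in> geodesics_meeting D
        then h (range (semicircle_line u v)) / (v - u)\<^sup>2 else 0) = F"
    by (auto simp: F_def H_def fun_eq_iff)
  have EF: "(\<lambda>q. indicator E q * F q) \<in> borel_measurable borel"
    using E F by (intro borel_measurable_times borel_measurable_indicator) auto
  have F0: "F q = 0" if "q \<notin> meeting_ends" for q
    using that E ends_chord_pairs_subset by (auto simp: F_def H_eq E_def)
  \<comment> \<open>\<open>F\<close> vanishes off \<open>meeting_ends\<close>, and the endpoint
    pairs of tangents form a null set.\<close>
  have AE: "AE q in lborel. F q = indicator E q * F q"
    using tangent_null by (rule AE_mp) (auto intro!: AE_I2 simp: E_def[symmetric] F0 split: split_indicator)
  define as where "as = (\<lambda>p. hdist_tra (c (fst p)) (c' (fst p)) (c (snd p)) / (2 * (Re (c (fst p)) - Re (c (snd p)))\<^sup>2))"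
  define at' where "at' = (\<lambda>p. hdist_tra (c (snd p)) (c' (snd p)) (c (fst p)) / (2 * (Re (c (fst p)) - Re (c (snd p)))\<^sup>2))"
  define rs where "rs = (\<lambda>p. - (Re (c (snd p)) - geod_centre (c (fst p)) (c (snd p))) / geod_radius (c (fst p)) (c (snd p)))"
  define rt where "rt = (\<lambda>p. - (Re (c (fst p)) - geod_centre (c (fst p)) (c (snd p))) / geod_radius (c (fst p)) (c (snd p)))"
  let ?J = "\<lambda>p. (as p - rs p * as p) * (at' p + rt p * at' p) - (at' p - rt p * at' p) * (as p + rs p * as p)"
  have der: "(ends has_derivative (\<lambda>(h, k). ((as p - rs p * as p) * h + (at' p - rt p * at' p) * k,
      (as p + rs p * as p) * h + (at' p + rt p * at' p) * k))) (at p within chord_pairs)" if "p \<in> chord_pairs" for p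
    using has_derivative_ideal_ends[OF c_deriv c_deriv c_pos c_pos, of "fst p" "snd p"] that
    unfolding ends_def[abs_def] as_def at'_def rs_def rt_def chord_pairs_def by simp
  \<comment> \<open>Since v - u is twice the radius, the Jacobian and the Liouville density combine
    to \<open>dd p / 2\<close>, and positivity of \<open>dd\<close> removes the absolute
    value.\<close>
  have J: "indicator chord_pairs p * (\<bar>?J p\<bar> * F (ends p)) = indicator chord_pairs p * (dd p / 2 * \<phi> p)" for p
  proof (cases "p \<in> chord_pairs")
    case True
    obtain s t where st: "p = (s, t)" by fastforce
    define r where "r = geod_radius (c s) (c t)"
    have r: "r > 0" unfolding r_def by (rule geod_radius_pos[OF c_pos])
    have less: "Re (c s) < Re (c t)" using True by (simp add: st chord_pairs_def)
    have J1: "?J p / (2 * r)\<^sup>2 = dd p / 2"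
      using jacobian_ideal_ends[OF c_deriv c_deriv c_pos c_pos less]
      unfolding as_def at'_def rs_def rt_def st r_def by simp
    have ddpos: "dd p > 0"
      using hdist_dd_pos[OF chord_pairs_not_int[of s t]] True by (simp add: st)
    have abs_div: "\<bar>j\<bar> / x = y" if "j / x = y" "y > 0" "x > 0" for j x y :: real
    proof -
      have "j = y * x" using that by auto
      then show ?thesis using that(2,3) by simp
    qed
    have "\<bar>?J p\<bar> / (2 * r)\<^sup>2 = dd p / 2"
      by (rule abs_div[OF J1]) (use ddpos r in simp_all)
    moreover have "F (ends p) = \<phi> p / (2 * r)\<^sup>2"
      unfolding F_def HE[OF True] by (simp add: ends_def ideal_ends_def st r_def)
    ultimately have "\<bar>?J p\<bar> * F (ends p) = dd p / 2 * \<phi> p"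
      by (simp only: times_divide_eq_right times_divide_eq_left[symmetric])
    then show ?thesis by simp
  qed simp
  have ne: "c (fst p) \<noteq> c (snd p)" if "p \<in> chord_pairs" for p
    using that by (auto simp: chord_pairs_def)
  have m1: "(\<lambda>p. indicator chord_pairs p * (dd p / 2 * \<phi> p)) \<in> borel_measurable borel"
    using borel_measurable_continuous_on_indicator[OF sets_chord_pairs, of "\<lambda>p. dd p / 2 * \<phi> p"]
      continuous_on_mult[OF continuous_on_divide[OF continuous_on_hdist_dd[OF ne] continuous_on_const] cont]
    by simp
  note cv = integrable_change_of_variables_prod[OF sets_chord_pairs der inj_on_ends, of F, unfolded J, OF _ m1]
    and cv' = integral_change_of_variables_prod[OF sets_chord_pairs der inj_on_ends, of F, unfolded J, OF _ m1]
  have "set_integrable liouville (geodesics_meeting D) h \<longleftrightarrow> integrable lborel F"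
    using set_integrable_liouville_iff[OF sub H[unfolded H_def]] unfolding Feq .
  also have "\<dots> \<longleftrightarrow> integrable lborel (\<lambda>q. indicator E q * F q)"
    by (rule integrable_cong_AE[OF _ _ AE]) (use F EF in simp_all)
  also have "\<dots> \<longleftrightarrow> integrable lborel (\<lambda>p. indicator chord_pairs p * (dd p / 2 * \<phi> p))"
    unfolding E_def by (rule cv) (use EF in \<open>simp_all add: E_def\<close>)
  finally show "set_integrable liouville (geodesics_meeting D) h \<longleftrightarrow>
      integrable lborel (\<lambda>p. indicator chord_pairs p * (dd p / 2 * \<phi> p))" .
  have "(LINT \<gamma>:geodesics_meeting D|liouville. h \<gamma>) = integral\<^sup>L lborel F"
    using set_lebesgue_integral_liouville[OF sub H[unfolded H_def]] unfolding Feq .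
  also have "\<dots> = integral\<^sup>L lborel (\<lambda>q. indicator E q * F q)"
    by (rule integral_cong_AE[OF _ _ AE]) (use F EF in simp_all)
  also have "\<dots> = integral\<^sup>L lborel (\<lambda>p. indicator chord_pairs p * (dd p / 2 * \<phi> p))"
    unfolding E_def by (rule cv') (use EF in \<open>simp_all add: E_def\<close>)
  finally show "(LINT \<gamma>:geodesics_meeting D|liouville. h \<gamma>) =
      integral\<^sup>L lborel (\<lambda>p. indicator chord_pairs p * (dd p / 2 * \<phi> p))" .
qed

end


section \<open>Integration over pairs of boundary points\<close>

text \<open>In the application \<open>P\<close> involves \<open>hdist_d\<close>, which on the
  diagonal is a quotient by 0, so \<open>P b\<close> has nothing to do with the limit. Replacing
  this one value by the limit gives a continuous function with the same derivative before b.\<close>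

lemma ftc_left_limit:
  fixes P p :: "real \<Rightarrow> real"
  assumes "a < b" and der: "\<And>t. a \<le> t \<Longrightarrow> t < b \<Longrightarrow> (P has_real_derivative p t) (at t)"
    and lim: "(P \<longlongrightarrow> L) (at_left b)"
  shows "(p has_integral (L - P a)) {a..b}"
proof -
  define Q where "Q = P(b := L)"
  have ev: "\<forall>\<^sub>F x in nhds t. P x = Q x" if "t < b" for t
  proof -
    have "\<forall>\<^sub>F x in nhds t. x \<in> {..<b}" using that by (intro eventually_nhds_in_open) auto
    then show ?thesis by (rule eventually_mono) (auto simp: Q_def)
  qed
  have Q: "(Q has_real_derivative p t) (at t)" if "a \<le> t" "t < b" for t
    using der[OF that] DERIV_cong_ev[OF refl ev[OF that(2)] refl] by simp
  have "continuous_on {a..b} Q"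
  proof (unfold continuous_on_eq_continuous_within, intro ballI)
    fix t assume t: "t \<in> {a..b}"
    show "continuous (at t within {a..b}) Q"
    proof (cases "t < b")
      case True
      have "a \<le> t" using t by simp
      from DERIV_isCont[OF Q[OF this True]] show ?thesis
        by (rule continuous_at_imp_continuous_at_within)
    next
      case False
      then have tb: "t = b" using t by simp
      have "(Q \<longlongrightarrow> L) (at_left b)"
        using lim by (rule Lim_transform_eventually) (auto simp: eventually_at_filter Q_def)
      then show ?thesis
        unfolding tb continuous_within using assms(1) by (simp add: at_within_Icc_at_left Q_def)
    qed
  qed
  then have "(p has_integral (Q b - Q a)) {a..b}"
    using assms(1) Q by (intro fundamental_theorem_of_calculus_interior)
      (auto simp: has_real_derivative_iff_has_vector_derivative[symmetric])
  then show ?thesis using assms(1) by (simp add: Q_def)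
qed

lemma ftc_right_limit:
  fixes P p :: "real \<Rightarrow> real"
  assumes "a < b" and der: "\<And>t. a < t \<Longrightarrow> t \<le> b \<Longrightarrow> (P has_real_derivative p t) (at t)"
    and lim: "(P \<longlongrightarrow> L) (at_right a)"
  shows "(p has_integral (P b - L)) {a..b}"
proof -
  \<comment> \<open>Reflection at 0 turns the limit from the right into a limit from the
    left.\<close>
  have "((\<lambda>t. - p (- t)) has_integral (L - P (- (- b)))) {- b..- a}"
  proof (rule ftc_left_limit)
    fix t assume "- b \<le> t" "t < - a"
    then have P: "(P has_real_derivative p (- t)) (at (- t))" by (intro der) auto
    have "((\<lambda>t :: real. - t) has_real_derivative - 1) (at t)" by (auto intro!: derivative_eq_intros)
    from DERIV_chain2[OF P this] show "((\<lambda>t. P (- t)) has_real_derivative - p (- t)) (at t)" by simp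
  next
    show "((\<lambda>t. P (- t)) \<longlongrightarrow> L) (at_left (- a))"
      unfolding filterlim_at_left_to_right[of "\<lambda>t. P (- t)"] using lim by simp
  qed (use assms(1) in simp)
  from has_integral_neg[OF this] have "((\<lambda>t. p (- t)) has_integral (P b - L)) {- b..- a}" by simp
  then show ?thesis
    using has_integral_reflect_real[of p "P b - L" a b] by simp
qed

section \<open>The square of all parameter pairs without its diagonal\<close>

context smooth_domain
begin

abbreviation \<rho> :: "real \<times> real \<Rightarrow> real" where
  "\<rho> p \<equiv> hdist (c (fst p)) (c (snd p))"

abbreviation d1 :: "real \<times> real \<Rightarrow> real" where
  "d1 p \<equiv> hdist_d (c (fst p)) (c' (fst p)) (c (snd p))"

abbreviation d2 :: "real \<times> real \<Rightarrow> real" where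
  "d2 p \<equiv> hdist_d (c (snd p)) (c' (snd p)) (c (fst p))"

definition speed :: "real \<Rightarrow> real" where
  "speed s = norm (c' s) / Im (c s)"

lemma speed_eq: "speed = hyp_speed c"
  by (simp add: fun_eq_iff speed_def hyp_speed_def c'_def)

lemma continuous_speed: "continuous_on S speed"
  unfolding speed_def
  by (intro continuous_intros continuous_c continuous_c') (simp add: less_imp_neq[OF c_pos, symmetric])

lemma speed_nonneg: "0 \<le> speed s"
  using c_pos[of s] by (simp add: speed_def)

definition square :: "(real \<times> real) set" where
  "square = {p \<in> {0..<1} \<times> {0..<1}. fst p \<noteq> snd p}"

lemma sets_square: "square \<in> sets borel"
proof -
  have "square = ({0..<1} \<times> {0..<1}) \<inter> - {p. fst p = snd p}" by (auto simp: square_def)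
  moreover have "{0..<1} \<times> {0..<1} \<in> sets (borel :: (real \<times> real) measure)"
    unfolding borel_prod[symmetric] by (intro pair_measureI) auto
  moreover have "closed {p :: real \<times> real. fst p = snd p}"
    by (intro closed_Collect_eq continuous_intros)
  ultimately show ?thesis by (metis borel_closed borel_comp sets.Int)
qed

lemma square_ne: "p \<in> square \<Longrightarrow> c (fst p) \<noteq> c (snd p)"
  using c_eq_iff_unit[of "fst p" "snd p"] by (auto simp: square_def)

lemma chord_pairs_subset_square: "chord_pairs \<subseteq> square"
  by (auto simp: chord_pairs_def square_def)

lemma integrable_square:
  fixes g :: "real \<times> real \<Rightarrow> real"
  assumes "continuous_on square g" "\<And>p. p \<in> square \<Longrightarrow> \<bar>g p\<bar> \<le> B"
  shows "integrable lborel (\<lambda>p. indicator square p * g p)"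
proof -
  have "square \<subseteq> cbox (0, 0) (1, 1)" by (auto simp: square_def cbox_Pair_eq)
  then have "emeasure lborel square \<le> emeasure lborel (cbox (0, 0) (1, 1) :: (real \<times> real) set)"
    by (rule emeasure_mono) (simp add: sets_lborel borel_closed)
  then have fin: "emeasure lborel square < \<infinity>"
    using emeasure_lborel_cbox_finite[of "(0, 0) :: real \<times> real" "(1, 1)"] by (simp add: order_le_less_trans)
  have "integrable lborel (indicator square :: real \<times> real \<Rightarrow> real)"
    using sets_square by (intro integrable_real_indicator fin) simp
  then have i: "integrable lborel (\<lambda>p. indicator square p * B)" by simp
  have m: "(\<lambda>p. indicator square p * g p) \<in> borel_measurable lborel"
    using borel_measurable_continuous_on_indicator[OF sets_square assms(1)] by simp
  show ?thesis
    by (rule Bochner_Integration.integrable_bound[OF i m]) (auto simp: indicator_def dest!: assms(2))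
qed

lemma bounded_on_square:
  fixes g :: "real \<times> real \<Rightarrow> real"
  assumes "continuous_on UNIV g"
  obtains B :: real where "B \<ge> 0" "\<And>p. p \<in> square \<Longrightarrow> \<bar>g p\<bar> \<le> B"
proof -
  have "compact (g ` cbox (0, 0) (1, 1))"
    by (rule compact_continuous_image[OF continuous_on_subset[OF assms] compact_cbox]) simp
  then obtain B where "\<And>x. x \<in> g ` cbox (0, 0) (1, 1) \<Longrightarrow> norm x \<le> B"
    using compact_imp_bounded bounded_iff by metis
  then have B: "\<bar>g p\<bar> \<le> B" if "p \<in> square" for p
    using that by (force simp: square_def cbox_Pair_eq)
  show thesis
  proof (rule that[of "\<bar>B\<bar>"])
    fix p assume "p \<in> square"
    then show "\<bar>g p\<bar> \<le> \<bar>B\<bar>" using B[of p] by simp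
  qed simp
qed

lemma dd_nonneg: "0 \<le> dd p"
proof (cases "fst p - snd p \<in> \<int>")
  case True
  then have "c (fst p) = c (snd p)" by (simp add: c_eq_iff)
  \<comment> \<open>\<open>hdist_dd\<close> is a fraction with denominator 0 here\<close>
  then show ?thesis by (simp add: hdist_dd_def hdist_root_def)
next
  case False
  then show ?thesis using hdist_dd_pos[of "fst p" "snd p"] by simp
qed

lemma continuous_on_square:
  "continuous_on square dd" "continuous_on square d1" "continuous_on square d2"
  by (rule continuous_on_hdist_dd[OF square_ne], assumption,
      rule continuous_on_hdist_d(1)[OF square_ne], assumption,
      rule continuous_on_hdist_d(2)[OF square_ne], assumption)

end

text \<open>A locale of its own, because the row computation is used for two functions: the given f
  and the constant 1, which yields the integrability of \<open>dd\<close>.\<close>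

locale smooth_domain_fun = smooth_domain +
  fixes f :: "real \<Rightarrow> real"
  assumes f: "f C1_differentiable_on UNIV"
begin

lemma f_deriv: "(f has_real_derivative deriv f x) (at x)"
  using f unfolding C1_differentiable_on_def has_real_derivative_iff_has_vector_derivative[symmetric]
  by (metis DERIV_imp_deriv UNIV_I)

lemma continuous_deriv_f: "continuous_on S (deriv f)"
proof -
  obtain F where F: "\<And>x. (f has_real_derivative F x) (at x)" "continuous_on UNIV F"
    using f unfolding C1_differentiable_on_def has_real_derivative_iff_has_vector_derivative[symmetric] by auto
  then have "deriv f = F" by (auto intro: DERIV_imp_deriv)
  then show ?thesis using F(2) continuous_on_subset by blast
qed

lemma continuous_f: "continuous_on S f"
  using f_deriv DERIV_isCont by (auto intro!: continuous_at_imp_continuous_on)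

definition density2 :: "real \<times> real \<Rightarrow> real" where
  "density2 p = f (\<rho> p) * dd p + deriv f (\<rho> p) * (d1 p * d2 p)"

lemma row_derivative:
  assumes "c s \<noteq> c t"
  shows "((\<lambda>t. f (\<rho> (s, t)) * d1 (s, t)) has_real_derivative density2 (s, t)) (at t)"
proof -
  have 1: "((\<lambda>t. hdist (c s) (c t)) has_real_derivative d2 (s, t)) (at t)"
    using has_real_derivative_hdist[OF c_deriv c_pos c_pos assms] by simp
  have 2: "((\<lambda>t. d1 (s, t)) has_real_derivative dd (s, t)) (at t)"
    using has_real_derivative_hdist_d[OF c_deriv c_pos c_pos assms] by simp
  show ?thesis
    using DERIV_mult[OF DERIV_chain2[OF f_deriv 1] 2] by (simp add: density2_def algebra_simps)
qed

text \<open>f of the distance is continuous across the diagonal with value \<open>f 0\<close> there,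
  so the jump is that of the first variation.\<close>

lemma row_limits:
  shows "((\<lambda>t. f (\<rho> (s, t)) * d1 (s, t)) \<longlongrightarrow> f 0 * speed s) (at_left s)"
    and "((\<lambda>t. f (\<rho> (s, t)) * d1 (s, t)) \<longlongrightarrow> - (f 0 * speed s)) (at_right s)"
proof -
  have lim: "((\<lambda>t. sgn (t - s) * d1 (s, t)) \<longlongrightarrow> - speed s) (at s)"
    using tendsto_hdist_d_diagonal[OF c_deriv c_pos c'_nonzero, of s] by (simp add: speed_def)
  have "continuous_on UNIV (\<lambda>t. f (hdist (c s) (c t)))"
    by (intro continuous_on_compose2[OF continuous_f[of UNIV]] continuous_on_hdist continuous_intros continuous_c c_pos) auto
  then have "isCont (\<lambda>t. f (hdist (c s) (c t))) s" by (simp add: continuous_on_eq_continuous_at)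
  then have lf: "((\<lambda>t. f (\<rho> (s, t))) \<longlongrightarrow> f 0) (at s)"
    using c_pos[of s] by (simp add: isCont_def)
  have "((\<lambda>t. f (\<rho> (s, t)) * (sgn (t - s) * d1 (s, t))) \<longlongrightarrow> f 0 * - speed s) (at s)"
    by (rule tendsto_mult[OF lf lim])
  then have l: "((\<lambda>t. f (\<rho> (s, t)) * (sgn (t - s) * d1 (s, t))) \<longlongrightarrow> f 0 * - speed s) (at_left s)"
    and r: "((\<lambda>t. f (\<rho> (s, t)) * (sgn (t - s) * d1 (s, t))) \<longlongrightarrow> f 0 * - speed s) (at_right s)"
    by (auto intro: filterlim_mono at_le)
  have "((\<lambda>t. - (f (\<rho> (s, t)) * (sgn (t - s) * d1 (s, t)))) \<longlongrightarrow> - (f 0 * - speed s)) (at_left s)"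
    by (rule tendsto_minus[OF l])
  then have "((\<lambda>t. f (\<rho> (s, t)) * d1 (s, t)) \<longlongrightarrow> - (f 0 * - speed s)) (at_left s)"
    by (rule Lim_transform_eventually) (auto simp: eventually_at_filter)
  then show "((\<lambda>t. f (\<rho> (s, t)) * d1 (s, t)) \<longlongrightarrow> f 0 * speed s) (at_left s)" by simp
  have "((\<lambda>t. f (\<rho> (s, t)) * d1 (s, t)) \<longlongrightarrow> f 0 * - speed s) (at_right s)"
    using r by (rule Lim_transform_eventually) (auto simp: eventually_at_filter)
  then show "((\<lambda>t. f (\<rho> (s, t)) * d1 (s, t)) \<longlongrightarrow> - (f 0 * speed s)) (at_right s)" by simp
qed

lemma row_integral:
  assumes s: "0 < s" "s < 1"
  shows "((\<lambda>t. density2 (s, t)) has_integral 2 * f 0 * speed s) {0..1}"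
proof -
  let ?P = "\<lambda>t. f (\<rho> (s, t)) * d1 (s, t)"
  have ne: "c s \<noteq> c t" if "t \<noteq> s" "0 \<le> t" "t \<le> 1" for t
  proof -
    have "\<bar>s - t\<bar> < 1" using that s by (simp add: abs_less_iff)
    then show ?thesis unfolding c_eq_iff using that Ints_nonzero_abs_less1[of "s - t"] by auto
  qed
  have "((\<lambda>t. density2 (s, t)) has_integral (f 0 * speed s - ?P 0)) {0..s}"
    using s by (intro ftc_left_limit row_derivative row_limits ne) auto
  moreover have "((\<lambda>t. density2 (s, t)) has_integral (?P 1 - - (f 0 * speed s))) {s..1}"
    using s by (intro ftc_right_limit row_derivative row_limits ne) auto
  ultimately have "((\<lambda>t. density2 (s, t)) has_integral (f 0 * speed s - ?P 0) + (?P 1 - - (f 0 * speed s))) {0..1}"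
    using s by (intro has_integral_combine[of 0 s 1]) auto
  \<comment> \<open>Periodicity cancels the terms at t = 0 and t = 1. The two sides of the diagonal
    contribute \<open>f 0 * speed s\<close> each.\<close>
  moreover have "c 1 = c 0" by (simp add: c_eq_iff)
  ultimately show ?thesis by (simp add: mult.assoc)
qed

lemma continuous_on_f_\<rho>: "continuous_on UNIV (\<lambda>p. f (\<rho> p))"
  and continuous_on_deriv_f_\<rho>: "continuous_on UNIV (\<lambda>p. deriv f (\<rho> p))"
  by (intro continuous_on_compose2[OF continuous_f[of UNIV] continuous_on_hdist_c] subset_UNIV
      continuous_on_compose2[OF continuous_deriv_f[of UNIV] continuous_on_hdist_c])+

text \<open>Each first variation is at most the speed of the moving endpoint, so the integrand is
  bounded up to the diagonal.\<close>

lemma integrable_d1_d2: "integrable lborel (\<lambda>p. indicator square p * (deriv f (\<rho> p) * (d1 p * d2 p)))"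
proof -
  obtain B where B: "B \<ge> 0" "\<And>p. p \<in> square \<Longrightarrow> \<bar>deriv f (\<rho> p)\<bar> \<le> B"
    by (rule bounded_on_square[OF continuous_on_deriv_f_\<rho>]) blast
  have "continuous_on UNIV (\<lambda>p :: real \<times> real. speed (fst p) * speed (snd p))"
    by (intro continuous_on_mult continuous_on_compose2[OF continuous_speed[of UNIV]] continuous_intros) auto
  then obtain B' where B': "B' \<ge> 0" "\<And>p. p \<in> square \<Longrightarrow> \<bar>speed (fst p) * speed (snd p)\<bar> \<le> B'"
    by (rule bounded_on_square) blast
  have bound: "\<bar>deriv f (\<rho> p) * (d1 p * d2 p)\<bar> \<le> B * B'" if p: "p \<in> square" for p
  proof -
    have "\<bar>d1 p\<bar> \<le> speed (fst p)" "\<bar>d2 p\<bar> \<le> speed (snd p)"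
      unfolding speed_def
      by (rule abs_hdist_d_le[OF c_pos c_pos square_ne[OF p]],
          rule abs_hdist_d_le[OF c_pos c_pos square_ne[OF p, symmetric]])
    then have "\<bar>d1 p * d2 p\<bar> \<le> speed (fst p) * speed (snd p)"
      unfolding abs_mult by (intro mult_mono speed_nonneg) auto
    also have "\<dots> \<le> B'" using B'(2)[OF p] by simp
    finally show ?thesis unfolding abs_mult[of "deriv f (\<rho> p)"] using B(2)[OF p] B(1) by (intro mult_mono) auto
  qed
  show ?thesis
    by (rule integrable_square[OF _ bound])
      (intro continuous_on_mult continuous_on_square continuous_on_subset[OF continuous_on_deriv_f_\<rho>] subset_UNIV)
qed

end

section \<open>Integrability of the mixed derivative\<close>

context smooth_domain
begin

lemma integrable_dd: "integrable lborel (\<lambda>p. indicator square p * dd p)"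
proof -
  \<comment> \<open>For a constant function the second summand of \<open>density2\<close> vanishes,
    and the row integral is that of \<open>dd\<close> alone.\<close>
  interpret one: smooth_domain_fun D c "\<lambda>_. 1"
    by unfold_locales simp
  have row: "((\<lambda>t. dd (s, t)) has_integral 2 * speed s) {0..1}" if "0 < s" "s < 1" for s
    using one.row_integral[OF that] by (simp add: one.density2_def)
  obtain B where B: "\<And>s. s \<in> {0..1} \<Longrightarrow> speed s \<le> B"
  proof -
    have "compact (speed ` {0..1})"
      by (rule compact_continuous_image[OF continuous_speed compact_Icc])
    then obtain B where "\<And>x. x \<in> speed ` {0..1} \<Longrightarrow> norm x \<le> B"
      using compact_imp_bounded bounded_iff by metis
    then show thesis using that[of B] by force
  qed
  have m: "(\<lambda>p. indicator square p * dd p) \<in> borel_measurable borel"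
    using borel_measurable_continuous_on_indicator[OF sets_square continuous_on_square(1)] by simp
  then have m': "(\<lambda>p. ennreal (indicator square p * dd p)) \<in> borel_measurable (lborel \<Otimes>\<^sub>M lborel)"
    by (simp add: lborel_prod)
  have "(\<integral>\<^sup>+ p. ennreal (indicator square p * dd p) \<partial>lborel) = (\<integral>\<^sup>+ p. ennreal (indicator square p * dd p) \<partial>(lborel \<Otimes>\<^sub>M lborel))"
    by (simp add: lborel_prod)
  also have "\<dots> = (\<integral>\<^sup>+ s. \<integral>\<^sup>+ t. ennreal (indicator square (s, t) * dd (s, t)) \<partial>lborel \<partial>lborel)"
    by (rule lborel.nn_integral_fst[OF m', symmetric])
  also have "\<dots> \<le> (\<integral>\<^sup>+ (s::real). ennreal (2 * B) * indicator {0..1} s \<partial>lborel)"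
  proof (rule nn_integral_mono_AE)
    \<comment> \<open>For s = 0 the diagonal lies at an end of the row, a case that
      \<open>row_integral\<close> does not cover.\<close>
    have "AE s in lborel. s \<noteq> (0 :: real)" by (rule AE_lborel_singleton)
    then show "AE s in lborel. (\<integral>\<^sup>+ t. ennreal (indicator square (s, t) * dd (s, t)) \<partial>lborel) \<le> ennreal (2 * B) * indicator {0..1} s"
    proof (rule AE_mp, intro AE_I2 impI)
      fix s :: real assume s0: "s \<noteq> 0"
      show "(\<integral>\<^sup>+ t. ennreal (indicator square (s, t) * dd (s, t)) \<partial>lborel) \<le> ennreal (2 * B) * indicator {0..1} s"
      proof (cases "0 < s \<and> s < 1")
        case True
        have "(\<integral>\<^sup>+ t. ennreal (indicator square (s, t) * dd (s, t)) \<partial>lborel)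
            \<le> (\<integral>\<^sup>+ t. ennreal (dd (s, t)) * indicator {0..1} t \<partial>lborel)"
          by (rule nn_integral_mono) (auto simp: square_def indicator_def)
        also have "\<dots> = ennreal (2 * speed s)"
          using row True dd_nonneg by (intro nn_integral_has_integral_lebesgue') auto
        also have "\<dots> \<le> ennreal (2 * B)" using B[of s] True by (intro ennreal_leI) auto
        finally show ?thesis using True by simp
      next
        case False
        then have "indicator square (s, t) = (0 :: real)" for t using s0 by (auto simp: square_def indicator_def)
        then show ?thesis by simp
      qed
    qed
  qed
  also have "\<dots> < \<infinity>" by (simp add: nn_integral_cmult ennreal_mult_less_top)
  finally show ?thesis
    using m dd_nonneg by (intro integrableI_nonneg) auto
qed

end

section \<open>Symmetry of the square\<close>

context smooth_domain
begin

text \<open>For fixed s only finitely many t are exceptional, by the bound on boundary points of a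
  vertical line; Fubini then gives measure 0.\<close>

lemma Re_eq_null: "AE p in lborel. p \<in> square \<longrightarrow> Re (c (fst p)) \<noteq> Re (c (snd p))"
proof -
  let ?N = "{p \<in> square. Re (c (fst p)) = Re (c (snd p))}"
  have "closed {p :: real \<times> real. Re (c (fst p)) = Re (c (snd p))}"
    by (intro closed_Collect_eq continuous_intros continuous_on_boundary)
  then have "square \<inter> {p. Re (c (fst p)) = Re (c (snd p))} \<in> sets borel"
    by (intro sets.Int sets_square borel_closed)
  then have N: "?N \<in> sets borel" by (simp add: Int_def)
  have "emeasure (lborel :: (real \<times> real) measure) ?N = emeasure (lborel \<Otimes>\<^sub>M lborel) ?N"
    by (simp add: lborel_prod)
  also have "\<dots> = (\<integral>\<^sup>+ s. emeasure lborel (Pair s -` ?N) \<partial>lborel)"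
    using N by (intro lborel.emeasure_pair_measure_alt) (simp only: lborel_prod sets_lborel)
  also have "\<dots> = (\<integral>\<^sup>+ (s::real). 0 \<partial>lborel)"
  proof (rule nn_integral_cong)
    fix s :: real
    have "Pair s -` ?N \<subseteq> {t \<in> {0..<1}. Re (c t) = Re (c s)}" by (auto simp: square_def)
    then have "finite (Pair s -` ?N)" using finite_vertical_pairs by (rule finite_subset)
    then show "emeasure lborel (Pair s -` ?N) = 0"
      by (intro emeasure_lborel_countable countable_finite)
  qed
  finally have "?N \<in> null_sets lborel" using N by (auto simp: null_sets_def)
  from AE_not_in[OF this] show ?thesis by (rule AE_mp) simp
qed

text \<open>Up to the null set of pairs with equal real parts, the square is the disjoint union of
  \<open>chord_pairs\<close> and its mirror image in the diagonal.\<close>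

lemma
  fixes k :: "real \<times> real \<Rightarrow> real"
  assumes int: "integrable lborel (\<lambda>p. indicator square p * k p)"
  shows integrable_chord_pairs: "integrable lborel (\<lambda>p. indicator chord_pairs p * k p)"
    and integral_square_symmetric: "(\<And>s t. k (t, s) = k (s, t)) \<Longrightarrow>
      integral\<^sup>L lborel (\<lambda>p. indicator square p * k p) = 2 * integral\<^sup>L lborel (\<lambda>p. indicator chord_pairs p * k p)"
proof -
  define F where "F = (\<lambda>p. indicator chord_pairs p * k p)"
  have "integrable lborel (\<lambda>p. indicator chord_pairs p *\<^sub>R (indicator square p * k p))"
    using sets_chord_pairs by (intro integrable_mult_indicator int) simp
  also have "(\<lambda>p. indicator chord_pairs p *\<^sub>R (indicator square p * k p)) = F"
    using chord_pairs_subset_square by (auto simp: F_def indicator_def fun_eq_iff)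
  finally have F: "integrable lborel F" .
  then show "integrable lborel (\<lambda>p. indicator chord_pairs p * k p)" by (simp add: F_def)
  assume sym: "\<And>s t. k (t, s) = k (s, t)"
  have F': "integrable (lborel \<Otimes>\<^sub>M lborel) F" using F by (simp only: lborel_prod)
  have swap: "integrable lborel (\<lambda>(s, t). F (t, s))"
    using F' lborel_pair.integrable_product_swap_iff[of F] by (simp only: lborel_prod)
  have swap': "integral\<^sup>L lborel (\<lambda>(s, t). F (t, s)) = integral\<^sup>L lborel F"
    using lborel_pair.integral_product_swap[OF borel_measurable_integrable[OF F']] by (simp only: lborel_prod)
  have "AE p in lborel. indicator square p * k p = F p + (\<lambda>(s, t). F (t, s)) p"
  proof (rule AE_mp[OF Re_eq_null], intro AE_I2 impI)
    fix p assume ne: "p \<in> square \<longrightarrow> Re (c (fst p)) \<noteq> Re (c (snd p))"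
    obtain s t where st: "p = (s, t)" by fastforce
    consider "(s, t) \<notin> square" | "(s, t) \<in> square" "Re (c s) < Re (c t)" | "(s, t) \<in> square" "Re (c t) < Re (c s)"
      using ne unfolding st by fastforce
    then show "indicator square p * k p = F p + (\<lambda>(s, t). F (t, s)) p"
      by cases (auto simp: st F_def square_def chord_pairs_def indicator_def sym[of s t])
  qed
  then have "integral\<^sup>L lborel (\<lambda>p. indicator square p * k p) = integral\<^sup>L lborel (\<lambda>p. F p + (\<lambda>(s, t). F (t, s)) p)"
    using int F swap by (intro integral_cong_AE borel_measurable_add borel_measurable_integrable)
  also have "\<dots> = 2 * integral\<^sup>L lborel F"
    using F swap by (simp add: Bochner_Integration.integral_add swap')
  finally show "integral\<^sup>L lborel (\<lambda>p. indicator square p * k p) = 2 * integral\<^sup>L lborel (\<lambda>p. indicator chord_pairs p * k p)"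
    unfolding F_def .
qed

end

section \<open>Fubini over the rows and return to geodesics\<close>

context smooth_domain_fun
begin

lemma integrable_f_dd: "integrable lborel (\<lambda>p. indicator square p * (f (\<rho> p) * dd p))"
proof -
  obtain B where B: "B \<ge> 0" "\<And>p. p \<in> square \<Longrightarrow> \<bar>f (\<rho> p)\<bar> \<le> B"
    by (rule bounded_on_square[OF continuous_on_f_\<rho>]) blast
  have i: "integrable lborel (\<lambda>p. B * (indicator square p * dd p))"
    by (intro integrable_mult_right integrable_dd)
  have "continuous_on square (\<lambda>p. f (\<rho> p) * dd p)"
    by (intro continuous_on_mult continuous_on_square continuous_on_subset[OF continuous_on_f_\<rho>] subset_UNIV)
  from borel_measurable_continuous_on_indicator[OF sets_square this]
  have m: "(\<lambda>p. indicator square p * (f (\<rho> p) * dd p)) \<in> borel_measurable lborel" by simp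
  have "norm (indicator square p * (f (\<rho> p) * dd p)) \<le> norm (B * (indicator square p * dd p))" for p
  proof (cases "p \<in> square")
    case True
    then show ?thesis
      using B(1) mult_right_mono[OF B(2)[OF True] dd_nonneg[of p]] dd_nonneg[of p] by (simp add: abs_mult)
  qed simp
  then show ?thesis by (intro Bochner_Integration.integrable_bound[OF i m]) simp
qed

lemma integrable_density2: "integrable lborel (\<lambda>p. indicator square p * density2 p)"
  using Bochner_Integration.integrable_add[OF integrable_f_dd integrable_d1_d2]
  by (simp add: density2_def distrib_left)

lemma integral_density2:
  "integral\<^sup>L lborel (\<lambda>p. indicator square p * density2 p) = 2 * f 0 * hyp_length c 0 1"
proof -
  define G where "G = (\<lambda>p. indicator square p * density2 p)"
  have G: "integrable (lborel \<Otimes>\<^sub>M lborel) G"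
    using integrable_density2 by (simp only: G_def lborel_prod)
  have row: "AE s in lborel. (\<integral>t. G (s, t) \<partial>lborel) = 2 * f 0 * (indicator {0..1} s *\<^sub>R speed s)"
    using lborel_pair.AE_integrable_fst'[OF G] AE_lborel_singleton[of 0] AE_lborel_singleton[of 1]
  proof eventually_elim
    case (elim s)
    show ?case
    proof (cases "0 < s \<and> s < 1")
      case True
      have "((\<lambda>t. if t \<in> {0..1} then density2 (s, t) else 0) has_integral 2 * f 0 * speed s) UNIV"
        using row_integral[of s] True unfolding has_integral_restrict_UNIV by simp
      \<comment> \<open>On the interval from 0 to 1, \<open>G\<close> differs from
        \<open>density2\<close> only on the diagonal t = s and at t = 1, which the half-open square
        omits.\<close>
      then have "((\<lambda>t. G (s, t)) has_integral 2 * f 0 * speed s) UNIV"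
        by (rule has_integral_spike_finite[rotated 2, of _ _ _ "{s, 1}"])
          (use True in \<open>auto simp: G_def square_def indicator_def\<close>)
      moreover have "((\<lambda>t. G (s, t)) has_integral (\<integral>t. G (s, t) \<partial>lborel)) UNIV"
        by (rule has_integral_integral_lborel[OF elim(1)])
      ultimately have "(\<integral>t. G (s, t) \<partial>lborel) = 2 * f 0 * speed s" by (rule has_integral_unique[rotated])
      then show ?thesis using True by simp
    next
      case False
      then have "s \<notin> {0..1}" using elim(2,3) by auto
      moreover from this have "G (s, t) = 0" for t by (auto simp: G_def square_def indicator_def)
      ultimately show ?thesis by simp
    qed
  qed
  have sp: "set_integrable lborel {0..1} speed"
    by (rule borel_integrable_atLeastAtMost'[OF continuous_speed])
  have "integral\<^sup>L lborel G = (\<integral>s. \<integral>t. G (s, t) \<partial>lborel \<partial>lborel)"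
    using lborel_pair.integral_fst'[OF G] by (simp only: lborel_prod)
  also have "\<dots> = (\<integral>s. 2 * f 0 * (indicator {0..1} s *\<^sub>R speed s) \<partial>lborel)"
    using borel_measurable_integrable[OF lborel_pair.integrable_fst'[OF G]]
      borel_measurable_integrable[OF sp[unfolded set_integrable_def]]
    by (intro integral_cong_AE row borel_measurable_times) auto
  also have "\<dots> = 2 * f 0 * (LINT s:{0..1}|lborel. speed s)"
    unfolding set_lebesgue_integral_def by simp
  also have "(LINT s:{0..1}|lborel. speed s) = integral {0..1} speed"
    by (rule set_borel_integral_eq_integral(2)[OF sp])
  also have "\<dots> = hyp_length c 0 1"
    by (simp only: hyp_length_def speed_eq)
  finally show ?thesis unfolding G_def .
qed

text \<open>The row computation singles out the second variable, but the distance and its mixed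
  derivative are symmetric. This is what allows half of the square to stand for
  \<open>chord_pairs\<close>.\<close>

lemma density2_commute: "density2 (t, s) = density2 (s, t)"
  unfolding density2_def by (simp add: hdist_commute[of "c t"] hdist_dd_commute[of "c t"] mult.commute)

lemma tangent_chord_length:
  assumes "u < v" "{y. semicircle_line u v y \<in> D} = {x}"
  shows "chord_length D (range (semicircle_line u v)) = 0"
  using chord_parameters(3)[OF semicircle_line_in_params[OF assms(1)], of x x] assms(2) by simp

lemma
  shows set_integrable_chord_length: "set_integrable liouville (geodesics_meeting D) (\<lambda>\<gamma>. f (chord_length D \<gamma>))"
    and integral_chord_length: "(LINT \<gamma>:geodesics_meeting D|liouville. f (chord_length D \<gamma>)) =
      integral\<^sup>L lborel (\<lambda>p. indicator chord_pairs p * (f (\<rho> p) * dd p)) / 2"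
proof -
  have cont: "continuous_on chord_pairs (\<lambda>p. f (\<rho> p))"
    by (rule continuous_on_subset[OF continuous_on_f_\<rho>]) simp
  have chords: "f (chord_length D (range (semicircle_line u v))) = f (\<rho> (s, t))"
    if "(s, t) \<in> chord_pairs" "ends (s, t) = (u, v)" for s t u v
    using chord_length_ends(1)[OF that] by simp
  have tangents: "f (chord_length D (range (semicircle_line u v))) = f 0"
    if "u < v" "{y. semicircle_line u v y \<in> D} = {x}" for u v x
    by (simp only: tangent_chord_length[OF that])
  have eq: "(\<lambda>p. indicator chord_pairs p * (dd p / 2 * f (\<rho> p))) = (\<lambda>p. indicator chord_pairs p * (f (\<rho> p) * dd p) / 2)"
    by (auto simp: fun_eq_iff)
  show "set_integrable liouville (geodesics_meeting D) (\<lambda>\<gamma>. f (chord_length D \<gamma>))"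
    using set_integrable_geodesics_iff
        [where h = "\<lambda>\<gamma>. f (chord_length D \<gamma>)" and \<phi> = "\<lambda>p. f (\<rho> p)" and \<kappa> = "f 0", OF chords cont tangents] integrable_chord_pairs[OF integrable_f_dd]
    unfolding eq by simp
  show "(LINT \<gamma>:geodesics_meeting D|liouville. f (chord_length D \<gamma>)) =
      integral\<^sup>L lborel (\<lambda>p. indicator chord_pairs p * (f (\<rho> p) * dd p)) / 2"
    using set_lebesgue_integral_geodesics
        [where h = "\<lambda>\<gamma>. f (chord_length D \<gamma>)" and \<phi> = "\<lambda>p. f (\<rho> p)" and \<kappa> = "f 0", OF chords cont tangents] unfolding eq by simp
qed

definition angle_integrand :: "complex set \<Rightarrow> real" where
  "angle_integrand \<gamma> = deriv f (chord_length D \<gamma>) * sinh (chord_length D \<gamma>)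
     * cot (chord_angle_start D c \<gamma>) * cot (chord_angle_end D c \<gamma>)"

lemma
  shows set_integrable_angle_integrand: "set_integrable liouville (geodesics_meeting D) angle_integrand"
    and integral_angle_integrand: "(LINT \<gamma>:geodesics_meeting D|liouville. angle_integrand \<gamma>) =
      - (integral\<^sup>L lborel (\<lambda>p. indicator chord_pairs p * (deriv f (\<rho> p) * (d1 p * d2 p))) / 2)"
proof -
  \<comment> \<open>This is \<open>pleijel_integrand_ends\<close> solved for the integrand. The
    factor \<open>dd p / 2\<close> of the coordinate change removes the denominator again.\<close>
  let ?\<phi> = "\<lambda>p. - (deriv f (\<rho> p) * (d1 p * d2 p)) / dd p"
  have dd: "0 < dd p" if "p \<in> chord_pairs" for p
    using hdist_dd_pos chord_pairs_not_int[of "fst p" "snd p"] that by simp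
  have sub: "continuous_on chord_pairs g" if "continuous_on square g" for g :: "real \<times> real \<Rightarrow> real"
    by (rule continuous_on_subset[OF that chord_pairs_subset_square])
  have cont: "continuous_on chord_pairs ?\<phi>"
    by (intro continuous_on_divide continuous_on_minus continuous_on_mult sub[OF continuous_on_square(1)]
        sub[OF continuous_on_square(2)] sub[OF continuous_on_square(3)]
        continuous_on_subset[OF continuous_on_deriv_f_\<rho>] subset_UNIV) (use dd in force)
  have chords: "angle_integrand (range (semicircle_line u v)) = ?\<phi> (s, t)"
    if p: "(s, t) \<in> chord_pairs" and uv: "ends (s, t) = (u, v)" for s t u v
  proof -
    define X where "X = sinh (chord_length D (range (semicircle_line u v)))
      * cot (chord_angle_start D c (range (semicircle_line u v)))
      * cot (chord_angle_end D c (range (semicircle_line u v)))"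
    have "X * dd (s, t) = - (d1 (s, t) * d2 (s, t))"
      using pleijel_integrand_ends[OF p uv] unfolding X_def by simp
    moreover have "dd (s, t) \<noteq> 0" using dd[OF p] by (rule less_imp_neq[symmetric])
    ultimately have "X = - (d1 (s, t) * d2 (s, t)) / dd (s, t)" by (intro eq_divide_imp)
    moreover have "angle_integrand (range (semicircle_line u v)) = deriv f (\<rho> (s, t)) * X"
      using chord_length_ends(1)[OF p uv] by (simp add: angle_integrand_def X_def mult.assoc)
    ultimately show ?thesis by simp
  qed
  \<comment> \<open>At a tangent the two cotangents are unspecified values, but the chord has length
    0 and sinh 0 = 0.\<close>
  have tangents: "angle_integrand (range (semicircle_line u v)) = 0"
    if "u < v" "{y. semicircle_line u v y \<in> D} = {x}" for u v x
    unfolding angle_integrand_def by (simp only: tangent_chord_length[OF that] sinh_0 mult_zero_right mult_zero_left)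
  have eq: "(\<lambda>p. indicator chord_pairs p * (dd p / 2 * ?\<phi> p))
      = (\<lambda>p. - (indicator chord_pairs p * (deriv f (\<rho> p) * (d1 p * d2 p)) / 2))"
  proof (rule ext)
    fix p
    have "dd p / 2 * ?\<phi> p = - (deriv f (\<rho> p) * (d1 p * d2 p) / 2)" if "p \<in> chord_pairs"
      using dd[OF that] by simp
    then show "indicator chord_pairs p * (dd p / 2 * ?\<phi> p)
        = - (indicator chord_pairs p * (deriv f (\<rho> p) * (d1 p * d2 p)) / 2)"
      by (cases "p \<in> chord_pairs") simp_all
  qed
  show "set_integrable liouville (geodesics_meeting D) angle_integrand"
    using set_integrable_geodesics_iff[where h = angle_integrand and \<phi> = ?\<phi> and \<kappa> = 0, OF chords cont tangents]
      integrable_chord_pairs[OF integrable_d1_d2]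
    unfolding eq by simp
  show "(LINT \<gamma>:geodesics_meeting D|liouville. angle_integrand \<gamma>) =
      - (integral\<^sup>L lborel (\<lambda>p. indicator chord_pairs p * (deriv f (\<rho> p) * (d1 p * d2 p))) / 2)"
    using set_lebesgue_integral_geodesics[where h = angle_integrand and \<phi> = ?\<phi> and \<kappa> = 0, OF chords cont tangents]
    unfolding eq by simp
qed

text \<open>Origin of the constant: the Liouville measure contributes a factor 1/2,
  \<open>chord_pairs\<close> is half of the square, and the square gives 2 f(0) times the boundary
  length, which makes 1/2 in all.\<close>

lemma pleijel_identity:
  "(LINT \<gamma>:geodesics_meeting D|liouville. f (chord_length D \<gamma>)) =
    (LINT \<gamma>:geodesics_meeting D|liouville. angle_integrand \<gamma>) + 1 / 2 * f 0 * hyp_length c 0 1"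
proof -
  let ?I = "\<lambda>k. integral\<^sup>L lborel (\<lambda>p. indicator chord_pairs p * k p)"
  have "?I (\<lambda>p. f (\<rho> p) * dd p) + ?I (\<lambda>p. deriv f (\<rho> p) * (d1 p * d2 p)) = ?I density2"
    using Bochner_Integration.integral_add[OF integrable_chord_pairs[OF integrable_f_dd]
        integrable_chord_pairs[OF integrable_d1_d2]]
    by (simp add: density2_def distrib_left)
  moreover have "2 * ?I density2 = 2 * f 0 * hyp_length c 0 1"
    using integral_square_symmetric[OF integrable_density2 density2_commute] integral_density2 by simp
  ultimately show ?thesis
    unfolding integral_chord_length integral_angle_integrand by simp
qed

end


theorem theorem2:
  fixes D :: "complex set" and c :: "real \<Rightarrow> complex" and f :: "real \<Rightarrow> real"
  assumes "compact_convex_domain D"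
    and "C1_boundary_param D c"
    and "\<not> contains_geodesic_segment (frontier D)"
    and "f C1_differentiable_on UNIV"
  shows "set_integrable liouville (geodesics_meeting D) (\<lambda>\<gamma>. f (chord_length D \<gamma>)) \<and>
    set_integrable liouville (geodesics_meeting D)
      (\<lambda>\<gamma>. deriv f (chord_length D \<gamma>) * sinh (chord_length D \<gamma>)
            * cot (chord_angle_start D c \<gamma>) * cot (chord_angle_end D c \<gamma>)) \<and>
    (LINT \<gamma>:geodesics_meeting D|liouville. f (chord_length D \<gamma>)) =
      (LINT \<gamma>:geodesics_meeting D|liouville.
         deriv f (chord_length D \<gamma>) * sinh (chord_length D \<gamma>)
         * cot (chord_angle_start D c \<gamma>) * cot (chord_angle_end D c \<gamma>))
      + 1 / 2 * f 0 * hyp_length c 0 1 \<and>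
    (f 0 = 0 \<longrightarrow>
      (LINT \<gamma>:geodesics_meeting D|liouville. f (chord_length D \<gamma>)) =
      (LINT \<gamma>:geodesics_meeting D|liouville.
         deriv f (chord_length D \<gamma>) * sinh (chord_length D \<gamma>)
         * cot (chord_angle_start D c \<gamma>) * cot (chord_angle_end D c \<gamma>)))"
proof -
  interpret smooth_domain_fun D c f
    using assms by unfold_locales
  show ?thesis
    using set_integrable_chord_length set_integrable_angle_integrand pleijel_identity
    unfolding angle_integrand_def[abs_def] by simp
qed


end
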